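(* Let $\lambda>0$, $h\equiv0$, and assume: (i) $f\in C(\mathbb{R})$ is odd, $f(0)=0$, $f'(0)$ exists and $f'(0)=1$; (ii) $f$ is strictly concave for $u>0$ and strictly convex for $u<0$; (iii) there are $p\ge2$ and constants $C_1,\dots,C_4>0$ such that $|f(u)|\le C_1+C_2|u|^{p-1}$ for all $u\in\mathbb{R}$, and moreover $f(u)u\le C_3-C_4|u|^p$ for all $u\in\mathbb{R}$ if $p>2$, while $\limsup_{u\to\pm\infty}\frac{f(u)}{u}\le0$ if $p=2$; (iv) $a\in C(\mathbb{R}^+)$ is non-decreasing, globally Lipschitz continuous, and $0<m\le a(s)\le M_1$ for all $s\ge0$; (v) $a(0)\pi^2k^2<\lambda\le a(0)\pi^2(k+1)^2$ for an integer $k\ge1$. Then the stationary points $u_{1,d_1^*}^+$ and $u_{1,d_1^*}^-$ are asymptotically stable for the multivalued semiflow $G$.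
   Context: $\Omega=(0,1)$, $\mathbb{R}^+=[0,\infty)$, $X=H_0^1(\Omega)$ with $\|u\|_{H_0^1}=\|u_x\|_{L^2}$, $(\cdot,\cdot)$ is the $L^2(\Omega)$ inner product. Consider the problem $$u_t-a(\|u\|_{H_0^1}^2)u_{xx}=\lambda f(u),\quad t>0,\ x\in\Omega;\qquad u(t,0)=u(t,1)=0;\qquad u(0,x)=u_0(x).$$ For $u_0\in X$, a strong solution is a function $u$ with $u\in L^\infty(0,T;H_0^1(\Omega))\cap L^2(0,T;H^2(\Omega)\cap H_0^1(\Omega))$, $u_t\in L^2(0,T;L^2(\Omega))$ for any $T>0$ (hence $u\in C([0,T];H_0^1(\Omega))$), $u(0)=u_0$, and $\frac{d}{dt}(u,v)+a(\|u\|_{H_0^1}^2)(u_x,v_x)=\lambda(f(u),v)$ for all $v\in H_0^1(\Omega)$ in the sense of distributions in $t$. Let $\mathcal{R}$ be the set of all strong solutions and $G(t,u_0)=\{u(t):u\in\mathcal{R},\ u(0)=u_0\}$, $G(t,B)=\bigcup_{x\in B}G(t,x)$. Stationary points are the solutions $z\in H^2(\Omega)\cap H_0^1(\Omega)$ of $-a(\|z\|_{H_0^1}^2)z''=\lambda f(z)$. Under the stated hypotheses there are exactly $2k+1$ of them: $0$ and $u_{1,d_1^*}^\pm,\dots,u_{k,d_k^*}^\pm$, where $u_{j,d_j^*}^\pm$ has exactly $j+1$ (simple) zeros in $[0,1]$, $u_{j,d_j^*}^+$ is positive between its first two zeros, and $u_{j,d_j^*}^-=-u_{j,d_j^*}^+$.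 In particular $u_{1,d_1^*}^+>0$ and $u_{1,d_1^*}^-<0$ on $(0,1)$. A stationary point $z$ is stable if for every $\varepsilon>0$ there is $\delta>0$ such that $G(t,\mathcal{O}_\delta(z))\subset\mathcal{O}_\varepsilon(z)$ for all $t\ge0$ ($\mathcal{O}_\delta(z)$ is the open $\delta$-ball in $X$). It is asymptotically stable if it is stable and there is $\varepsilon>0$ such that $\sup_{y\in G(t,\mathcal{O}_\varepsilon(z))}\|y-z\|_{H_0^1}\to0$ as $t\to+\infty$. *)

theory Defs
  imports "HOL-Analysis.Analysis"
begin

text \<open>
  Elements of the Lebesgue and Sobolev spaces over \<open>(0,1)\<close> are represented by functions on the
  reals, of which only the almost-everywhere class on \<open>(0,1)\<close> matters; all norms below are hence
  seminorms, and every space is closed under modification on null sets.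
\<close>

definition test_function :: "real set \<Rightarrow> (real \<Rightarrow> real) \<Rightarrow> bool" where
  "test_function S \<phi> \<longleftrightarrow>
     (\<forall>n x. ((deriv ^^ n) \<phi>) differentiable (at x)) \<and>
     (\<exists>K. compact K \<and> K \<subseteq> S \<and> (\<forall>x. x \<notin> K \<longrightarrow> \<phi> x = 0))"

abbreviation \<Omega> :: "real set" where "\<Omega> \<equiv> {0<..<1}"


subsection \<open>Sobolev spaces on the unit interval\<close>

definition L2 :: "(real \<Rightarrow> real) set" where
  "L2 = {u. u \<in> borel_measurable (lebesgue_on \<Omega>) \<and> integrable (lebesgue_on \<Omega>) (\<lambda>x. (u x)\<^sup>2)}"

definition L2_inner :: "(real \<Rightarrow> real) \<Rightarrow> (real \<Rightarrow> real) \<Rightarrow> real" where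
  "L2_inner u v = (LINT x|lebesgue_on \<Omega>. u x * v x)"

definition L2_norm :: "(real \<Rightarrow> real) \<Rightarrow> real" where
  "L2_norm u = sqrt (L2_inner u u)"

definition has_weak_deriv :: "(real \<Rightarrow> real) \<Rightarrow> (real \<Rightarrow> real) \<Rightarrow> bool" where
  "has_weak_deriv u g \<longleftrightarrow> (\<forall>\<phi>. test_function \<Omega> \<phi> \<longrightarrow> L2_inner u (deriv \<phi>) = - L2_inner g \<phi>)"

definition H1 :: "(real \<Rightarrow> real) set" where
  "H1 = {u \<in> L2. \<exists>g\<in>L2. has_weak_deriv u g}"

(* A representative of the weak derivative, which is unique up to null sets. Meaningful on H1 only. *)
definition wderiv :: "(real \<Rightarrow> real) \<Rightarrow> real \<Rightarrow> real" where
  "wderiv u = (SOME g. g \<in> L2 \<and> has_weak_deriv u g)"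

definition H1_norm :: "(real \<Rightarrow> real) \<Rightarrow> real" where
  "H1_norm u = sqrt ((L2_norm u)\<^sup>2 + (L2_norm (wderiv u))\<^sup>2)"

definition H10 :: "(real \<Rightarrow> real) set" where
  "H10 = {u \<in> H1. \<exists>\<phi>. (\<forall>n. test_function \<Omega> (\<phi> n)) \<and> (\<lambda>n::nat. H1_norm (u - \<phi> n)) \<longlonglongrightarrow> 0}"

definition H10_norm :: "(real \<Rightarrow> real) \<Rightarrow> real" where
  "H10_norm u = L2_norm (wderiv u)"

definition H2 :: "(real \<Rightarrow> real) set" where
  "H2 = {u \<in> H1. wderiv u \<in> H1}"

definition H2_norm :: "(real \<Rightarrow> real) \<Rightarrow> real" where
  "H2_norm u = sqrt ((L2_norm u)\<^sup>2 + (L2_norm (wderiv u))\<^sup>2 + (L2_norm (wderiv (wderiv u)))\<^sup>2)"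


subsection \<open>Bochner spaces on \<open>(0,T)\<close> with values in a seminormed space of functions\<close>

definition strongly_measurable ::
    "real \<Rightarrow> (real \<Rightarrow> real) set \<Rightarrow> ((real \<Rightarrow> real) \<Rightarrow> real) \<Rightarrow> (real \<Rightarrow> real \<Rightarrow> real) \<Rightarrow> bool" where
  "strongly_measurable T V N u \<longleftrightarrow>
     (AE t in lebesgue_on {0<..<T}. u t \<in> V) \<and>
     (\<exists>s. (\<forall>n. simple_function (lebesgue_on {0<..<T}) (s n) \<and> s n ` {0<..<T} \<subseteq> V) \<and>
          (AE t in lebesgue_on {0<..<T}. (\<lambda>n::nat. N (u t - s n t)) \<longlonglongrightarrow> 0))"

definition bochner_Linf ::
    "real \<Rightarrow> (real \<Rightarrow> real) set \<Rightarrow> ((real \<Rightarrow> real) \<Rightarrow> real) \<Rightarrow> (real \<Rightarrow> real \<Rightarrow> real) set" where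
  "bochner_Linf T V N =
     {u. strongly_measurable T V N u \<and> (\<exists>C. AE t in lebesgue_on {0<..<T}. N (u t) \<le> C)}"

definition bochner_L2 ::
    "real \<Rightarrow> (real \<Rightarrow> real) set \<Rightarrow> ((real \<Rightarrow> real) \<Rightarrow> real) \<Rightarrow> (real \<Rightarrow> real \<Rightarrow> real) set" where
  "bochner_L2 T V N =
     {u. strongly_measurable T V N u \<and> integrable (lebesgue_on {0<..<T}) (\<lambda>t. (N (u t))\<^sup>2)}"

(* The identity between the L2-valued integrals of \<phi>' u and of - \<phi> v, written by pairing both
   sides with an arbitrary element w of L2. *)
definition has_time_deriv :: "real \<Rightarrow> (real \<Rightarrow> real \<Rightarrow> real) \<Rightarrow> (real \<Rightarrow> real \<Rightarrow> real) \<Rightarrow> bool" where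
  "has_time_deriv T u v \<longleftrightarrow>
     (\<forall>\<phi>. test_function {0<..<T} \<phi> \<longrightarrow> (\<forall>w\<in>L2.
        (LINT t|lebesgue_on {0<..<T}. L2_inner (u t) w * deriv \<phi> t)
        = - (LINT t|lebesgue_on {0<..<T}. L2_inner (v t) w * \<phi> t)))"


subsection \<open>Strong solutions and the multivalued semiflow\<close>

(* u t is the value at time t of the representative that is continuous into H10; this is what
   gives meaning to u(0) and to the values u(t) at single times. *)
definition strong_solution ::
    "(real \<Rightarrow> real) \<Rightarrow> (real \<Rightarrow> real) \<Rightarrow> real \<Rightarrow> (real \<Rightarrow> real \<Rightarrow> real) \<Rightarrow> bool" where
  "strong_solution a f lam u \<longleftrightarrow>
     (\<forall>t\<ge>0. u t \<in> H10 \<and> ((\<lambda>s. H10_norm (u s - u t)) \<longlongrightarrow> 0) (at t within {0..})) \<and>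
     (\<forall>T>0.
        u \<in> bochner_Linf T H10 H10_norm \<and>
        u \<in> bochner_L2 T (H2 \<inter> H10) H2_norm \<and>
        (\<exists>v \<in> bochner_L2 T L2 L2_norm. has_time_deriv T u v) \<and>
        (\<forall>v\<in>H10. \<forall>\<phi>. test_function {0<..<T} \<phi> \<longrightarrow>
           - (LINT t|lebesgue_on {0<..<T}. L2_inner (u t) v * deriv \<phi> t)
           + (LINT t|lebesgue_on {0<..<T}.
                a ((H10_norm (u t))\<^sup>2) * L2_inner (wderiv (u t)) (wderiv v) * \<phi> t)
           = (LINT t|lebesgue_on {0<..<T}. lam * L2_inner (\<lambda>x. f (u t x)) v * \<phi> t)))"

definition semiflow ::
    "(real \<Rightarrow> real) \<Rightarrow> (real \<Rightarrow> real) \<Rightarrow> real \<Rightarrow> real \<Rightarrow> (real \<Rightarrow> real) \<Rightarrow> (real \<Rightarrow> real) set" where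
  "semiflow a f lam t u0 =
     {u t | u. strong_solution a f lam u \<and> (AE x in lebesgue_on \<Omega>. u 0 x = u0 x)}"

definition semiflow_set ::
    "(real \<Rightarrow> real) \<Rightarrow> (real \<Rightarrow> real) \<Rightarrow> real \<Rightarrow> real \<Rightarrow> (real \<Rightarrow> real) set \<Rightarrow> (real \<Rightarrow> real) set" where
  "semiflow_set a f lam t B = (\<Union>u0\<in>B. semiflow a f lam t u0)"


subsection \<open>Stationary points and their stability\<close>

definition stationary_point ::
    "(real \<Rightarrow> real) \<Rightarrow> (real \<Rightarrow> real) \<Rightarrow> real \<Rightarrow> (real \<Rightarrow> real) \<Rightarrow> bool" where
  "stationary_point a f lam z \<longleftrightarrow> z \<in> H2 \<inter> H10 \<and>
     (AE x in lebesgue_on \<Omega>. - a ((H10_norm z)\<^sup>2) * wderiv (wderiv z) x = lam * f (z x))"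

(* z is (the continuous representative of) the stationary point with j + 1 zeros in [0,1] that is
   positive between its first two zeros x1 < x2. *)
definition is_u_plus ::
    "(real \<Rightarrow> real) \<Rightarrow> (real \<Rightarrow> real) \<Rightarrow> real \<Rightarrow> nat \<Rightarrow> (real \<Rightarrow> real) \<Rightarrow> bool" where
  "is_u_plus a f lam j z \<longleftrightarrow>
     stationary_point a f lam z \<and> continuous_on {0..1} z \<and>
     card {x \<in> {0..1}. z x = 0} = j + 1 \<and>
     (\<exists>x1 x2. 0 \<le> x1 \<and> x1 < x2 \<and> x2 \<le> 1 \<and>
        {x \<in> {0..x2}. z x = 0} = {x1, x2} \<and> (\<forall>x\<in>{x1<..<x2}. z x > 0))"

definition H10_ball :: "(real \<Rightarrow> real) \<Rightarrow> real \<Rightarrow> (real \<Rightarrow> real) set" where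
  "H10_ball z r = {y \<in> H10. H10_norm (y - z) < r}"

definition stable ::
    "(real \<Rightarrow> real) \<Rightarrow> (real \<Rightarrow> real) \<Rightarrow> real \<Rightarrow> (real \<Rightarrow> real) \<Rightarrow> bool" where
  "stable a f lam z \<longleftrightarrow>
     (\<forall>\<epsilon>>0. \<exists>\<delta>>0. \<forall>t\<ge>0. semiflow_set a f lam t (H10_ball z \<delta>) \<subseteq> H10_ball z \<epsilon>)"

(* The supremum is taken in ennreal, so that it is meaningful even before boundedness is known. *)
definition asymptotically_stable ::
    "(real \<Rightarrow> real) \<Rightarrow> (real \<Rightarrow> real) \<Rightarrow> real \<Rightarrow> (real \<Rightarrow> real) \<Rightarrow> bool" where
  "asymptotically_stable a f lam z \<longleftrightarrow>
     stable a f lam z \<and>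
     (\<exists>\<epsilon>>0. ((\<lambda>t. SUP y \<in> semiflow_set a f lam t (H10_ball z \<epsilon>). ennreal (H10_norm (y - z)))
               \<longlongrightarrow> 0) at_top)"


subsection \<open>Strict concavity and convexity\<close>

definition strictly_convex_on :: "real set \<Rightarrow> (real \<Rightarrow> real) \<Rightarrow> bool" where
  "strictly_convex_on S f \<longleftrightarrow> convex S \<and>
     (\<forall>x\<in>S. \<forall>y\<in>S. \<forall>t\<in>{0<..<1}. x \<noteq> y \<longrightarrow>
        f ((1 - t) * x + t * y) < (1 - t) * f x + t * f y)"

definition strictly_concave_on :: "real set \<Rightarrow> (real \<Rightarrow> real) \<Rightarrow> bool" where
  "strictly_concave_on S f \<longleftrightarrow> strictly_convex_on S (\<lambda>x. - f x)"

end

theory Submission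
  imports Defs
begin

text \<open>
  The equation is a gradient flow of \<open>E u = \<Phi>(|u_x|\<^sup>2) / 2 - lam \<integral> F(u)\<close>, where \<open>\<Phi>' = a\<close> and
  \<open>F' = f\<close>. As \<open>a\<close> is non-decreasing, \<open>\<Phi>\<close> is convex, and as \<open>f\<close> is odd and concave on the positive
  half line with \<open>f'(0) = 1\<close>, its difference quotients do not exceed 1. Hence every solution satisfies
  the evolution variational inequality
  \<open>d/dt |u(t) - v|\<^sup>2 \<le> 2 (E v - E (u t)) + lam |u(t) - v|\<^sup>2\<close>, which uses only that
  \<open>t \<mapsto> (u(t), v)\<close> is continuously differentiable and which forces the energy to be non-increasing
  along solutions.

  By convexity of \<open>\<Phi>\<close>, the growth of \<open>E\<close> near \<open>z = u_1\<^sup>+\<close> is at least that of the local energy with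
  frozen coefficient \<open>a(|z_x|\<^sup>2)\<close>. The latter is coercive, because \<open>z\<close> is positive and strict
  concavity of \<open>f\<close> turns it into a strict supersolution of the linearised equation. So \<open>z\<close> is a strict
  local minimum of \<open>E\<close>, which gives stability. The same coercivity, together with the Lipschitz
  continuity of \<open>a\<close>, yields \<open>d/dt |u - z|\<^sup>2 \<le> - c |u_x - z_x|\<^sup>2\<close>; hence within a uniformly bounded time
  the solution gets as close to \<open>z\<close> as needed to apply stability again.
\<close>

subsection \<open>Smooth functions\<close>

text \<open>The function \<open>f\<close> is known to be differentiable only at 0 and
  \<open>a\<close> is only Lipschitz, so neither the equation nor the energy can be linearised
  literally. One-sided secant bounds replace the derivative: slopes of \<open>f\<close> never exceed
  1, and at a value z away from 0 nearby secants stay below the chord over [z/2, z], whose slope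
  times z is strictly less than \<open>f z\<close>. This gap is the source of coercivity. It
  degenerates where z tends to 0, which is why a concave corrector has to take over near the
  boundary. In time, differentiating \<open>E\<close> along a solution would call for a chain rule
  and for testing with the time derivative. Comparing \<open>u t\<close> with a fixed earlier state
  involves only pairings with fixed elements of \<open>H10\<close>. The decaying quantity is an L2
  distance while the dissipation controls the \<open>H10\<close> distance. This gives no rate in
  \<open>H10\<close>, but a bound on the time by which a given \<open>H10\<close> ball is entered.
  All estimates quantify over every weak flow, so the multivalued semiflow requires no
  selection.\<close>

lemma continuous_imp_antiderivative:
  fixes g :: "real \<Rightarrow> real"
  assumes "continuous_on UNIV g"
  shows "\<exists>G. \<forall>x. (G has_real_derivative g x) (at x)"
  using einterval_antiderivative[of "-\<infinity>" "\<infinity>" g] assms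
  by (auto simp: continuous_on_eq_continuous_at has_real_derivative_iff_has_vector_derivative)

definition smooth :: "(real \<Rightarrow> real) \<Rightarrow> bool" where
  "smooth \<phi> \<longleftrightarrow> (\<forall>n x. ((deriv ^^ n) \<phi>) differentiable (at x))"

text \<open>Having derivatives of all orders is the largest property stable under differentiation.
  Any class that contains \<open>\<phi>\<close> and is closed under differentiation is therefore a
  witness, and no formula for the n-th derivative is needed.\<close>

lemma smooth_coinduct:
  assumes "P \<phi>"
    and step: "\<And>\<psi>. P \<psi> \<Longrightarrow> \<exists>\<psi>'. (\<forall>x. (\<psi> has_real_derivative \<psi>' x) (at x)) \<and> P \<psi>'"
  shows "smooth \<phi>"
proof -
  have P_deriv: "P (deriv \<psi>)" if P: "P \<psi>" for \<psi>
  proof -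
    obtain \<psi>' where "\<And>x. (\<psi> has_real_derivative \<psi>' x) (at x)" "P \<psi>'"
      using step[OF P] by blast
    moreover from this have "deriv \<psi> = \<psi>'"
      by (auto intro: DERIV_imp_deriv)
    ultimately show ?thesis by simp
  qed
  have "P ((deriv ^^ n) \<phi>)" for n
    by (induction n) (auto intro: assms(1) P_deriv)
  then show ?thesis
    unfolding smooth_def using step real_differentiable_def by blast
qed

lemma smooth_deriv: "smooth \<phi> \<Longrightarrow> smooth (deriv \<phi>)"
  unfolding smooth_def by (metis funpow_Suc_right o_apply)

lemma smooth_DERIV: "smooth \<phi> \<Longrightarrow> (\<phi> has_real_derivative deriv \<phi> x) (at x)"
  unfolding smooth_def
  by (metis DERIV_deriv_iff_real_differentiable funpow_0)

lemma smooth_continuous: "smooth \<phi> \<Longrightarrow> continuous_on S \<phi>"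
  by (meson DERIV_continuous continuous_at_imp_continuous_on smooth_DERIV)

lemma smooth_antiderivative:
  assumes "\<And>x. (\<phi> has_real_derivative \<psi> x) (at x)" and "smooth \<psi>"
  shows "smooth \<phi>"
proof (rule smooth_coinduct[where P = "\<lambda>\<eta>. \<eta> = \<phi> \<or> smooth \<eta>"])
  show "\<exists>\<eta>'. (\<forall>x. (\<eta> has_real_derivative \<eta>' x) (at x)) \<and> (\<eta>' = \<phi> \<or> smooth \<eta>')"
    if "\<eta> = \<phi> \<or> smooth \<eta>" for \<eta>
    using that assms smooth_DERIV smooth_deriv by blast
qed simp

lemma smooth_add:
  assumes "smooth \<phi>" "smooth \<psi>"
  shows "smooth (\<lambda>x. \<phi> x + \<psi> x)"
proof (rule smooth_coinduct[where P = "\<lambda>\<eta>. \<exists>\<phi> \<psi>. smooth \<phi> \<and> smooth \<psi> \<and> \<eta> = (\<lambda>x. \<phi> x + \<psi> x)"])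
  fix \<eta> assume "\<exists>\<phi> \<psi>. smooth \<phi> \<and> smooth \<psi> \<and> \<eta> = (\<lambda>x. \<phi> x + \<psi> x)"
  then obtain \<phi> \<psi> where s: "smooth \<phi>" "smooth \<psi>" "\<eta> = (\<lambda>x. \<phi> x + \<psi> x)" by blast
  have "(\<eta> has_real_derivative deriv \<phi> x + deriv \<psi> x) (at x)" for x
    unfolding s(3) by (intro DERIV_add smooth_DERIV s)
  then show "\<exists>\<eta>'. (\<forall>x. (\<eta> has_real_derivative \<eta>' x) (at x)) \<and>
      (\<exists>\<phi> \<psi>. smooth \<phi> \<and> smooth \<psi> \<and> \<eta>' = (\<lambda>x. \<phi> x + \<psi> x))"
    using s(1,2) smooth_deriv by (intro exI[of _ "\<lambda>x. deriv \<phi> x + deriv \<psi> x"]) blast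
qed (use assms in blast)

lemma smooth_affine:
  assumes "smooth \<phi>"
  shows "smooth (\<lambda>x. c * \<phi> (\<alpha> * x + \<beta>))"
proof (rule smooth_coinduct[where P = "\<lambda>\<eta>. \<exists>c \<phi>. smooth \<phi> \<and> \<eta> = (\<lambda>x. c * \<phi> (\<alpha> * x + \<beta>))"])
  fix \<eta> assume "\<exists>c \<phi>. smooth \<phi> \<and> \<eta> = (\<lambda>x. c * \<phi> (\<alpha> * x + \<beta>))"
  then obtain c \<phi> where s: "smooth \<phi>" "\<eta> = (\<lambda>x. c * \<phi> (\<alpha> * x + \<beta>))" by blast
  have "(\<eta> has_real_derivative (c * \<alpha>) * deriv \<phi> (\<alpha> * x + \<beta>)) (at x)" for x
    unfolding s(2)
    by (rule derivative_eq_intros DERIV_chain2[OF smooth_DERIV[OF s(1)]] refl | simp)+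
  then show "\<exists>\<eta>'. (\<forall>x. (\<eta> has_real_derivative \<eta>' x) (at x)) \<and>
      (\<exists>c \<phi>. smooth \<phi> \<and> \<eta>' = (\<lambda>x. c * \<phi> (\<alpha> * x + \<beta>)))"
    using smooth_deriv[OF s(1)] by (intro exI[of _ "\<lambda>x. (c * \<alpha>) * deriv \<phi> (\<alpha> * x + \<beta>)"]) blast
qed (use assms in blast)

lemma smooth_cmult: "smooth \<phi> \<Longrightarrow> smooth (\<lambda>x. c * \<phi> x)"
  using smooth_affine[of \<phi> c 1 0] by simp

text \<open>The Leibniz rule leads from products of smooth functions to sums of such products and no
  further, so this is the invariant class for the coinduction in \<open>smooth_mult\<close>.\<close>

inductive smooth_product_sum :: "(real \<Rightarrow> real) \<Rightarrow> bool" where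
  product: "smooth \<phi> \<Longrightarrow> smooth \<psi> \<Longrightarrow> smooth_product_sum (\<lambda>x. \<phi> x * \<psi> x)"
| sum: "smooth_product_sum \<eta> \<Longrightarrow> smooth_product_sum \<xi> \<Longrightarrow> smooth_product_sum (\<lambda>x. \<eta> x + \<xi> x)"

lemma smooth_mult:
  assumes "smooth \<phi>" "smooth \<psi>"
  shows "smooth (\<lambda>x. \<phi> x * \<psi> x)"
proof (rule smooth_coinduct[where P = smooth_product_sum])
  show "\<exists>\<eta>'. (\<forall>x. (\<eta> has_real_derivative \<eta>' x) (at x)) \<and> smooth_product_sum \<eta>'"
    if "smooth_product_sum \<eta>" for \<eta>
    using that
  proof induction
    case (product \<phi> \<psi>)
    have "((\<lambda>x. \<phi> x * \<psi> x) has_real_derivative deriv \<phi> x * \<psi> x + \<phi> x * deriv \<psi> x) (at x)" for x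
      using DERIV_mult[OF smooth_DERIV smooth_DERIV, of \<phi> \<psi> x] product
      by (simp add: algebra_simps)
    moreover have "smooth_product_sum (\<lambda>x. deriv \<phi> x * \<psi> x + \<phi> x * deriv \<psi> x)"
      using product by (intro smooth_product_sum.intros smooth_deriv)
    ultimately show ?case
      by (intro exI[of _ "\<lambda>x. deriv \<phi> x * \<psi> x + \<phi> x * deriv \<psi> x"]) auto
  next
    case (sum \<eta> \<xi>)
    then obtain \<eta>' \<xi>' where "\<And>x. (\<eta> has_real_derivative \<eta>' x) (at x)" "smooth_product_sum \<eta>'"
      "\<And>x. (\<xi> has_real_derivative \<xi>' x) (at x)" "smooth_product_sum \<xi>'" by blast
    then show ?case
      by (intro exI[of _ "\<lambda>x. \<eta>' x + \<xi>' x"]) (auto intro: DERIV_add smooth_product_sum.sum)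
  qed
qed (use assms in \<open>rule smooth_product_sum.product\<close>)

section \<open>A smooth step function\<close>

lemma poly_div_exp_tendsto_0: "((\<lambda>y. poly p y / exp y) \<longlongrightarrow> (0::real)) at_top"
proof -
  have "((\<lambda>y. \<Sum>i\<le>degree p. coeff p i * (y ^ i / exp y)) \<longlongrightarrow> (\<Sum>i\<le>degree p. coeff p i * 0)) at_top"
    by (intro tendsto_intros tendsto_power_div_exp_0)
  then show ?thesis
    by (simp add: poly_altdef sum_divide_distrib)
qed

text \<open>For x > 0 every derivative is a polynomial in y = 1 / x times exp (- y), and
  differentiation replaces \<open>p\<close> by y^2 (p - p'). At 0 the right difference quotient is y
  p(y) / exp y with y tending to infinity, so each of these functions glues to 0.\<close>

lemma smooth_exp_inverse: "smooth (\<lambda>x. if x > 0 then exp (- (1 / x)) else 0)"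
proof (rule smooth_coinduct[where
      P = "\<lambda>\<eta>. \<exists>p. \<eta> = (\<lambda>x. if x > 0 then poly p (1 / x) * exp (- (1 / x)) else 0)"])
  show "\<exists>p. (\<lambda>x::real. if x > 0 then exp (- (1 / x)) else 0) =
      (\<lambda>x. if x > 0 then poly p (1 / x) * exp (- (1 / x)) else 0)"
    by (rule exI[of _ 1]) auto
  fix \<eta> :: "real \<Rightarrow> real"
  assume "\<exists>p. \<eta> = (\<lambda>x. if x > 0 then poly p (1 / x) * exp (- (1 / x)) else 0)"
  then obtain p where \<eta>: "\<eta> = (\<lambda>x. if x > 0 then poly p (1 / x) * exp (- (1 / x)) else 0)" by blast
  define q where "q = [:0, 0, 1:] * (p - pderiv p)"
  define \<eta>' where "\<eta>' = (\<lambda>x::real. if x > 0 then poly q (1 / x) * exp (- (1 / x)) else 0)"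
  have "(\<eta> has_real_derivative \<eta>' x) (at x)" for x
  proof -
    consider "x < 0" | "x > 0" | "x = 0" by linarith
    then show ?thesis
    proof cases
      case 1
      have "((\<lambda>_. 0) has_real_derivative \<eta>' x) (at x)"
        using 1 by (simp add: \<eta>'_def)
      then show ?thesis
        by (rule has_field_derivative_transform_within_open[where S = "{..<0}"])
          (use 1 in \<open>auto simp: \<eta>\<close>)
    next
      case 2
      have "((\<lambda>x. poly p (1 / x) * exp (- (1 / x))) has_real_derivative \<eta>' x) (at x)"
        using 2 by (auto intro!: derivative_eq_intros DERIV_chain2[OF poly_DERIV]
            simp: \<eta>'_def q_def field_simps power2_eq_square)
      then show ?thesis
        by (rule has_field_derivative_transform_within_open[where S = "{0<..}"])
          (use 2 in \<open>auto simp: \<eta>\<close>)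
    next
      case 3
      have "((\<lambda>h. \<eta> h / h) \<longlongrightarrow> 0) (at_right 0)"
      proof -
        have "((\<lambda>h::real. poly (pCons 0 p) (inverse h) / exp (inverse h)) \<longlongrightarrow> 0) (at_right 0)"
          by (rule filterlim_compose[OF poly_div_exp_tendsto_0 filterlim_inverse_at_top_right])
        then show ?thesis
          by (rule Lim_transform_eventually)
            (auto simp: eventually_at_filter \<eta> exp_minus field_simps)
      qed
      moreover have "((\<lambda>h. \<eta> h / h) \<longlongrightarrow> 0) (at_left 0)"
        by (rule tendsto_eventually) (auto simp: eventually_at_filter \<eta>)
      ultimately have "((\<lambda>h. \<eta> h / h) \<longlongrightarrow> 0) (at 0)"
        by (rule filterlim_split_at[rotated])
      then show ?thesis
        using 3 by (simp add: DERIV_def \<eta>'_def) (simp add: \<eta>)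
    qed
  qed
  then show "\<exists>\<eta>'. (\<forall>x. (\<eta> has_real_derivative \<eta>' x) (at x)) \<and>
      (\<exists>p. \<eta>' = (\<lambda>x. if x > 0 then poly p (1 / x) * exp (- (1 / x)) else 0))"
    by (intro exI[of _ \<eta>']) (auto simp: \<eta>'_def)
qed

text \<open>The bump e(x) e(1 - x) is nonnegative and vanishes outside (0, 1). Its antiderivative,
  shifted and divided by its total increase, is the step.\<close>

lemma smooth_step_exists:
  "\<exists>S :: real \<Rightarrow> real. smooth S \<and> mono S \<and> (\<forall>x\<le>0. S x = 0) \<and> (\<forall>x\<ge>1. S x = 1)"
proof -
  define e :: "real \<Rightarrow> real" where "e = (\<lambda>x. if x > 0 then exp (- (1 / x)) else 0)"
  define \<rho> where "\<rho> = (\<lambda>x. e x * e (1 - x))"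
  have "smooth (\<lambda>x. 1 * e ((-1) * x + 1))"
    by (intro smooth_affine) (unfold e_def, rule smooth_exp_inverse)
  then have "smooth (\<lambda>x. e (1 - x))" by (simp add: algebra_simps)
  then have \<rho>: "smooth \<rho>"
    unfolding \<rho>_def by (intro smooth_mult) (unfold e_def, rule smooth_exp_inverse)
  have nonneg: "\<rho> x \<ge> 0" for x by (simp add: \<rho>_def e_def)
  obtain S0 where S0: "\<And>x. (S0 has_real_derivative \<rho> x) (at x)"
    using continuous_imp_antiderivative smooth_continuous[OF \<rho>] by blast
  have mono: "S0 x \<le> S0 y" if "x \<le> y" for x y
    using DERIV_nonneg_imp_nondecreasing[OF that] S0 nonneg by blast
  have step: "\<exists>z>x. z < y \<and> S0 y - S0 x = (y - x) * \<rho> z" if "x < y" for x y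
    using MVT2[OF that S0] by blast
  have left: "S0 x = S0 0" if "x \<le> 0" for x
    using step[of x 0] that by (cases "x < 0") (auto simp: \<rho>_def e_def)
  have right: "S0 x = S0 1" if "x \<ge> 1" for x
    using step[of 1 x] that by (cases "x > 1") (auto simp: \<rho>_def e_def)
  have lt: "S0 0 < S0 1"
  proof -
    obtain z where "z > 0" "z < 1" "S0 1 - S0 0 = (1 - 0) * \<rho> z"
      using step[of 0 1] by auto
    then have "S0 1 - S0 0 = exp (- (1 / z)) * exp (- (1 / (1 - z)))"
      by (simp add: \<rho>_def e_def)
    moreover have "0 < exp (- (1 / z)) * exp (- (1 / (1 - z)))" by simp
    ultimately show ?thesis by linarith
  qed
  define S where "S = (\<lambda>x. (S0 x - S0 0) / (S0 1 - S0 0))"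
  have "(S has_real_derivative 1 / (S0 1 - S0 0) * \<rho> x) (at x)" for x
    unfolding S_def using lt S0[of x] by (auto intro!: derivative_eq_intros)
  then have "smooth S"
    by (rule smooth_antiderivative) (rule smooth_cmult[OF \<rho>])
  moreover have "mono S"
    unfolding S_def using lt by (intro monoI divide_right_mono) (auto intro: mono)
  moreover have "S x = 0" if "x \<le> 0" for x
    unfolding S_def left[OF that] by simp
  moreover have "S x = 1" if "x \<ge> 1" for x
    unfolding S_def right[OF that] using lt by simp
  ultimately show ?thesis by blast
qed

section \<open>Test functions and their supports\<close>

lemma test_function_smooth: "test_function S \<phi> \<Longrightarrow> smooth \<phi>"
  by (simp add: test_function_def smooth_def)

lemma test_function_iff:
  "test_function S \<phi> \<longleftrightarrow> smooth \<phi> \<and> (\<exists>K. compact K \<and> K \<subseteq> S \<and> (\<forall>x. x \<notin> K \<longrightarrow> \<phi> x = 0))"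
  by (simp add: test_function_def smooth_def)

lemma test_function_add:
  assumes "test_function S \<phi>" "test_function S \<psi>"
  shows "test_function S (\<lambda>x. \<phi> x + \<psi> x)"
proof -
  obtain K L where "compact K" "K \<subseteq> S" "\<And>x. x \<notin> K \<Longrightarrow> \<phi> x = 0"
    "compact L" "L \<subseteq> S" "\<And>x. x \<notin> L \<Longrightarrow> \<psi> x = 0"
    using assms unfolding test_function_iff by blast
  then show ?thesis
    using assms unfolding test_function_iff
    by (intro conjI exI[of _ "K \<union> L"] smooth_add compact_Un Un_least) auto
qed

lemma test_function_cmult: "test_function S \<phi> \<Longrightarrow> test_function S (\<lambda>x. c * \<phi> x)"
  unfolding test_function_iff by (auto intro: smooth_cmult)

lemma test_function_deriv_eq_0:
  fixes x :: real
  assumes "compact K" "\<And>x. x \<notin> K \<Longrightarrow> \<phi> x = 0" "x \<notin> K"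
  shows "deriv \<phi> x = 0"
proof -
  have "((\<lambda>_. 0) has_real_derivative 0) (at x)" by simp
  then have "(\<phi> has_real_derivative 0) (at x)"
    by (rule has_field_derivative_transform_within_open[where S = "- K"])
      (use assms in \<open>auto intro: compact_imp_closed\<close>)
  then show ?thesis by (rule DERIV_imp_deriv)
qed

lemma test_function_deriv:
  assumes "test_function S \<phi>"
  shows "test_function S (deriv \<phi>)"
proof -
  obtain K where K: "compact K" "K \<subseteq> S" "\<And>x. x \<notin> K \<Longrightarrow> \<phi> x = 0"
    using assms unfolding test_function_iff by blast
  then have "\<And>x. x \<notin> K \<Longrightarrow> deriv \<phi> x = 0"
    using test_function_deriv_eq_0 by blast
  then show ?thesis
    using K assms smooth_deriv unfolding test_function_iff by blast
qed

lemma test_function_support_interval: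
  assumes "test_function {\<alpha><..<\<beta>} \<phi>" "\<alpha> < \<beta>"
  obtains c d where "\<alpha> < c" "c < d" "d < \<beta>" "\<And>x. x \<notin> {c..d} \<Longrightarrow> \<phi> x = 0"
proof -
  obtain K where K: "compact K" "K \<subseteq> {\<alpha><..<\<beta>}" "\<And>x. x \<notin> K \<Longrightarrow> \<phi> x = 0"
    using assms(1) unfolding test_function_iff by blast
  show thesis
  proof (cases "K = {}")
    case True
    then show thesis
      using that[of "(2 * \<alpha> + \<beta>) / 3" "(\<alpha> + 2 * \<beta>) / 3"] K assms(2) by auto
  next
    case False
    \<comment> \<open>Midpoints between the support and the ends of the interval, so that
      \<open>c < d\<close> even if \<open>K\<close> is a single point.\<close>
    define c d where "c = (\<alpha> + Inf K) / 2" and "d = (Sup K + \<beta>) / 2"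
    have i: "Inf K \<in> K" "Sup K \<in> K"
      using False K(1) by (auto intro!: closed_contains_Inf closed_contains_Sup
          compact_imp_closed bounded_imp_bdd_above bounded_imp_bdd_below compact_imp_bounded)
    have b: "Inf K \<le> x" "x \<le> Sup K" if "x \<in> K" for x
      using that K(1) by (auto intro!: cInf_lower cSup_upper
          bounded_imp_bdd_above bounded_imp_bdd_below compact_imp_bounded)
    have *: "\<alpha> < Inf K" "Sup K < \<beta>" "Inf K \<le> Sup K"
      using i K(2) b by auto
    show thesis
    proof (rule that[of c d])
      show "\<phi> x = 0" if "x \<notin> {c..d}" for x
        using that b[of x] K(3)[of x] * by (fastforce simp: c_def d_def)
    qed (use * in \<open>auto simp: c_def d_def\<close>)
  qed
qed

text \<open>Two ramps of width \<open>\<epsilon>\<close>, one up from \<open>c\<close> and one down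
  from \<open>d\<close>. As \<open>\<epsilon>\<close> tends to 0 the function tends to the indicator
  of \<open>{c<..d}\<close>, half-open because \<open>S 0 = 0\<close>.\<close>

lemma test_function_step:
  assumes S: "smooth S" "\<forall>x\<le>0. S x = 0" "\<forall>x\<ge>1. S x = 1"
    and "\<epsilon> > 0" "\<alpha> < c" "c \<le> d" "d + \<epsilon> < \<beta>"
  shows "test_function {\<alpha><..<\<beta>} (\<lambda>x. S ((x - c) / \<epsilon>) - S ((x - d) / \<epsilon>))"
proof -
  have "smooth (\<lambda>x. 1 * S ((1 / \<epsilon>) * x + (- c / \<epsilon>)) + (-1) * S ((1 / \<epsilon>) * x + (- d / \<epsilon>)))"
    using S by (intro smooth_add smooth_affine)
  then have "smooth (\<lambda>x. S ((x - c) / \<epsilon>) - S ((x - d) / \<epsilon>))"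
    by (simp add: diff_divide_distrib)
  moreover have "S ((x - c) / \<epsilon>) - S ((x - d) / \<epsilon>) = 0" if "x \<notin> {c..d + \<epsilon>}" for x
  proof (cases "x < c")
    case True
    then show ?thesis using assms by (simp add: divide_le_0_iff)
  next
    case False
    then have "x - d \<ge> \<epsilon>" "x - c \<ge> \<epsilon>" using that assms by auto
    then show ?thesis using assms by (simp add: le_divide_eq)
  qed
  ultimately show ?thesis
    unfolding test_function_iff using assms
    by (intro conjI exI[of _ "{c..d + \<epsilon>}"]) auto
qed

subsection \<open>The fundamental lemma of the calculus of variations\<close>

text \<open>Rays form an intersection-stable generator of the Borel sets, so a Dynkin argument
  extends the vanishing of the integral to all Borel sets.\<close>

lemma AE_eq_0_if_integrals_atMost_eq_0:
  fixes h :: "real \<Rightarrow> real"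
  assumes h: "integrable lborel h"
    and zero: "\<And>c. set_lebesgue_integral lborel {..c} h = 0"
  shows "AE x in lborel. h x = 0"
proof (rule sigma_finite_measure.density_zero[OF lborel.sigma_finite_measure_axioms, OF h])
  have sint: "set_integrable lborel A h" if "A \<in> sets borel" for A
    using that h unfolding set_integrable_def by (intro integrable_mult_indicator) auto
  \<comment> \<open>Complements need the integral over the whole line, which is the limit over
    growing rays.\<close>
  have total: "integral\<^sup>L lborel h = 0"
  proof -
    have "(\<lambda>n. LINT x|lborel. indicator {..real n} x *\<^sub>R h x) \<longlonglongrightarrow> integral\<^sup>L lborel h"
    proof (rule integral_dominated_convergence[where w = "\<lambda>x. \<bar>h x\<bar>"])
      show "AE x in lborel. (\<lambda>n. indicator {..real n} x *\<^sub>R h x) \<longlonglongrightarrow> h x"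
      proof (rule AE_I2)
        fix x :: real
        have "\<forall>\<^sub>F n in sequentially. x \<le> real n"
          using eventually_sequentiallyI[of "nat \<lceil>x\<rceil>"] by (meson real_nat_ceiling_ge le_trans of_nat_le_iff order_trans)
        then have "\<forall>\<^sub>F n in sequentially. indicator {..real n} x *\<^sub>R h x = h x"
          by eventually_elim simp
        then show "(\<lambda>n. indicator {..real n} x *\<^sub>R h x) \<longlonglongrightarrow> h x"
          by (rule tendsto_eventually)
      qed
    qed (use h in \<open>auto simp: indicator_def\<close>)
    then show ?thesis
      using zero by (simp add: set_lebesgue_integral_def LIMSEQ_const_iff)
  qed
  show "set_lebesgue_integral lborel A h = 0" if "A \<in> sets lborel" for A
  proof -
    have "Int_stable (range (\<lambda>a. {..a::real}))"
      unfolding Int_stable_def by (auto intro!: exI[of _ "min _ _"])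
    moreover have "range (\<lambda>a. {..a::real}) \<subseteq> Pow UNIV" by simp
    moreover have "A \<in> sigma_sets UNIV (range (\<lambda>a. {..a::real}))"
      using that by (simp add: borel_eq_atMost)
    ultimately show ?thesis
    proof (induction rule: sigma_sets_induct_disjoint)
      case (basic A)
      then show ?case using zero by auto
    next
      case empty
      show ?case by (simp add: set_lebesgue_integral_def)
    next
      case (compl A)
      then have A: "A \<in> sets borel" by (simp add: borel_eq_atMost)
      have "set_lebesgue_integral lborel (A \<union> (UNIV - A)) h =
          set_lebesgue_integral lborel A h + set_lebesgue_integral lborel (UNIV - A) h"
        using A by (intro set_integral_Un sint) auto
      moreover have "set_lebesgue_integral lborel (A \<union> (UNIV - A)) h = 0"
        using total by (simp add: set_lebesgue_integral_def)
      ultimately show ?case using compl by simp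
    next
      case (union A)
      then have A: "A i \<in> sets borel" for i by (auto simp: borel_eq_atMost)
      have "set_lebesgue_integral lborel (\<Union>i. A i) h = (\<Sum>i. set_lebesgue_integral lborel (A i) h)"
        using union(1) A
        by (intro lebesgue_integral_countable_add sint) (auto simp: disjoint_family_on_def)
      then show ?case using union by simp
    qed
  qed
qed

lemma const_over_n_plus_2: "(\<lambda>n. K / (real n + 2)) \<longlonglongrightarrow> 0"
  using LIMSEQ_ignore_initial_segment[OF lim_const_over_n[of K], of 2] by (simp add: add.commute)

text \<open>Only intervals that keep away from both ends are assumed, as these are what test
  functions reach. They exhaust the part of a ray inside the interval, and dominated convergence
  reduces the claim to rays.\<close>

lemma AE_eq_0_if_interval_integrals_eq_0:
  fixes g :: "real \<Rightarrow> real"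
  assumes g: "integrable (lebesgue_on {\<alpha><..<\<beta>}) g" and "\<alpha> < \<beta>"
    and zero: "\<And>c d. \<alpha> < c \<Longrightarrow> c \<le> d \<Longrightarrow> d < \<beta> \<Longrightarrow>
      (LINT x|lebesgue_on {\<alpha><..<\<beta>}. g x * indicator {c<..d} x) = 0"
  shows "AE x in lebesgue_on {\<alpha><..<\<beta>}. g x = 0"
proof -
  have half: "(LINT x|lebesgue_on {\<alpha><..<\<beta>}. g x * indicator {..c} x) = 0" if "\<alpha> < c" for c
  proof -
    define e where "e = (\<lambda>n. (\<beta> - \<alpha>) / (real n + 2))"
    have e: "e \<longlonglongrightarrow> 0" "\<And>n. e n > 0"
      using \<open>\<alpha> < \<beta>\<close> const_over_n_plus_2 unfolding e_def by auto
    let ?I = "\<lambda>n x. g x * indicator {\<alpha> + e n<..min c (\<beta> - e n)} x"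
    have "(LINT x|lebesgue_on {\<alpha><..<\<beta>}. ?I n x) = 0" for n
    proof (cases "\<alpha> + e n \<le> min c (\<beta> - e n)")
      case True
      then show ?thesis using e(2)[of n] by (intro zero) auto
    next
      case False
      then have empty: "{\<alpha> + e n<..min c (\<beta> - e n)} = {}" by auto
      show ?thesis by (simp only: empty) simp
    qed
    moreover have "(\<lambda>n. LINT x|lebesgue_on {\<alpha><..<\<beta>}. ?I n x) \<longlonglongrightarrow>
        (LINT x|lebesgue_on {\<alpha><..<\<beta>}. g x * indicator {..c} x)"
    proof (rule integral_dominated_convergence[where w = "\<lambda>x. \<bar>g x\<bar>"])
      show "AE x in lebesgue_on {\<alpha><..<\<beta>}. (\<lambda>n. ?I n x) \<longlonglongrightarrow> g x * indicator {..c} x"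
      proof (rule AE_I2)
        fix x assume "x \<in> space (lebesgue_on {\<alpha><..<\<beta>})"
        then have x: "\<alpha> < x" "x < \<beta>" by auto
        have "\<forall>\<^sub>F n in sequentially. e n < min (x - \<alpha>) (\<beta> - x)"
          by (rule order_tendstoD(2)[OF e(1)]) (use x in simp)
        then have "\<forall>\<^sub>F n in sequentially. ?I n x = g x * indicator {..c} x"
          by eventually_elim (auto simp: indicator_def)
        then show "(\<lambda>n. ?I n x) \<longlonglongrightarrow> g x * indicator {..c} x"
          by (rule tendsto_eventually)
      qed
      have "(indicator J :: real \<Rightarrow> real) \<in> borel_measurable (lebesgue_on {\<alpha><..<\<beta>})" if "J \<in> sets borel" for J :: "real set"
        using that by (intro measurable_restrict_space1 borel_measurable_indicator) simp
      then show "(\<lambda>x. g x * indicator {..c} x) \<in> borel_measurable (lebesgue_on {\<alpha><..<\<beta>})"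
        "?I n \<in> borel_measurable (lebesgue_on {\<alpha><..<\<beta>})" for n
        by (auto intro!: borel_measurable_times[OF borel_measurable_integrable[OF g]])
    qed (use g in \<open>auto simp: indicator_def\<close>)
    ultimately show ?thesis by (simp add: LIMSEQ_const_iff)
  qed
  define h where "h = (\<lambda>x. indicator {\<alpha><..<\<beta>} x *\<^sub>R g x)"
  have hint: "integrable lebesgue h"
    using g unfolding h_def by (subst (asm) integrable_restrict_space) auto
  \<comment> \<open>The zero extension is only Lebesgue measurable, while the argument with rays is
    about Borel functions.\<close>
  obtain h' where h': "h' \<in> borel_measurable borel" "AE x in lborel. h x = h' x"
    using completion_ex_borel_measurable_real[of h lborel] borel_measurable_integrable[OF hint] by auto
  have ae: "AE x in lebesgue. h x = h' x"
    using h'(2) by (rule AE_completion)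
  have h'm: "h' \<in> borel_measurable lebesgue"
    using h'(1) by (simp add: measurable_completion)
  have "integrable lebesgue h'"
    using integrable_cong_AE[THEN iffD1, OF _ h'm ae hint] hint by auto
  then have h'i: "integrable lborel h'"
    using h'(1) by (simp add: integrable_completion)
  have "AE x in lborel. h' x = 0"
  proof (rule AE_eq_0_if_integrals_atMost_eq_0[OF h'i])
    fix c :: real
    have "set_lebesgue_integral lborel {..c} h' = (LINT x|lebesgue. indicator {..c} x *\<^sub>R h' x)"
      unfolding set_lebesgue_integral_def using h'(1)
      by (intro integral_completion[symmetric] borel_measurable_scaleR) auto
    also have "\<dots> = (LINT x|lebesgue. indicator {..c} x *\<^sub>R h x)"
      using ae h'm borel_measurable_integrable[OF hint]
      by (intro integral_cong_AE borel_measurable_scaleR borel_measurable_indicator) auto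
    also have "\<dots> = (LINT x|lebesgue. indicator {\<alpha><..<\<beta>} x *\<^sub>R (g x * indicator {..c} x))"
      unfolding h_def by (intro Bochner_Integration.integral_cong) (auto simp: indicator_def)
    also have "\<dots> = (LINT x|lebesgue_on {\<alpha><..<\<beta>}. g x * indicator {..c} x)"
      by (subst integral_restrict_space) auto
    also have "\<dots> = 0"
    proof (cases "\<alpha> < c")
      case False
      then have "(LINT x|lebesgue_on {\<alpha><..<\<beta>}. g x * indicator {..c} x) = (LINT x|lebesgue_on {\<alpha><..<\<beta>}. 0)"
        by (intro Bochner_Integration.integral_cong) (auto simp: indicator_def)
      then show ?thesis by simp
    qed (rule half)
    finally show "set_lebesgue_integral lborel {..c} h' = 0" .
  qed
  then have "AE x in lebesgue. h' x = 0" by (rule AE_completion)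
  with ae have "AE x in lebesgue. h x = 0" by eventually_elim simp
  then show ?thesis
    by (subst AE_restrict_space_iff) (auto simp: h_def indicator_def elim!: eventually_mono)
qed

section \<open>Integration over bounded open intervals\<close>

lemma integrable_lebesgue_on_mult_bounded:
  fixes g :: "real \<Rightarrow> real"
  assumes "integrable M g" "h \<in> borel_measurable M" "\<And>x. x \<in> space M \<Longrightarrow> \<bar>h x\<bar> \<le> B"
  shows "integrable M (\<lambda>x. g x * h x)"
proof (rule Bochner_Integration.integrable_bound[of _ "\<lambda>x. B * g x"])
  show "AE x in M. norm (g x * h x) \<le> norm (B * g x)"
  proof (rule AE_I2)
    fix x assume x: "x \<in> space M"
    have "\<bar>g x\<bar> * \<bar>h x\<bar> \<le> \<bar>g x\<bar> * \<bar>B\<bar>"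
      using assms(3)[OF x] by (intro mult_left_mono) auto
    then show "norm (g x * h x) \<le> norm (B * g x)" by (simp add: abs_mult mult.commute)
  qed
qed (use assms in auto)

lemma continuous_borel_measurable_lebesgue_on:
  fixes h :: "real \<Rightarrow> real"
  assumes "continuous_on {\<alpha>..\<beta>} h"
  shows "h \<in> borel_measurable (lebesgue_on {\<alpha><..<\<beta>})"
  using assms by (intro continuous_imp_measurable_on_sets_lebesgue) (auto intro: continuous_on_subset)

lemma continuous_bounded_Icc:
  fixes h :: "real \<Rightarrow> real"
  assumes "continuous_on {\<alpha>..\<beta>} h"
  obtains B where "\<And>x. x \<in> {\<alpha>..\<beta>} \<Longrightarrow> \<bar>h x\<bar> \<le> B"
proof -
  have "bounded (h ` {\<alpha>..\<beta>})"
    using assms by (intro compact_imp_bounded compact_continuous_image) auto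
  then show thesis using that unfolding bounded_iff by (auto simp del: atLeastAtMost_iff)
qed

lemma integrable_mult_continuous:
  fixes g h :: "real \<Rightarrow> real"
  assumes "integrable (lebesgue_on {\<alpha><..<\<beta>}) g" "continuous_on {\<alpha>..\<beta>} h"
  shows "integrable (lebesgue_on {\<alpha><..<\<beta>}) (\<lambda>x. g x * h x)"
proof -
  obtain B where "\<And>x. x \<in> {\<alpha>..\<beta>} \<Longrightarrow> \<bar>h x\<bar> \<le> B"
    using continuous_bounded_Icc[OF assms(2)] by blast
  then show ?thesis
    using assms by (intro integrable_lebesgue_on_mult_bounded[where B = B]
        continuous_borel_measurable_lebesgue_on) auto
qed

lemma finite_measure_interval: "finite_measure (lebesgue_on {\<alpha><..<\<beta>::real})"
  by (rule finite_measure_lebesgue_on) simp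

lemma integrable_const_interval: "integrable (lebesgue_on {\<alpha><..<\<beta>::real}) (\<lambda>_. c::real)"
  by (rule finite_measure.integrable_const[OF finite_measure_interval])

lemma integrable_continuous_interval:
  fixes h :: "real \<Rightarrow> real"
  assumes "continuous_on {\<alpha>..\<beta>} h"
  shows "integrable (lebesgue_on {\<alpha><..<\<beta>}) h"
  using integrable_mult_continuous[OF integrable_const_interval[of \<alpha> \<beta> 1] assms] by simp

text \<open>The two endpoints are a null set, so the integral may be taken over the closed interval
  with respect to \<open>lborel\<close>, where the fundamental theorem of calculus applies.\<close>

lemma integral_deriv_interval:
  fixes F f :: "real \<Rightarrow> real"
  assumes "\<alpha> \<le> \<beta>" "\<And>x. x \<in> {\<alpha>..\<beta>} \<Longrightarrow> (F has_real_derivative f x) (at x within {\<alpha>..\<beta>})"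
    and "continuous_on {\<alpha>..\<beta>} f"
  shows "(LINT x|lebesgue_on {\<alpha><..<\<beta>}. f x) = F \<beta> - F \<alpha>"
proof -
  have eq: "(LINT x|lebesgue_on {\<alpha><..<\<beta>}. f x) = (LINT x|lebesgue. indicator {\<alpha><..<\<beta>} x *\<^sub>R f x)"
    by (subst integral_restrict_space) auto
  have m: "(\<lambda>x. indicator {\<alpha>..\<beta>} x *\<^sub>R f x) \<in> borel_measurable borel"
    using assms(3) by (intro borel_measurable_continuous_on_indicator) auto
  then have m1: "(\<lambda>x. indicator {\<alpha>..\<beta>} x *\<^sub>R f x) \<in> borel_measurable lebesgue"
    by (simp add: measurable_completion)
  have "(\<lambda>x. indicator {\<alpha><..<\<beta>} x *\<^sub>R (indicator {\<alpha>..\<beta>} x *\<^sub>R f x)) \<in> borel_measurable lebesgue"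
    by (intro borel_measurable_scaleR m1 borel_measurable_indicator) simp
  also have "(\<lambda>x. indicator {\<alpha><..<\<beta>} x *\<^sub>R (indicator {\<alpha>..\<beta>} x *\<^sub>R f x)) = (\<lambda>x. indicator {\<alpha><..<\<beta>} x *\<^sub>R f x)"
    by (auto simp: indicator_def)
  finally have m2: "(\<lambda>x. indicator {\<alpha><..<\<beta>} x *\<^sub>R f x) \<in> borel_measurable lebesgue" .
  have n: "{\<alpha>, \<beta>} \<in> null_sets lebesgue"
    by (intro null_sets_completionI finite_imp_null_set_lborel) auto
  have "AE x in lebesgue. indicator {\<alpha><..<\<beta>} x *\<^sub>R f x = indicator {\<alpha>..\<beta>} x *\<^sub>R f x"
    using AE_not_in[OF n] by eventually_elim (auto simp: indicator_def)
  then have "(LINT x|lebesgue. indicator {\<alpha><..<\<beta>} x *\<^sub>R f x) = (LINT x|lebesgue. indicator {\<alpha>..\<beta>} x *\<^sub>R f x)"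
    using m1 m2 by (intro integral_cong_AE)
  also have "\<dots> = (LINT x|lborel. indicator {\<alpha>..\<beta>} x *\<^sub>R f x)"
    using m by (intro integral_completion) auto
  also have "\<dots> = F \<beta> - F \<alpha>"
    using assms by (intro integral_FTC_atLeastAtMost) (auto simp: has_real_derivative_iff_has_vector_derivative)
  finally show ?thesis using eq by simp
qed

text \<open>Smoothed indicators of \<open>{c<..d}\<close> are test functions bounded by 1 that
  converge pointwise, so dominated convergence gives vanishing interval integrals.\<close>

lemma fundamental_lemma_variations:
  fixes g :: "real \<Rightarrow> real"
  assumes g: "integrable (lebesgue_on {\<alpha><..<\<beta>}) g" and "\<alpha> < \<beta>"
    and zero: "\<And>\<phi>. test_function {\<alpha><..<\<beta>} \<phi> \<Longrightarrow> (LINT x|lebesgue_on {\<alpha><..<\<beta>}. g x * \<phi> x) = 0"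
  shows "AE x in lebesgue_on {\<alpha><..<\<beta>}. g x = 0"
proof (rule AE_eq_0_if_interval_integrals_eq_0[OF g \<open>\<alpha> < \<beta>\<close>])
  fix c d assume cd: "\<alpha> < c" "c \<le> d" "d < \<beta>"
  obtain S :: "real \<Rightarrow> real" where S: "smooth S" "mono S" "\<forall>x\<le>0. S x = 0" "\<forall>x\<ge>1. S x = 1"
    using smooth_step_exists by blast
  have S01: "0 \<le> S x" "S x \<le> 1" for x
    using monoD[OF S(2), of 0 x] monoD[OF S(2), of x 1] S(3,4)
    by (cases "x \<le> 0"; cases "x \<ge> 1"; auto)+
  \<comment> \<open>The denominators start at 2, so the ramp after \<open>d\<close> uses at most
    half of the gap to \<open>\<beta>\<close>.\<close>
  define e where "e = (\<lambda>n. (\<beta> - d) / (real n + 2))"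
  have e: "e \<longlonglongrightarrow> 0" "\<And>n. e n > 0"
    using cd const_over_n_plus_2 unfolding e_def by auto
  have "e n \<le> (\<beta> - d) / 2" for n
    using cd unfolding e_def by (intro divide_left_mono) auto
  moreover have "(\<beta> - d) / 2 < \<beta> - d" using cd by simp
  ultimately have lt: "d + e n < \<beta>" for n by (metis add.commute le_less_trans less_diff_eq)
  let ?\<phi> = "\<lambda>n x. S ((x - c) / e n) - S ((x - d) / e n)"
  have test: "test_function {\<alpha><..<\<beta>} (?\<phi> n)" for n
    using S cd e(2) lt by (intro test_function_step) auto
  have "(\<lambda>n. LINT x|lebesgue_on {\<alpha><..<\<beta>}. g x * ?\<phi> n x) \<longlonglongrightarrow>
      (LINT x|lebesgue_on {\<alpha><..<\<beta>}. g x * indicator {c<..d} x)"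
  proof (rule integral_dominated_convergence[where w = "\<lambda>x. \<bar>g x\<bar>"])
    show "AE x in lebesgue_on {\<alpha><..<\<beta>}. (\<lambda>n. g x * ?\<phi> n x) \<longlonglongrightarrow> g x * indicator {c<..d} x"
    proof (rule AE_I2)
      fix x
      have lim: "(\<lambda>n. S ((x - b) / e n)) \<longlonglongrightarrow> (if x \<le> b then 0 else 1)" for b
      proof (cases "x \<le> b")
        case True
        then have "S ((x - b) / e n) = 0" for n
          using S(3) e(2)[of n] by (simp add: divide_le_0_iff)
        then show ?thesis using True by simp
      next
        case False
        then have "\<forall>\<^sub>F n in sequentially. e n < x - b"
          using order_tendstoD(2)[OF e(1)] by simp
        then have "\<forall>\<^sub>F n in sequentially. S ((x - b) / e n) = 1"
          by eventually_elim (use S(4) e(2) in \<open>auto simp: le_divide_eq less_imp_le\<close>)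
        then show ?thesis using False by (simp add: tendsto_eventually)
      qed
      have "(\<lambda>n. g x * ?\<phi> n x) \<longlonglongrightarrow> g x * ((if x \<le> c then 0 else 1) - (if x \<le> d then 0 else 1))"
        by (intro tendsto_intros lim)
      also have "(if x \<le> c then 0 else 1) - (if x \<le> d then 0 else 1) = (indicator {c<..d} x :: real)"
        using cd by (auto simp: indicator_def)
      finally show "(\<lambda>n. g x * ?\<phi> n x) \<longlonglongrightarrow> g x * indicator {c<..d} x" .
    qed
    show "AE x in lebesgue_on {\<alpha><..<\<beta>}. norm (g x * ?\<phi> n x) \<le> \<bar>g x\<bar>" for n
    proof (rule AE_I2)
      fix x
      have "\<bar>?\<phi> n x\<bar> \<le> 1"
        using S01[of "(x - c) / e n"] S01[of "(x - d) / e n"] by linarith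
      then show "norm (g x * ?\<phi> n x) \<le> \<bar>g x\<bar>"
        by (simp add: abs_mult mult_left_le)
    qed
    show "(\<lambda>x. g x * ?\<phi> n x) \<in> borel_measurable (lebesgue_on {\<alpha><..<\<beta>})" for n
      using integrable_mult_continuous[OF g smooth_continuous[OF test_function_smooth[OF test]]]
      by (rule borel_measurable_integrable)
    have "indicator {c<..d} \<in> borel_measurable (lebesgue_on {\<alpha><..<\<beta>})"
      by (intro measurable_restrict_space1 borel_measurable_indicator) simp
    then show "(\<lambda>x. g x * indicator {c<..d} x) \<in> borel_measurable (lebesgue_on {\<alpha><..<\<beta>})"
      by (rule borel_measurable_times[OF borel_measurable_integrable[OF g]])
  qed (use g in \<open>auto intro!: borel_measurable_integrable\<close>)
  then show "(LINT x|lebesgue_on {\<alpha><..<\<beta>}. g x * indicator {c<..d} x) = 0"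
    using zero[OF test] by (simp add: LIMSEQ_const_iff)
qed

lemma constant_if_deriv_eq_0_Icc:
  fixes F :: "real \<Rightarrow> real"
  assumes "\<And>x. (F has_real_derivative f x) (at x)" "a \<le> b" "\<And>x. a < x \<Longrightarrow> x < b \<Longrightarrow> f x = 0"
  shows "F a = F b"
proof (cases "a = b")
  case False
  then obtain z where "a < z" "z < b" "F b - F a = (b - a) * f z"
    using MVT2[of a b F f] assms by auto
  then show ?thesis using assms(3) by simp
qed simp

text \<open>A test function is a derivative of a test function exactly when its integral vanishes.
  An arbitrary \<open>\<eta>\<close> with integral \<open>m\<close> is corrected by
  \<open>m * deriv P\<close>, where \<open>P\<close> climbs from 0 to 1 in the middle third, so that
  \<open>deriv P\<close> has integral 1. The constant is then the pairing of \<open>g\<close> with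
  \<open>deriv P\<close>.\<close>

lemma du_Bois_Reymond:
  fixes g :: "real \<Rightarrow> real"
  assumes g: "integrable (lebesgue_on {\<alpha><..<\<beta>}) g" and "\<alpha> < \<beta>"
    and zero: "\<And>\<phi>. test_function {\<alpha><..<\<beta>} \<phi> \<Longrightarrow> (LINT x|lebesgue_on {\<alpha><..<\<beta>}. g x * deriv \<phi> x) = 0"
  shows "\<exists>C. AE x in lebesgue_on {\<alpha><..<\<beta>}. g x = C"
proof -
  obtain S :: "real \<Rightarrow> real" where S: "smooth S" "mono S" "\<forall>x\<le>0. S x = 0" "\<forall>x\<ge>1. S x = 1"
    using smooth_step_exists by blast
  define \<epsilon> where "\<epsilon> = (\<beta> - \<alpha>) / 3"
  define P where "P = (\<lambda>x. 1 * S ((1 / \<epsilon>) * x + (- (\<alpha> + \<epsilon>) / \<epsilon>)))"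
  have \<epsilon>: "\<epsilon> > 0" using \<open>\<alpha> < \<beta>\<close> by (simp add: \<epsilon>_def)
  have P: "smooth P" unfolding P_def by (intro smooth_affine S)
  have P0: "P x = 0" if "x \<le> \<alpha> + \<epsilon>" for x
    using that S(3) \<epsilon> by (simp add: P_def divide_simps)
  have P1: "P x = 1" if "x \<ge> \<beta> - \<epsilon>" for x
  proof -
    have "x \<ge> \<alpha> + 2 * \<epsilon>" using that by (simp add: \<epsilon>_def field_simps)
    then show ?thesis using S(4) \<epsilon> by (simp add: P_def divide_simps)
  qed
  define C where "C = (LINT x|lebesgue_on {\<alpha><..<\<beta>}. g x * deriv P x)"
  have "AE x in lebesgue_on {\<alpha><..<\<beta>}. g x - C = 0"
  proof (rule fundamental_lemma_variations[OF _ \<open>\<alpha> < \<beta>\<close>])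
    show "integrable (lebesgue_on {\<alpha><..<\<beta>}) (\<lambda>x. g x - C)"
      by (intro Bochner_Integration.integrable_diff g integrable_const_interval)
    fix \<eta> assume \<eta>: "test_function {\<alpha><..<\<beta>} \<eta>"
    then have \<eta>s: "smooth \<eta>" by (rule test_function_smooth)
    obtain c d where cd: "\<alpha> < c" "c < d" "d < \<beta>" "\<And>x. x \<notin> {c..d} \<Longrightarrow> \<eta> x = 0"
      using test_function_support_interval[OF \<eta> \<open>\<alpha> < \<beta>\<close>] by blast
    obtain X0 where X0: "\<And>x. (X0 has_real_derivative \<eta> x) (at x)"
      using continuous_imp_antiderivative smooth_continuous[OF \<eta>s] by blast
    define X where "X = (\<lambda>x. X0 x - X0 \<alpha>)"
    have X: "(X has_real_derivative \<eta> x) (at x)" for x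
      unfolding X_def using X0[of x] by (auto intro!: derivative_eq_intros)
    have Xs: "smooth X" using smooth_antiderivative[OF X \<eta>s] .
    have Xl: "X x = 0" if "x < c" for x
    proof -
      have "X (min x \<alpha>) = X x"
        by (rule constant_if_deriv_eq_0_Icc[OF X]) (use that cd in auto)
      moreover have "X (min x \<alpha>) = X \<alpha>"
        by (rule constant_if_deriv_eq_0_Icc[OF X]) (use that cd in auto)
      ultimately show ?thesis by (simp add: X_def)
    qed
    define m where "m = X \<beta>"
    have Xr: "X x = m" if "x > d" for x
    proof -
      have "X x = X (max x \<beta>)"
        by (rule constant_if_deriv_eq_0_Icc[OF X]) (use that cd in auto)
      moreover have "X \<beta> = X (max x \<beta>)"
        by (rule constant_if_deriv_eq_0_Icc[OF X]) (use that cd in auto)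
      ultimately show ?thesis by (simp add: m_def)
    qed
    have int\<eta>: "(LINT x|lebesgue_on {\<alpha><..<\<beta>}. \<eta> x) = m"
      using integral_deriv_interval[of \<alpha> \<beta> X \<eta>] X \<open>\<alpha> < \<beta>\<close> smooth_continuous[OF \<eta>s]
      by (auto simp: m_def X_def has_field_derivative_at_within)
    define \<phi> where "\<phi> = (\<lambda>x. X x + (- m) * P x)"
    have "\<phi> x = 0" if "x \<notin> {min c (\<alpha> + \<epsilon>)..max d (\<beta> - \<epsilon>)}" for x
      using that Xl[of x] Xr[of x] P0[of x] P1[of x] by (auto simp: \<phi>_def)
    moreover have "smooth \<phi>" unfolding \<phi>_def by (intro smooth_add smooth_cmult Xs P)
    ultimately have "test_function {\<alpha><..<\<beta>} \<phi>"
      unfolding test_function_iff using cd \<epsilon>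
      by (intro conjI exI[of _ "{min c (\<alpha> + \<epsilon>)..max d (\<beta> - \<epsilon>)}"]) auto
    from zero[OF this] have "(LINT x|lebesgue_on {\<alpha><..<\<beta>}. g x * deriv \<phi> x) = 0" .
    moreover have "deriv \<phi> x = \<eta> x - m * deriv P x" for x
      unfolding \<phi>_def
      by (rule DERIV_imp_deriv) (auto intro!: derivative_eq_intros X smooth_DERIV[OF P])
    moreover have i1: "integrable (lebesgue_on {\<alpha><..<\<beta>}) (\<lambda>x. g x * \<eta> x)"
      by (intro integrable_mult_continuous[OF g] smooth_continuous \<eta>s)
    moreover have "integrable (lebesgue_on {\<alpha><..<\<beta>}) (\<lambda>x. g x * deriv P x)"
      by (intro integrable_mult_continuous[OF g] smooth_continuous smooth_deriv P)
    ultimately have "(LINT x|lebesgue_on {\<alpha><..<\<beta>}. g x * \<eta> x) - m * C = 0"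
      by (simp add: C_def right_diff_distrib mult.left_commute[of _ m])
    moreover have "integrable (lebesgue_on {\<alpha><..<\<beta>}) \<eta>"
      by (intro integrable_continuous_interval smooth_continuous \<eta>s)
    ultimately show "(LINT x|lebesgue_on {\<alpha><..<\<beta>}. (g x - C) * \<eta> x) = 0"
      using i1 int\<eta> by (simp add: left_diff_distrib)
  qed
  then show ?thesis by (intro exI[of _ C]) simp
qed

subsection \<open>The space of square integrable functions\<close>

lemma L2_measurable: "u \<in> L2 \<Longrightarrow> u \<in> borel_measurable (lebesgue_on \<Omega>)"
  by (simp add: L2_def)

lemma L2_mult_integrable:
  assumes "u \<in> L2" "v \<in> L2"
  shows "integrable (lebesgue_on \<Omega>) (\<lambda>x. u x * v x)"
proof (rule Bochner_Integration.integrable_bound[of _ "\<lambda>x. (u x)\<^sup>2 + (v x)\<^sup>2"])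
  show "integrable (lebesgue_on \<Omega>) (\<lambda>x. (u x)\<^sup>2 + (v x)\<^sup>2)"
    using assms by (auto simp: L2_def)
  show "(\<lambda>x. u x * v x) \<in> borel_measurable (lebesgue_on \<Omega>)"
    using assms by (intro borel_measurable_times L2_measurable)
  show "AE x in lebesgue_on \<Omega>. norm (u x * v x) \<le> norm ((u x)\<^sup>2 + (v x)\<^sup>2)"
  proof (rule AE_I2)
    fix x
    have "0 \<le> (\<bar>u x\<bar> - \<bar>v x\<bar>)\<^sup>2" by simp
    then have "2 * (\<bar>u x\<bar> * \<bar>v x\<bar>) \<le> (u x)\<^sup>2 + (v x)\<^sup>2"
      by (simp add: power2_diff mult.assoc)
    moreover have "0 \<le> \<bar>u x\<bar> * \<bar>v x\<bar>" by simp
    ultimately have "\<bar>u x\<bar> * \<bar>v x\<bar> \<le> (u x)\<^sup>2 + (v x)\<^sup>2" by linarith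
    then show "norm (u x * v x) \<le> norm ((u x)\<^sup>2 + (v x)\<^sup>2)"
      by (simp add: abs_mult)
  qed
qed

lemma L2_lincomb:
  assumes "u \<in> L2" "v \<in> L2"
  shows "(\<lambda>x. c * u x + d * v x) \<in> L2"
proof -
  have "(\<lambda>x. (c * u x + d * v x)\<^sup>2) =
      (\<lambda>x. c\<^sup>2 * (u x)\<^sup>2 + 2 * c * d * (u x * v x) + d\<^sup>2 * (v x)\<^sup>2)"
    by (auto simp: power2_eq_square algebra_simps)
  then show ?thesis
    using assms L2_mult_integrable[OF assms] by (auto simp: L2_def)
qed

lemma L2_add: "u \<in> L2 \<Longrightarrow> v \<in> L2 \<Longrightarrow> (\<lambda>x. u x + v x) \<in> L2"
  using L2_lincomb[of u v 1 1] by simp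

lemma L2_diff: "u \<in> L2 \<Longrightarrow> v \<in> L2 \<Longrightarrow> u - v \<in> L2"
  using L2_lincomb[of u v 1 "-1"] by (simp add: fun_diff_def)

lemma L2_cmult: "u \<in> L2 \<Longrightarrow> (\<lambda>x. c * u x) \<in> L2"
  using L2_lincomb[of u u c 0] by simp

lemma L2_bounded:
  assumes "u \<in> borel_measurable (lebesgue_on \<Omega>)" "AE x in lebesgue_on \<Omega>. \<bar>u x\<bar> \<le> B"
  shows "u \<in> L2"
proof -
  have "integrable (lebesgue_on \<Omega>) (\<lambda>x. (u x)\<^sup>2)"
  proof (rule Bochner_Integration.integrable_bound[of _ "\<lambda>_. B\<^sup>2"])
    show "AE x in lebesgue_on \<Omega>. norm ((u x)\<^sup>2) \<le> norm (B\<^sup>2)"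
      using assms(2) by eventually_elim (simp add: abs_le_square_iff[symmetric])
  qed (use assms integrable_const_interval in auto)
  then show ?thesis using assms by (simp add: L2_def)
qed

lemma L2_continuous:
  assumes "continuous_on {0..1} h"
  shows "h \<in> L2"
proof -
  obtain B where "\<And>x. x \<in> {0..1} \<Longrightarrow> \<bar>h x\<bar> \<le> B"
    using continuous_bounded_Icc[OF assms] by blast
  then show ?thesis
    by (intro L2_bounded[where B = B] continuous_borel_measurable_lebesgue_on assms AE_I2) auto
qed

lemma L2_integrable: "u \<in> L2 \<Longrightarrow> integrable (lebesgue_on \<Omega>) u"
  using L2_mult_integrable[of u "\<lambda>_. 1"] L2_continuous[of "\<lambda>_. 1"] by simp

lemma L2_inner_commute: "L2_inner u v = L2_inner v u"
  by (simp add: L2_inner_def mult.commute)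

lemma L2_inner_lincomb_left:
  assumes "u \<in> L2" "v \<in> L2" "w \<in> L2"
  shows "L2_inner (\<lambda>x. c * u x + d * v x) w = c * L2_inner u w + d * L2_inner v w"
  using L2_mult_integrable[OF assms(1,3)] L2_mult_integrable[OF assms(2,3)]
  by (simp add: L2_inner_def distrib_right mult.assoc)

lemma L2_inner_diff_left:
  "u \<in> L2 \<Longrightarrow> v \<in> L2 \<Longrightarrow> w \<in> L2 \<Longrightarrow> L2_inner (u - v) w = L2_inner u w - L2_inner v w"
  using L2_inner_lincomb_left[of u v w 1 "-1"] by (simp add: fun_diff_def)

lemma L2_inner_diff_right:
  "u \<in> L2 \<Longrightarrow> v \<in> L2 \<Longrightarrow> w \<in> L2 \<Longrightarrow> L2_inner w (u - v) = L2_inner w u - L2_inner w v"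
  using L2_inner_diff_left[of u v w] by (simp add: L2_inner_commute)

lemma L2_inner_cmult_left: "L2_inner (\<lambda>x. c * u x) v = c * L2_inner u v"
  by (simp add: L2_inner_def mult.assoc)

lemma L2_inner_nonneg: "0 \<le> L2_inner u u"
  by (simp add: L2_inner_def)

lemma L2_norm_nonneg [simp]: "0 \<le> L2_norm u"
  by (simp add: L2_norm_def L2_inner_nonneg)

lemma L2_norm_sq: "(L2_norm u)\<^sup>2 = L2_inner u u"
  by (simp add: L2_norm_def L2_inner_nonneg)

lemma L2_norm_minus_commute: "L2_norm (u - v) = L2_norm (v - u)"
  unfolding L2_norm_def L2_inner_def by (simp add: algebra_simps)

lemma L2_norm_cmult: "L2_norm (\<lambda>x. c * u x) = \<bar>c\<bar> * L2_norm u"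
proof -
  have "L2_inner (\<lambda>x. c * u x) (\<lambda>x. c * u x) = c\<^sup>2 * L2_inner u u"
    unfolding L2_inner_cmult_left by (subst L2_inner_commute) (simp add: L2_inner_cmult_left power2_eq_square)
  then show ?thesis by (simp add: L2_norm_def real_sqrt_mult)
qed

lemma L2_inner_cong_AE:
  assumes "u \<in> L2" "u' \<in> L2" "v \<in> L2" "v' \<in> L2"
    and "AE x in lebesgue_on \<Omega>. u x = u' x" "AE x in lebesgue_on \<Omega>. v x = v' x"
  shows "L2_inner u v = L2_inner u' v'"
  unfolding L2_inner_def
proof (rule integral_cong_AE)
  show "AE x in lebesgue_on \<Omega>. u x * v x = u' x * v' x"
    using assms(5,6) by eventually_elim simp
qed (rule borel_measurable_times[OF L2_measurable L2_measurable], use assms in auto)+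

lemma L2_norm_cong_AE:
  "u \<in> L2 \<Longrightarrow> u' \<in> L2 \<Longrightarrow> AE x in lebesgue_on \<Omega>. u x = u' x \<Longrightarrow> L2_norm u = L2_norm u'"
  unfolding L2_norm_def by (metis L2_inner_cong_AE)

lemma L2_norm_eq_0_AE:
  assumes "u \<in> L2" "L2_norm u = 0"
  shows "AE x in lebesgue_on \<Omega>. u x = 0"
proof -
  have "(LINT x|lebesgue_on \<Omega>. (u x)\<^sup>2) = 0"
    using assms(2) L2_norm_sq[of u] by (simp add: L2_inner_def power2_eq_square)
  then have "AE x in lebesgue_on \<Omega>. (u x)\<^sup>2 = 0"
    using assms(1) by (subst (asm) integral_nonneg_eq_0_iff_AE) (auto simp: L2_def)
  then show ?thesis by simp
qed

lemma L2_Cauchy_Schwarz: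
  assumes "u \<in> L2" "v \<in> L2"
  shows "\<bar>L2_inner u v\<bar> \<le> L2_norm u * L2_norm v"
proof -
  have quad: "0 \<le> s\<^sup>2 * (L2_norm u)\<^sup>2 + 2 * s * t * L2_inner u v + t\<^sup>2 * (L2_norm v)\<^sup>2" for s t
  proof -
    have w: "(\<lambda>x. s * u x + t * v x) \<in> L2" using assms by (rule L2_lincomb)
    have "0 \<le> L2_inner (\<lambda>x. s * u x + t * v x) (\<lambda>x. s * u x + t * v x)"
      by (rule L2_inner_nonneg)
    also have "\<dots> = s * L2_inner (\<lambda>x. s * u x + t * v x) u + t * L2_inner (\<lambda>x. s * u x + t * v x) v"
      unfolding L2_inner_lincomb_left[OF assms w] by (simp add: L2_inner_commute)
    also have "\<dots> = s\<^sup>2 * (L2_norm u)\<^sup>2 + 2 * s * t * L2_inner u v + t\<^sup>2 * (L2_norm v)\<^sup>2"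
      unfolding L2_inner_lincomb_left[OF assms assms(1)] L2_inner_lincomb_left[OF assms assms(2)] L2_norm_sq
      by (simp add: L2_inner_commute[of v u] power2_eq_square algebra_simps)
    finally show ?thesis .
  qed
  define a b c where "a = L2_norm u" and "b = L2_norm v" and "c = L2_inner u v"
  have ab: "a \<ge> 0" "b \<ge> 0" by (auto simp: a_def b_def)
  have q: "0 \<le> s\<^sup>2 * a\<^sup>2 + 2 * s * t * c + t\<^sup>2 * b\<^sup>2" for s t
    using quad[of s t] by (simp add: a_def b_def c_def)
  have "c\<^sup>2 \<le> a\<^sup>2 * b\<^sup>2"
  proof (cases "b = 0")
    case True
    have "c = 0"
    proof (rule ccontr)
      assume "c \<noteq> 0"
      \<comment> \<open>For \<open>b = 0\<close> the form is affine in \<open>t\<close>, and this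
        value of \<open>t\<close> makes it equal to -1.\<close>
      then show False using q[of 1 "- (a\<^sup>2 + 1) / (2 * c)"] True by (simp add: field_simps)
    qed
    then show ?thesis by simp
  next
    case False
    \<comment> \<open>Up to scaling, this choice of \<open>s\<close> and \<open>t\<close> minimises
      the quadratic form.\<close>
    have "0 \<le> (b\<^sup>2)\<^sup>2 * a\<^sup>2 + 2 * b\<^sup>2 * (- c) * c + (- c)\<^sup>2 * b\<^sup>2" by (rule q)
    also have "\<dots> = b\<^sup>2 * (a\<^sup>2 * b\<^sup>2 - c\<^sup>2)" by (simp add: power2_eq_square algebra_simps)
    finally show ?thesis using False by (simp add: zero_le_mult_iff)
  qed
  then have "\<bar>c\<bar>\<^sup>2 \<le> (a * b)\<^sup>2" by (simp add: power_mult_distrib)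
  then show ?thesis
    using ab by (simp add: abs_le_square_iff[symmetric] a_def b_def c_def)
qed

lemma L2_norm_triangle:
  assumes "u \<in> L2" "v \<in> L2"
  shows "L2_norm (\<lambda>x. u x + v x) \<le> L2_norm u + L2_norm v"
proof -
  have w: "(\<lambda>x. u x + v x) \<in> L2" using assms by (rule L2_add)
  have "(L2_norm (\<lambda>x. u x + v x))\<^sup>2 = (L2_norm u)\<^sup>2 + 2 * L2_inner u v + (L2_norm v)\<^sup>2"
    using L2_inner_lincomb_left[OF assms w, of 1 1] L2_inner_lincomb_left[OF assms assms(1), of 1 1]
      L2_inner_lincomb_left[OF assms assms(2), of 1 1]
    by (simp add: L2_norm_sq L2_inner_commute)
  also have "\<dots> \<le> (L2_norm u + L2_norm v)\<^sup>2"
    using L2_Cauchy_Schwarz[OF assms] by (simp add: power2_sum)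
  finally show ?thesis by (rule power2_le_imp_le) simp
qed

lemma L2_norm_diff_triangle:
  assumes "u \<in> L2" "v \<in> L2" "w \<in> L2"
  shows "L2_norm (u - w) \<le> L2_norm (u - v) + L2_norm (v - w)"
  using L2_norm_triangle[OF L2_diff[OF assms(1,2)] L2_diff[OF assms(2,3)]]
  by (simp add: fun_diff_def)

lemma L2_norm_le_bound:
  assumes "u \<in> L2" "AE x in lebesgue_on \<Omega>. \<bar>u x\<bar> \<le> B" "B \<ge> 0"
  shows "L2_norm u \<le> B"
proof -
  have le: "(LINT x|lebesgue_on \<Omega>. (u x)\<^sup>2) \<le> (LINT x|lebesgue_on \<Omega>. B\<^sup>2)"
  proof (rule integral_mono_AE)
    show "AE x in lebesgue_on \<Omega>. (u x)\<^sup>2 \<le> B\<^sup>2"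
      using assms(2) by eventually_elim (use assms(3) in \<open>simp add: abs_le_square_iff[symmetric]\<close>)
  qed (use assms(1) integrable_const_interval in \<open>auto simp: L2_def\<close>)
  have "(LINT x|lebesgue_on \<Omega>. B\<^sup>2) = B\<^sup>2" by (simp add: measure_restrict_space)
  with le have "(L2_norm u)\<^sup>2 \<le> B\<^sup>2"
    unfolding L2_norm_sq L2_inner_def by (simp only: power2_eq_square[symmetric])
  then show ?thesis using assms(3) by (rule power2_le_imp_le)
qed

lemma L2_inner_tendsto:
  assumes "\<And>n. u n \<in> L2" "u0 \<in> L2" "\<And>n. v n \<in> L2" "v0 \<in> L2"
    and lim: "((\<lambda>n. L2_norm (u n - u0)) \<longlongrightarrow> 0) F" "((\<lambda>n. L2_norm (v n - v0)) \<longlongrightarrow> 0) F"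
  shows "((\<lambda>n. L2_inner (u n) (v n)) \<longlongrightarrow> L2_inner u0 v0) F"
proof -
  let ?B = "\<lambda>n. L2_norm (u n - u0) * L2_norm (v n - v0)
      + L2_norm (u n - u0) * L2_norm v0 + L2_norm u0 * L2_norm (v n - v0)"
  have "(?B \<longlongrightarrow> 0 * 0 + 0 * L2_norm v0 + L2_norm u0 * 0) F"
    by (intro tendsto_intros lim)
  then have B: "(?B \<longlongrightarrow> 0) F" by simp
  have "norm (L2_inner (u n) (v n) - L2_inner u0 v0) \<le> ?B n" for n
  proof -
    have eq: "L2_inner (u n) (v n) - L2_inner u0 v0 =
        L2_inner (u n - u0) (v n - v0) + L2_inner (u n - u0) v0 + L2_inner u0 (v n - v0)"
      using assms by (simp add: L2_inner_diff_left L2_inner_diff_right L2_diff)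
    show ?thesis
      unfolding eq using L2_Cauchy_Schwarz[of "u n - u0" "v n - v0"] L2_Cauchy_Schwarz[of "u n - u0" v0]
        L2_Cauchy_Schwarz[of u0 "v n - v0"] assms by (auto simp: L2_diff)
  qed
  then have "((\<lambda>n. L2_inner (u n) (v n) - L2_inner u0 v0) \<longlongrightarrow> 0) F"
    by (intro Lim_null_comparison[OF _ B] always_eventually) auto
  then show ?thesis by (simp add: LIM_zero_iff)
qed

lemma L2_norm_tendsto:
  assumes "\<And>n. u n \<in> L2" "u0 \<in> L2" "((\<lambda>n. L2_norm (u n - u0)) \<longlongrightarrow> 0) F"
  shows "((\<lambda>n. L2_norm (u n)) \<longlongrightarrow> L2_norm u0) F"
  unfolding L2_norm_def using L2_inner_tendsto[OF assms(1,2,1,2,3,3)]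
  by (intro tendsto_real_sqrt)

subsection \<open>Sobolev functions on the unit interval\<close>

lemma test_function_L2: "test_function \<Omega> \<phi> \<Longrightarrow> \<phi> \<in> L2"
  by (intro L2_continuous smooth_continuous test_function_smooth)

lemma test_function_deriv_L2: "test_function \<Omega> \<phi> \<Longrightarrow> deriv \<phi> \<in> L2"
  by (intro test_function_L2 test_function_deriv)

lemma test_function_eq_0: "test_function \<Omega> \<phi> \<Longrightarrow> x \<notin> \<Omega> \<Longrightarrow> \<phi> x = 0"
  unfolding test_function_iff by blast

lemma test_function_weak_deriv:
  assumes "test_function \<Omega> \<phi>"
  shows "has_weak_deriv \<phi> (deriv \<phi>)"
  unfolding has_weak_deriv_def
proof (intro allI impI)
  fix \<psi> assume \<psi>: "test_function \<Omega> \<psi>"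
  note s = test_function_smooth[OF assms] test_function_smooth[OF \<psi>]
  have "(LINT x|lebesgue_on \<Omega>. \<phi> x * deriv \<psi> x + deriv \<phi> x * \<psi> x) = \<phi> 1 * \<psi> 1 - \<phi> 0 * \<psi> 0"
  proof (rule integral_deriv_interval)
    show "((\<lambda>x. \<phi> x * \<psi> x) has_real_derivative \<phi> x * deriv \<psi> x + deriv \<phi> x * \<psi> x) (at x within {0..1})" for x
      using DERIV_mult[OF smooth_DERIV[OF s(1)] smooth_DERIV[OF s(2)], of x]
      by (auto intro: has_field_derivative_at_within simp: algebra_simps)
    show "continuous_on {0..1} (\<lambda>x. \<phi> x * deriv \<psi> x + deriv \<phi> x * \<psi> x)"
      by (intro continuous_on_add continuous_on_mult smooth_continuous smooth_deriv s)
  qed simp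
  then show "L2_inner \<phi> (deriv \<psi>) = - L2_inner (deriv \<phi>) \<psi>"
    using L2_mult_integrable[OF test_function_L2[OF assms] test_function_deriv_L2[OF \<psi>]]
      L2_mult_integrable[OF test_function_deriv_L2[OF assms] test_function_L2[OF \<psi>]]
      test_function_eq_0[OF assms, of 0] test_function_eq_0[OF assms, of 1]
    by (simp add: L2_inner_def)
qed

lemma weak_deriv_unique:
  assumes "g \<in> L2" "h \<in> L2" "has_weak_deriv u g" "has_weak_deriv u h"
  shows "AE x in lebesgue_on \<Omega>. g x = h x"
proof -
  have "AE x in lebesgue_on \<Omega>. (g - h) x = 0"
  proof (rule fundamental_lemma_variations)
    show "integrable (lebesgue_on \<Omega>) (g - h)"
      by (intro L2_integrable L2_diff assms)
    fix \<phi> assume \<phi>: "test_function \<Omega> \<phi>"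
    have "L2_inner (g - h) \<phi> = 0"
      using assms(3,4) \<phi> test_function_L2[OF \<phi>] assms(1,2)
      by (simp add: has_weak_deriv_def L2_inner_diff_left)
    then show "(LINT x|lebesgue_on \<Omega>. (g - h) x * \<phi> x) = 0"
      by (simp add: L2_inner_def)
  qed simp
  then show ?thesis by simp
qed

lemma has_weak_deriv_lincomb:
  assumes "u \<in> L2" "v \<in> L2" "g \<in> L2" "h \<in> L2" "has_weak_deriv u g" "has_weak_deriv v h"
  shows "has_weak_deriv (\<lambda>x. c * u x + d * v x) (\<lambda>x. c * g x + d * h x)"
  using assms test_function_L2 test_function_deriv_L2
  by (simp add: has_weak_deriv_def L2_inner_lincomb_left)

lemma H1_L2: "u \<in> H1 \<Longrightarrow> u \<in> L2"
  by (simp add: H1_def)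

lemma H1I: "u \<in> L2 \<Longrightarrow> g \<in> L2 \<Longrightarrow> has_weak_deriv u g \<Longrightarrow> u \<in> H1"
  by (auto simp: H1_def)

lemma wderiv_H1:
  assumes "u \<in> H1"
  shows "wderiv u \<in> L2" "has_weak_deriv u (wderiv u)"
proof -
  have "\<exists>g. g \<in> L2 \<and> has_weak_deriv u g" using assms by (auto simp: H1_def)
  from someI_ex[OF this] show "wderiv u \<in> L2" "has_weak_deriv u (wderiv u)"
    by (simp_all add: wderiv_def)
qed

lemma wderiv_AE_eq:
  assumes "u \<in> L2" "g \<in> L2" "has_weak_deriv u g"
  shows "AE x in lebesgue_on \<Omega>. wderiv u x = g x"
  using assms H1I wderiv_H1 by (intro weak_deriv_unique) auto

lemma H1_diff:
  assumes "u \<in> H1" "v \<in> H1"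
  shows "u - v \<in> H1" "L2_norm (wderiv (u - v)) = L2_norm (wderiv u - wderiv v)"
proof -
  have d: "has_weak_deriv (u - v) (wderiv u - wderiv v)"
    using has_weak_deriv_lincomb[of u v "wderiv u" "wderiv v" 1 "-1"] assms
    by (simp add: H1_L2 wderiv_H1 fun_diff_def)
  show "u - v \<in> H1"
    using d by (rule H1I[rotated 2]) (auto intro: L2_diff H1_L2 wderiv_H1 assms)
  then show "L2_norm (wderiv (u - v)) = L2_norm (wderiv u - wderiv v)"
    using wderiv_AE_eq[OF _ _ d] assms
    by (intro L2_norm_cong_AE) (auto intro: wderiv_H1 L2_diff H1_L2)
qed

lemma test_function_H1: "test_function \<Omega> \<phi> \<Longrightarrow> \<phi> \<in> H1"
  by (rule H1I[OF test_function_L2 test_function_deriv_L2 test_function_weak_deriv])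

text \<open>
  Membership in \<open>H10\<close> with an explicit weak derivative \<open>g\<close>, which avoids the choice in
  \<open>wderiv\<close>.
\<close>

definition h10 :: "(real \<Rightarrow> real) \<Rightarrow> (real \<Rightarrow> real) \<Rightarrow> bool" where
  "h10 w g \<longleftrightarrow> w \<in> L2 \<and> g \<in> L2 \<and> (\<exists>\<phi>. (\<forall>n::nat. test_function \<Omega> (\<phi> n)) \<and>
     (\<lambda>n. L2_norm (\<phi> n - w)) \<longlonglongrightarrow> 0 \<and> (\<lambda>n. L2_norm (deriv (\<phi> n) - g)) \<longlonglongrightarrow> 0)"

lemma h10E:
  assumes "h10 w g"
  obtains \<phi> where "\<And>n::nat. test_function \<Omega> (\<phi> n)"
    "(\<lambda>n. L2_norm (\<phi> n - w)) \<longlonglongrightarrow> 0" "(\<lambda>n. L2_norm (deriv (\<phi> n) - g)) \<longlonglongrightarrow> 0"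
  using assms unfolding h10_def by blast

lemma h10_L2:
  assumes "h10 w g"
  shows "w \<in> L2" "g \<in> L2"
  using assms by (auto simp: h10_def)

lemma wderiv_test_function_diff:
  assumes "u \<in> H1" "test_function \<Omega> \<phi>"
  shows "L2_norm (wderiv (u - \<phi>)) = L2_norm (wderiv u - deriv \<phi>)"
proof -
  have "AE x in lebesgue_on \<Omega>. wderiv \<phi> x = deriv \<phi> x"
    using assms(2) by (intro wderiv_AE_eq test_function_L2 test_function_deriv_L2 test_function_weak_deriv)
  then have "AE x in lebesgue_on \<Omega>. (wderiv u - wderiv \<phi>) x = (wderiv u - deriv \<phi>) x"
    by eventually_elim simp
  then have "L2_norm (wderiv u - wderiv \<phi>) = L2_norm (wderiv u - deriv \<phi>)"
    using assms by (intro L2_norm_cong_AE) (auto intro: L2_diff wderiv_H1 test_function_H1 test_function_deriv_L2)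
  then show ?thesis
    using H1_diff(2)[OF assms(1) test_function_H1[OF assms(2)]] by simp
qed

lemma H10_h10:
  assumes "u \<in> H10"
  shows "h10 u (wderiv u)"
proof -
  obtain \<phi> where u: "u \<in> H1" and \<phi>: "\<And>n::nat. test_function \<Omega> (\<phi> n)"
    and lim: "(\<lambda>n. H1_norm (u - \<phi> n)) \<longlonglongrightarrow> 0"
    using assms unfolding H10_def by blast
  have H1: "H1_norm (u - \<phi> n) = sqrt ((L2_norm (\<phi> n - u))\<^sup>2 + (L2_norm (deriv (\<phi> n) - wderiv u))\<^sup>2)" for n
    by (simp add: H1_norm_def wderiv_test_function_diff[OF u \<phi>] L2_norm_minus_commute)
  have "(\<lambda>n. L2_norm (\<phi> n - u)) \<longlonglongrightarrow> 0"
    by (rule Lim_null_comparison[OF _ lim]) (simp add: H1 real_sqrt_sum_squares_ge1)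
  moreover have "(\<lambda>n. L2_norm (deriv (\<phi> n) - wderiv u)) \<longlonglongrightarrow> 0"
    by (rule Lim_null_comparison[OF _ lim]) (simp add: H1 real_sqrt_sum_squares_ge2)
  ultimately show ?thesis
    unfolding h10_def using \<phi> by (intro conjI exI[of _ \<phi>] H1_L2 wderiv_H1 u) auto
qed

text \<open>Both sides of the integration by parts formula are continuous in L2, so it passes from
  the approximating test functions to the limit.\<close>

lemma h10_weak_deriv:
  assumes "h10 w g"
  shows "has_weak_deriv w g"
  unfolding has_weak_deriv_def
proof (intro allI impI)
  fix \<psi> assume \<psi>: "test_function \<Omega> \<psi>"
  obtain \<phi> where \<phi>: "\<And>n::nat. test_function \<Omega> (\<phi> n)"
    and lim: "(\<lambda>n. L2_norm (\<phi> n - w)) \<longlonglongrightarrow> 0" "(\<lambda>n. L2_norm (deriv (\<phi> n) - g)) \<longlonglongrightarrow> 0"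
    using h10E[OF assms] by blast
  have z: "L2_norm (\<eta> - \<eta>) = 0" for \<eta> by (simp add: L2_norm_def L2_inner_def)
  have "(\<lambda>n. L2_inner (\<phi> n) (deriv \<psi>)) \<longlonglongrightarrow> L2_inner w (deriv \<psi>)"
    by (rule L2_inner_tendsto[OF _ _ _ _ lim(1)])
      (auto simp: z \<phi> \<psi> h10_L2[OF assms] test_function_L2 test_function_deriv_L2)
  moreover have "(\<lambda>n. L2_inner (deriv (\<phi> n)) \<psi>) \<longlonglongrightarrow> L2_inner g \<psi>"
    by (rule L2_inner_tendsto[OF _ _ _ _ lim(2)])
      (auto simp: z \<phi> \<psi> h10_L2[OF assms] test_function_L2 test_function_deriv_L2)
  then have "(\<lambda>n. L2_inner (\<phi> n) (deriv \<psi>)) \<longlonglongrightarrow> - L2_inner g \<psi>"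
    using test_function_weak_deriv[OF \<phi>] \<psi> by (simp add: has_weak_deriv_def tendsto_minus)
  ultimately show "L2_inner w (deriv \<psi>) = - L2_inner g \<psi>"
    by (rule LIMSEQ_unique)
qed

lemma h10_H1: "h10 w g \<Longrightarrow> w \<in> H1"
  using H1I h10_L2 h10_weak_deriv by blast

lemma h10_wderiv_AE: "h10 w g \<Longrightarrow> AE x in lebesgue_on \<Omega>. wderiv w x = g x"
  using wderiv_AE_eq h10_L2 h10_weak_deriv by blast

lemma h10_norm:
  assumes "h10 w g"
  shows "H10_norm w = L2_norm g"
  unfolding H10_norm_def
  using assms by (intro L2_norm_cong_AE h10_wderiv_AE) (auto intro: wderiv_H1 h10_H1 h10_L2)

lemma h10_H10:
  assumes "h10 w g"
  shows "w \<in> H10"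
proof -
  obtain \<phi> where \<phi>: "\<And>n::nat. test_function \<Omega> (\<phi> n)"
    and lim: "(\<lambda>n. L2_norm (\<phi> n - w)) \<longlonglongrightarrow> 0" "(\<lambda>n. L2_norm (deriv (\<phi> n) - g)) \<longlonglongrightarrow> 0"
    using h10E[OF assms] by blast
  have "L2_norm (wderiv w - deriv (\<phi> n)) = L2_norm (deriv (\<phi> n) - g)" for n
    unfolding L2_norm_minus_commute[of "deriv (\<phi> n)"]
  proof (rule L2_norm_cong_AE)
    show "AE x in lebesgue_on \<Omega>. (wderiv w - deriv (\<phi> n)) x = (g - deriv (\<phi> n)) x"
      using h10_wderiv_AE[OF assms] by eventually_elim simp
  qed (auto intro!: L2_diff wderiv_H1 h10_H1[OF assms] test_function_deriv_L2 \<phi> h10_L2[OF assms])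
  then have "H1_norm (w - \<phi> n) = sqrt ((L2_norm (\<phi> n - w))\<^sup>2 + (L2_norm (deriv (\<phi> n) - g))\<^sup>2)" for n
    by (simp add: H1_norm_def wderiv_test_function_diff[OF h10_H1[OF assms] \<phi>] L2_norm_minus_commute)
  moreover have "(\<lambda>n. sqrt ((L2_norm (\<phi> n - w))\<^sup>2 + (L2_norm (deriv (\<phi> n) - g))\<^sup>2)) \<longlonglongrightarrow> sqrt (0\<^sup>2 + 0\<^sup>2)"
    by (intro tendsto_intros lim)
  ultimately have "(\<lambda>n. H1_norm (w - \<phi> n)) \<longlonglongrightarrow> 0" by simp
  then show ?thesis
    unfolding H10_def using h10_H1[OF assms] \<phi> by blast
qed

lemma h10_lincomb:
  assumes "h10 v g" "h10 w h"
  shows "h10 (\<lambda>x. c * v x + d * w x) (\<lambda>x. c * g x + d * h x)"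
proof -
  obtain \<phi> where \<phi>: "\<And>n::nat. test_function \<Omega> (\<phi> n)"
    "(\<lambda>n. L2_norm (\<phi> n - v)) \<longlonglongrightarrow> 0" "(\<lambda>n. L2_norm (deriv (\<phi> n) - g)) \<longlonglongrightarrow> 0"
    using h10E[OF assms(1)] by blast
  obtain \<psi> where \<psi>: "\<And>n::nat. test_function \<Omega> (\<psi> n)"
    "(\<lambda>n. L2_norm (\<psi> n - w)) \<longlonglongrightarrow> 0" "(\<lambda>n. L2_norm (deriv (\<psi> n) - h)) \<longlonglongrightarrow> 0"
    using h10E[OF assms(2)] by blast
  note L = h10_L2[OF assms(1)] h10_L2[OF assms(2)]
  let ?\<eta> = "\<lambda>n x. c * \<phi> n x + d * \<psi> n x"
  have test: "test_function \<Omega> (?\<eta> n)" for n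
    by (intro test_function_add test_function_cmult \<phi> \<psi>)
  have deriv: "deriv (?\<eta> n) = (\<lambda>x. c * deriv (\<phi> n) x + d * deriv (\<psi> n) x)" for n
    by (intro ext DERIV_imp_deriv)
      (auto intro!: derivative_eq_intros smooth_DERIV test_function_smooth \<phi> \<psi>)
  have bound: "L2_norm ((\<lambda>x. c * p x + d * q x) - (\<lambda>x. c * p' x + d * q' x))
      \<le> \<bar>c\<bar> * L2_norm (p - p') + \<bar>d\<bar> * L2_norm (q - q')"
    if "p \<in> L2" "q \<in> L2" "p' \<in> L2" "q' \<in> L2" for p q p' q'
  proof -
    have "(\<lambda>x. c * p x + d * q x) - (\<lambda>x. c * p' x + d * q' x) = (\<lambda>x. c * (p - p') x + d * (q - q') x)"
      by (auto simp: algebra_simps)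
    then show ?thesis
      using L2_norm_triangle[OF L2_cmult[OF L2_diff] L2_cmult[OF L2_diff], of p p' q q' c d] that
      unfolding L2_norm_cmult by (simp add: fun_diff_def)
  qed
  have lim: "(\<lambda>n. \<bar>c\<bar> * X n + \<bar>d\<bar> * Y n) \<longlonglongrightarrow> 0" if "X \<longlonglongrightarrow> 0" "Y \<longlonglongrightarrow> 0" for X Y :: "nat \<Rightarrow> real"
    using tendsto_add[OF tendsto_mult_left[OF that(1), of "\<bar>c\<bar>"] tendsto_mult_left[OF that(2), of "\<bar>d\<bar>"]]
    by simp
  have "(\<lambda>n. L2_norm (?\<eta> n - (\<lambda>x. c * v x + d * w x))) \<longlonglongrightarrow> 0"
    by (rule Lim_null_comparison[OF always_eventually lim[OF \<phi>(2) \<psi>(2)]])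
      (auto intro!: bound test_function_L2 \<phi> \<psi> L)
  moreover have "(\<lambda>n. L2_norm (deriv (?\<eta> n) - (\<lambda>x. c * g x + d * h x))) \<longlonglongrightarrow> 0"
    unfolding deriv
    by (rule Lim_null_comparison[OF always_eventually lim[OF \<phi>(3) \<psi>(3)]])
      (auto intro!: bound test_function_deriv_L2 \<phi> \<psi> L)
  ultimately show ?thesis
    unfolding h10_def using test by (intro conjI exI[of _ ?\<eta>] L2_lincomb L) auto
qed

lemma h10_diff: "h10 v g \<Longrightarrow> h10 w h \<Longrightarrow> h10 (v - w) (g - h)"
  using h10_lincomb[of v g w h 1 "-1"] by (simp add: fun_diff_def)

lemma h10_uminus: "h10 v g \<Longrightarrow> h10 (- v) (- g)"
  using h10_lincomb[of v g v g "-1" 0] by (simp add: fun_Compl_def)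

text \<open>\<open>\<phi> x\<close> is the integral of the derivative over (0, x), that is, its
  inner product with an indicator of L2 norm at most 1. This is the embedding of \<open>H10\<close>
  into the bounded functions, with constant 1.\<close>

lemma test_function_sup_bound:
  assumes "test_function \<Omega> \<phi>"
  shows "\<bar>\<phi> x\<bar> \<le> L2_norm (deriv \<phi>)"
proof (cases "x \<in> \<Omega>")
  case True
  note s = test_function_smooth[OF assms]
  let ?J = "indicator {0<..<x} :: real \<Rightarrow> real"
  have J: "?J \<in> L2"
  proof (rule L2_bounded[where B = 1])
    show "?J \<in> borel_measurable (lebesgue_on \<Omega>)"
      by (intro measurable_restrict_space1 borel_measurable_indicator) simp
  qed (simp add: indicator_def)
  have "\<phi> x = \<phi> x - \<phi> 0" using test_function_eq_0[OF assms, of 0] by simp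
  also have "\<dots> = (LINT y|lebesgue_on {0<..<x}. deriv \<phi> y)"
    using True smooth_DERIV[OF s] smooth_continuous[OF smooth_deriv[OF s]]
    by (intro integral_deriv_interval[where F = \<phi> and f = "deriv \<phi>", symmetric])
      (auto intro: has_field_derivative_at_within)
  also have "\<dots> = (LINT y|lebesgue. indicator {0<..<x} y *\<^sub>R deriv \<phi> y)"
    by (subst integral_restrict_space) auto
  also have "\<dots> = (LINT y|lebesgue. indicator \<Omega> y *\<^sub>R (deriv \<phi> y * ?J y))"
    using True by (intro Bochner_Integration.integral_cong) (auto simp: indicator_def)
  also have "\<dots> = L2_inner (deriv \<phi>) ?J"
    unfolding L2_inner_def by (subst integral_restrict_space) auto
  finally have "\<bar>\<phi> x\<bar> \<le> L2_norm (deriv \<phi>) * L2_norm ?J"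
    using L2_Cauchy_Schwarz[OF test_function_deriv_L2[OF assms] J] by simp
  also have "\<dots> \<le> L2_norm (deriv \<phi>) * 1"
    by (intro mult_left_mono L2_norm_le_bound J) (auto simp: indicator_def)
  finally show ?thesis by simp
qed (simp add: test_function_eq_0[OF assms])

text \<open>Applied to differences of the approximating test functions, the sup bound makes them
  uniformly Cauchy. Their uniform limit is continuous, inherits the boundary values and the bound,
  and agrees with \<open>w\<close> almost everywhere because uniform convergence on the unit
  interval implies L2 convergence.\<close>

lemma h10_continuous_representative:
  assumes "h10 w g"
  obtains W where "continuous_on UNIV W" "W 0 = 0" "W 1 = 0" "\<And>x. \<bar>W x\<bar> \<le> L2_norm g"
    "AE x in lebesgue_on \<Omega>. w x = W x"
proof -
  obtain \<phi> where \<phi>: "\<And>n::nat. test_function \<Omega> (\<phi> n)"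
    and lim: "(\<lambda>n. L2_norm (\<phi> n - w)) \<longlonglongrightarrow> 0" "(\<lambda>n. L2_norm (deriv (\<phi> n) - g)) \<longlonglongrightarrow> 0"
    using h10E[OF assms] by blast
  note L = h10_L2[OF assms]
  have diff: "\<bar>\<phi> m x - \<phi> n x\<bar> \<le> L2_norm (deriv (\<phi> m) - g) + L2_norm (deriv (\<phi> n) - g)" for m n x
  proof -
    have t: "test_function \<Omega> (\<lambda>x. \<phi> m x + (-1) * \<phi> n x)"
      by (intro test_function_add test_function_cmult \<phi>)
    have "deriv (\<lambda>x. \<phi> m x + (-1) * \<phi> n x) = deriv (\<phi> m) - deriv (\<phi> n)"
      by (intro ext DERIV_imp_deriv)
        (auto intro!: derivative_eq_intros smooth_DERIV test_function_smooth \<phi>)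
    with test_function_sup_bound[OF t, of x]
    have "\<bar>\<phi> m x - \<phi> n x\<bar> \<le> L2_norm (deriv (\<phi> m) - deriv (\<phi> n))" by simp
    also have "\<dots> \<le> L2_norm (deriv (\<phi> m) - g) + L2_norm (g - deriv (\<phi> n))"
      by (intro L2_norm_diff_triangle test_function_deriv_L2 \<phi> L)
    finally show ?thesis by (simp add: L2_norm_minus_commute)
  qed
  have "uniformly_Cauchy_on UNIV \<phi>"
    unfolding uniformly_Cauchy_on_def
  proof (intro allI impI)
    fix e :: real assume "e > 0"
    then have "\<forall>\<^sub>F n in sequentially. L2_norm (deriv (\<phi> n) - g) < e / 2"
      using order_tendstoD(2)[OF lim(2), of "e / 2"] by simp
    then obtain N where N: "\<And>n. n \<ge> N \<Longrightarrow> L2_norm (deriv (\<phi> n) - g) < e / 2"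
      by (auto simp: eventually_sequentially)
    show "\<exists>M. \<forall>x\<in>UNIV. \<forall>m\<ge>M. \<forall>n\<ge>M. dist (\<phi> m x) (\<phi> n x) < e"
    proof (intro exI[of _ N] ballI allI impI)
      fix x m n assume "m \<ge> N" "n \<ge> N"
      then show "dist (\<phi> m x) (\<phi> n x) < e"
        using diff[of m x n] N[of m] N[of n] by (simp add: dist_real_def)
    qed
  qed
  then obtain W where W: "uniform_limit UNIV \<phi> W sequentially"
    using Cauchy_uniformly_convergent unfolding uniformly_convergent_on_def by blast
  have cont: "continuous_on UNIV W"
    using W by (rule uniform_limit_theorem[rotated])
      (auto intro!: always_eventually smooth_continuous test_function_smooth \<phi>)
  have pt: "(\<lambda>n. \<phi> n x) \<longlonglongrightarrow> W x" for x
    using tendsto_uniform_limitI[OF W] by simp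
  have W0: "W x = 0" if "x \<notin> \<Omega>" for x
    using pt[of x] test_function_eq_0[OF \<phi> that] by (simp add: LIMSEQ_const_iff)
  have bound: "\<bar>W x\<bar> \<le> L2_norm g" for x
  proof (rule LIMSEQ_le[OF tendsto_rabs[OF pt]])
    show "(\<lambda>n. L2_norm (deriv (\<phi> n))) \<longlonglongrightarrow> L2_norm g"
      by (intro L2_norm_tendsto lim L test_function_deriv_L2 \<phi>)
  qed (use test_function_sup_bound[OF \<phi>] in blast)
  have WL: "W \<in> L2" using cont by (intro L2_continuous) (auto intro: continuous_on_subset)
  have "L2_norm (W - w) \<le> L2_norm (\<phi> n - W) + L2_norm (\<phi> n - w)" for n
    using L2_norm_diff_triangle[OF WL test_function_L2[OF \<phi>] L(1), of n]
    by (simp add: L2_norm_minus_commute[of W])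
  moreover have "(\<lambda>n. L2_norm (\<phi> n - W)) \<longlonglongrightarrow> 0"
  proof (rule LIMSEQ_I)
    fix e :: real assume e: "e > 0"
    then have "\<forall>\<^sub>F n in sequentially. \<forall>x\<in>UNIV. dist (\<phi> n x) (W x) < e / 2"
      using W unfolding uniform_limit_iff by (meson half_gt_zero)
    then obtain N where N: "\<And>n x. n \<ge> N \<Longrightarrow> \<bar>\<phi> n x - W x\<bar> \<le> e / 2"
      by (auto simp: eventually_sequentially dist_real_def intro: less_imp_le)
    have "L2_norm (\<phi> n - W) \<le> e / 2" if "n \<ge> N" for n
      using e N[OF that] by (intro L2_norm_le_bound L2_diff test_function_L2 \<phi> WL) auto
    then show "\<exists>no. \<forall>n\<ge>no. norm (L2_norm (\<phi> n - W) - 0) < e"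
      using e by (intro exI[of _ N]) fastforce
  qed
  then have "(\<lambda>n. L2_norm (\<phi> n - W) + L2_norm (\<phi> n - w)) \<longlonglongrightarrow> 0"
    using tendsto_add[OF _ lim(1)] by fastforce
  ultimately have "L2_norm (W - w) \<le> 0"
    by (meson LIMSEQ_le_const)
  then have "L2_norm (W - w) = 0" by (simp add: order_antisym)
  from L2_norm_eq_0_AE[OF L2_diff[OF WL L(1)] this]
  have "AE x in lebesgue_on \<Omega>. w x = W x" by eventually_elim simp
  then show thesis
    using that cont bound W0 by simp
qed

lemma h10_sup_bound:
  assumes "h10 w g"
  shows "AE x in lebesgue_on \<Omega>. \<bar>w x\<bar> \<le> L2_norm g"
proof -
  obtain W where W: "\<And>x. \<bar>W x\<bar> \<le> L2_norm g" "AE x in lebesgue_on \<Omega>. w x = W x"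
    using h10_continuous_representative[OF assms] by blast
  from W(2) show ?thesis by eventually_elim (simp add: W(1))
qed

text \<open>A Poincare inequality; the sup bound gives constant 1 because the interval has length
  1.\<close>

lemma h10_L2_norm_le: "h10 w g \<Longrightarrow> L2_norm w \<le> L2_norm g"
  using L2_norm_le_bound h10_sup_bound h10_L2 L2_norm_nonneg by blast

text \<open>Inside the interval the set of disagreement is open and null, hence empty; the endpoints
  follow by continuity.\<close>

lemma continuous_AE_eq:
  fixes U W :: "real \<Rightarrow> real"
  assumes "continuous_on {\<alpha>..\<beta>} U" "continuous_on {\<alpha>..\<beta>} W"
    "AE x in lebesgue_on {\<alpha><..<\<beta>}. U x = W x" "\<alpha> < \<beta>" "x \<in> {\<alpha>..\<beta>}"
  shows "U x = W x"
proof -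
  let ?D = "\<lambda>x. U x - W x"
  have cont: "continuous_on {\<alpha>..\<beta>} ?D" using assms by (intro continuous_intros)
  define N where "N = {x \<in> {\<alpha><..<\<beta>}. ?D x \<in> - {0}}"
  have "open N"
  proof -
    have "continuous_on {\<alpha><..<\<beta>} ?D" using cont by (rule continuous_on_subset) auto
    then have "open ({\<alpha><..<\<beta>} \<inter> ?D -` (- {0}))" by (intro continuous_open_preimage) auto
    also have "{\<alpha><..<\<beta>} \<inter> ?D -` (- {0}) = N" by (auto simp: N_def)
    finally show ?thesis .
  qed
  moreover have "negligible N"
  proof -
    have "AE x in lebesgue. x \<in> {\<alpha><..<\<beta>} \<longrightarrow> U x = W x"
      using assms(3) by (simp add: AE_restrict_space_iff)
    then have "AE x in lebesgue. x \<notin> N" by eventually_elim (auto simp: N_def)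
    then have "N \<in> null_sets lebesgue"
      using \<open>open N\<close> by (subst (asm) AE_iff_null_sets[symmetric]) auto
    then show ?thesis by (simp add: negligible_iff_null_sets)
  qed
  ultimately have "N = {}" using open_not_negligible by blast
  then have eq: "\<And>x. x \<in> {\<alpha><..<\<beta>} \<Longrightarrow> ?D x = 0" by (auto simp: N_def)
  have "?D x = 0"
    by (rule continuous_constant_on_closure[of "{\<alpha><..<\<beta>}" ?D]) (use cont eq assms in auto)
  then show ?thesis by simp
qed

subsection \<open>The reaction term\<close>

locale reaction =
  fixes f :: "real \<Rightarrow> real"
  assumes cont: "continuous_on UNIV f"
    and odd: "\<And>u. f (- u) = - f u"
    and deriv0: "(f has_real_derivative 1) (at 0)"
    and strict_concave: "strictly_concave_on {0<..} f"
begin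

lemma f_0 [simp]: "f 0 = 0"
  using odd[of 0] by simp

text \<open>Strict concavity speaks about positive points only. Shifting both points by
  \<open>e\<close> and letting \<open>e\<close> tend to 0 from the right includes the
  origin.\<close>

lemma concave:
  assumes "0 \<le> x" "0 \<le> y" "0 \<le> t" "t \<le> 1"
  shows "(1 - t) * f x + t * f y \<le> f ((1 - t) * x + t * y)"
proof -
  have pos: "(1 - t) * f x + t * f y \<le> f ((1 - t) * x + t * y)" if "0 < x" "0 < y" for x y
  proof (cases "x = y \<or> t = 0 \<or> t = 1")
    case True
    then show ?thesis by (auto simp: algebra_simps)
  next
    case False
    then have "x \<in> {0<..}" "y \<in> {0<..}" "t \<in> {0<..<1}" "x \<noteq> y" using that assms(3,4) by auto
    then have "- f ((1 - t) * x + t * y) < (1 - t) * - f x + t * - f y"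
      using strict_concave unfolding strictly_concave_on_def strictly_convex_on_def by blast
    then show ?thesis by simp
  qed
  have "((\<lambda>e. f (b + e)) \<longlongrightarrow> f (b + 0)) (at_right 0)" for b
    by (rule isCont_tendsto_compose[OF _ tendsto_add[OF tendsto_const tendsto_ident_at]])
      (use cont in \<open>simp add: continuous_on_eq_continuous_at\<close>)
  then have lim: "((\<lambda>e. f (b + e)) \<longlongrightarrow> f b) (at_right 0)" for b by simp
  show ?thesis
  proof (rule tendsto_le[OF _ lim])
    show "((\<lambda>e. (1 - t) * f (x + e) + t * f (y + e)) \<longlongrightarrow> (1 - t) * f x + t * f y) (at_right 0)"
      by (intro tendsto_intros lim)
    have "(1 - t) * f (x + e) + t * f (y + e) \<le> f ((1 - t) * x + t * y + e)" if "e > 0" for e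
      using pos[of "x + e" "y + e"] that assms(1,2) by (simp add: algebra_simps)
    then show "\<forall>\<^sub>F e in at_right 0. (1 - t) * f (x + e) + t * f (y + e) \<le> f ((1 - t) * x + t * y + e)"
      by (auto simp: eventually_at_filter)
  qed simp
qed

lemma concave_0:
  assumes "0 \<le> y" "0 \<le> t" "t \<le> 1"
  shows "t * f y \<le> f (t * y)"
  using concave[of 0 y t] assms by simp

text \<open>By concavity through the origin \<open>f (t * y) / t\<close> is at least
  \<open>f y\<close> for t in (0, 1), and as t tends to 0 it converges to f'(0) y = y.\<close>

lemma f_le_id:
  assumes "0 \<le> y"
  shows "f y \<le> y"
proof -
  have "((\<lambda>t. f (t * y)) has_real_derivative 1 * y) (at 0)"
    by (rule DERIV_chain2) (use deriv0 in \<open>auto intro!: derivative_eq_intros\<close>)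
  then have "((\<lambda>t. f (t * y) / t) \<longlongrightarrow> y) (at 0)"
    by (simp add: DERIV_def)
  then have lim: "((\<lambda>t. f (t * y) / t) \<longlongrightarrow> y) (at_right 0)"
    by (rule filterlim_mono) (auto simp: at_within_le_at)
  show ?thesis
  proof (rule tendsto_lowerbound[OF lim])
    have "f y \<le> f (t * y) / t" if "0 < t" "t < 1" for t
      using concave_0[of y t] that assms by (simp add: le_divide_eq mult.commute)
    then show "\<forall>\<^sub>F t in at_right 0. f y \<le> f (t * y) / t"
      using eventually_at_right_real[of 0 1] by (auto elim!: eventually_mono)
  qed simp
qed

text \<open>Stands in for the bound f' \<le> 1. For 0 < x < y the quotient f(x) / x does not
  increase, so the slope over [x, y] is at most f(x) / x \<le> 1. Oddness covers the negative side,
  and intervals containing 0 are split there.\<close>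

lemma increment_le:
  assumes "x \<le> y"
  shows "f y - f x \<le> y - x"
proof -
  have pos: "f y - f x \<le> y - x" if xy: "0 \<le> x" "x \<le> y" for x y
  proof (cases "0 < x \<and> x < y")
    case False
    then consider "x = 0" | "x = y" using xy by linarith
    then show ?thesis using f_le_id[of y] xy by cases auto
  next
    case True
    have "x / y * f y \<le> f (x / y * y)"
      using True by (intro concave_0) auto
    then have "x * f y \<le> y * f x" using True by (simp add: field_simps)
    then have "x * (f y - f x) \<le> (y - x) * f x" by (simp add: algebra_simps)
    also have "\<dots> \<le> (y - x) * x"
      using True f_le_id[of x] by (intro mult_left_mono) auto
    finally have "x * (f y - f x) \<le> x * (y - x)" by (simp add: mult.commute)
    then show ?thesis using True by simp
  qed
  consider "0 \<le> x" | "x < 0" "0 \<le> y" | "y < 0" using assms by linarith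
  then show ?thesis
  proof cases
    case 1
    then show ?thesis using pos assms by blast
  next
    case 2
    then show ?thesis using f_le_id[of y] f_le_id[of "- x"] odd[of x] by simp
  next
    case 3
    then show ?thesis using pos[of "- y" "- x"] odd[of x] odd[of y] assms by simp
  qed
qed

lemma one_sided_Lipschitz: "(f v - f u) * (v - u) \<le> (v - u)\<^sup>2"
proof (cases "u \<le> v")
  case True
  then have "(f v - f u) * (v - u) \<le> (v - u) * (v - u)"
    using increment_le by (intro mult_right_mono) auto
  then show ?thesis by (simp add: power2_eq_square)
next
  case False
  then have "(f u - f v) * (u - v) \<le> (u - v) * (u - v)"
    using increment_le by (intro mult_right_mono) auto
  then show ?thesis by (simp add: power2_eq_square algebra_simps)
qed

text \<open>Strictness is not given for the pair 0, z itself. It is used at z/4 and 3z/4, which have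
  the same midpoint as 0 and z, and weak concavity gives f(z/4) + f(3z/4) \<ge> f(z).\<close>

lemma strict_half:
  assumes "0 < z"
  shows "f z < 2 * f (z / 2)"
proof -
  have "z / 4 \<in> {0<..}" "3 * z / 4 \<in> {0<..}" "1/2 \<in> {0<..<1::real}" "z / 4 \<noteq> 3 * z / 4"
    using assms by auto
  then have "- f ((1 - 1/2) * (z / 4) + 1/2 * (3 * z / 4)) < (1 - 1/2) * - f (z / 4) + 1/2 * - f (3 * z / 4)"
    using strict_concave unfolding strictly_concave_on_def strictly_convex_on_def by blast
  then have "(f (z / 4) + f (3 * z / 4)) / 2 < f (z / 2)" by (simp add: field_simps)
  moreover have "1/4 * f z \<le> f (1/4 * z)" "3/4 * f z \<le> f (3/4 * z)"
    using assms concave_0[of z "1/4"] concave_0[of z "3/4"] by simp_all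
  ultimately show ?thesis by simp
qed

text \<open>A substitute for f'(z) as an upper bound of secant slopes at z. For z \<ge>
  \<open>\<zeta>\<close> it is the slope of the chord over [z/2, z], which dominates secants from z
  to any v \<ge> z/2. For smaller z a nearby v may lie below z/2, and only the global bound 1
  remains.\<close>

definition slope_bound :: "real \<Rightarrow> real \<Rightarrow> real" where
  "slope_bound \<zeta> z = (if z < \<zeta> then 1 else 2 * (f z - f (z / 2)) / z)"

lemma slope_bound_le_1: "0 < \<zeta> \<Longrightarrow> slope_bound \<zeta> z \<le> 1"
  using increment_le[of "z / 2" z] by (auto simp: slope_bound_def divide_le_eq)

text \<open>If z \<ge> \<open>\<zeta>\<close>, the distance bound \<open>\<zeta> / 2\<close> forces
  v \<ge> z/2, and slopes of chords of a concave function decrease from left to right.\<close>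

lemma secant_le_slope_bound:
  assumes "0 < \<zeta>" "0 \<le> z" "\<bar>v - z\<bar> \<le> \<zeta> / 2"
  shows "(f v - f z) * (v - z) \<le> slope_bound \<zeta> z * (v - z)\<^sup>2"
proof (cases "z < \<zeta>")
  case True
  then show ?thesis using one_sided_Lipschitz by (simp add: slope_bound_def)
next
  case False
  define s where "s = 2 * (f z - f (z / 2)) / z"
  have z: "0 < z" "z / 2 \<le> v" using False assms by (auto simp: abs_real_def split: if_splits)
  have s: "f (z / 2) = f z - s * (z / 2)" using z by (simp add: s_def field_simps)
  have "(f v - f z) * (v - z) \<le> s * (v - z)\<^sup>2"
  proof (cases "v \<le> z")
    case True
    \<comment> \<open>The weight that writes \<open>v\<close> as a convex combination of
      \<open>z / 2\<close> and \<open>z\<close>.\<close>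
    define t where "t = (v - z / 2) / (z / 2)"
    have t: "0 \<le> t" "t \<le> 1" "v = z / 2 + t * (z / 2)"
      using z True by (auto simp: t_def field_simps)
    have "(1 - t) * f (z / 2) + t * f z \<le> f ((1 - t) * (z / 2) + t * z)"
      using z t by (intro concave) auto
    also have "(1 - t) * (z / 2) + t * z = v" using t(3) by (simp add: field_simps)
    finally have "f z - s * (z - v) \<le> f v"
      unfolding s t(3) by (simp add: field_simps)
    then have "(z - v) * (f z - f v) \<le> (z - v) * (s * (z - v))"
      using True by (intro mult_left_mono) auto
    then show ?thesis by (simp add: power2_eq_square algebra_simps)
  next
    case False
    \<comment> \<open>Now \<open>z\<close> is the point in the middle, and \<open>t\<close> is the
      weight of \<open>v\<close>.\<close>
    define t where "t = (z / 2) / (v - z / 2)"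
    have t: "0 < t" "t \<le> 1" using z False by (auto simp: t_def field_simps)
    have d: "v - z / 2 > 0" using z False by simp
    have tv: "t * (v - z / 2) = z / 2" using d unfolding t_def by (intro nonzero_eq_divide_eq[THEN iffD1]) auto
    have "(1 - t) * f (z / 2) + t * f v \<le> f ((1 - t) * (z / 2) + t * v)"
      using z t by (intro concave) auto
    also have "(1 - t) * (z / 2) + t * v = z"
      using tv by (simp add: field_simps)
    finally have "t * (f v - f z) \<le> (1 - t) * (f z - f (z / 2))"
      by (simp add: algebra_simps)
    also have "\<dots> = (1 - t) * (z / 2) * s" unfolding s by simp
    also have "(1 - t) * (z / 2) = t * (v - z)" using tv by (simp add: field_simps)
    finally have "f v - f z \<le> (v - z) * s" using t by simp
    then have "(f v - f z) * (v - z) \<le> ((v - z) * s) * (v - z)"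
      using False by (intro mult_right_mono) auto
    then show ?thesis by (simp add: power2_eq_square algebra_simps)
  qed
  then show ?thesis using False by (simp add: slope_bound_def s_def)
qed

end

text \<open>Subtracting the tangent parabola from \<open>F\<close> leaves a function whose
  derivative has the opposite sign to \<open>c - z\<close>, so it is maximal at \<open>z\<close>,
  where it is 0.\<close>

lemma antiderivative_quadratic_bound:
  fixes F f :: "real \<Rightarrow> real"
  assumes F: "\<And>x. (F has_real_derivative f x) (at x)"
    and slope: "\<And>c. \<bar>c - z\<bar> \<le> \<bar>v - z\<bar> \<Longrightarrow> (f c - f z) * (c - z) \<le> s * (c - z)\<^sup>2"
  shows "F v - F z - f z * (v - z) \<le> s / 2 * (v - z)\<^sup>2"
proof -
  define G where "G = (\<lambda>c. F c - F z - f z * (c - z) - s / 2 * (c - z)\<^sup>2)"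
  have G: "(G has_real_derivative f c - f z - s * (c - z)) (at c)" for c
    unfolding G_def using F[of c] by (auto intro!: derivative_eq_intros)
  have "G v \<le> G z"
  proof (cases "z \<le> v")
    case True
    show ?thesis
    proof (rule DERIV_nonpos_imp_nonincreasing[OF True])
      fix c assume c: "z \<le> c" "c \<le> v"
      have "(f c - f z - s * (c - z)) * (c - z) \<le> 0"
        using slope[of c] c by (simp add: power2_eq_square algebra_simps)
      then have "f c - f z - s * (c - z) \<le> 0"
        using c by (cases "c = z") (auto simp: mult_le_0_iff)
      then show "\<exists>y. (G has_real_derivative y) (at c) \<and> y \<le> 0" using G by blast
    qed
  next
    case False
    show ?thesis
    proof (rule DERIV_nonneg_imp_nondecreasing[where f = G and a = v and b = z])
      show "v \<le> z" using False by simp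
      fix c assume c: "v \<le> c" "c \<le> z"
      have "(f c - f z - s * (c - z)) * (c - z) \<le> 0"
        using slope[of c] c by (simp add: power2_eq_square algebra_simps)
      then have "0 \<le> f c - f z - s * (c - z)"
        using c by (cases "c = z") (auto simp: mult_le_0_iff)
      then show "\<exists>y. (G has_real_derivative y) (at c) \<and> 0 \<le> y" using G by blast
    qed
  qed
  then show ?thesis by (simp add: G_def)
qed

subsection \<open>Regularity of weak derivatives and of stationary points\<close>

lemma antiderivative_Icc:
  fixes q :: "real \<Rightarrow> real"
  assumes "continuous_on {\<alpha>..\<beta>} q"
  obtains Q where "\<And>x. x \<in> {\<alpha>..\<beta>} \<Longrightarrow> (Q has_real_derivative q x) (at x within {\<alpha>..\<beta>})"
  using antiderivative_continuous[OF assms]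
  by (auto simp: has_real_derivative_iff_has_vector_derivative)

text \<open>Subtracting a classical antiderivative of \<open>q\<close> leaves a function with zero
  weak derivative, which is constant. The interval is arbitrary since the lemma serves both in
  space, for the regularity of stationary points, and in time, for the equation tested with a fixed
  function.\<close>

lemma continuous_weak_deriv:
  fixes y q :: "real \<Rightarrow> real"
  assumes y: "integrable (lebesgue_on {\<alpha><..<\<beta>}) y" and q: "continuous_on {\<alpha>..\<beta>} q" and "\<alpha> < \<beta>"
    and weak: "\<And>\<phi>. test_function {\<alpha><..<\<beta>} \<phi> \<Longrightarrow>
      (LINT x|lebesgue_on {\<alpha><..<\<beta>}. y x * deriv \<phi> x) = - (LINT x|lebesgue_on {\<alpha><..<\<beta>}. q x * \<phi> x)"
  obtains U where "\<And>x. x \<in> {\<alpha>..\<beta>} \<Longrightarrow> (U has_real_derivative q x) (at x within {\<alpha>..\<beta>})"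
    "AE x in lebesgue_on {\<alpha><..<\<beta>}. y x = U x"
proof -
  obtain Q where Q: "\<And>x. x \<in> {\<alpha>..\<beta>} \<Longrightarrow> (Q has_real_derivative q x) (at x within {\<alpha>..\<beta>})"
    using antiderivative_Icc[OF q] by blast
  then have Qc: "continuous_on {\<alpha>..\<beta>} Q"
    by (meson DERIV_continuous continuous_on_eq_continuous_within)
  have "\<exists>C. AE x in lebesgue_on {\<alpha><..<\<beta>}. y x - Q x = C"
  proof (rule du_Bois_Reymond[OF _ \<open>\<alpha> < \<beta>\<close>])
    show "integrable (lebesgue_on {\<alpha><..<\<beta>}) (\<lambda>x. y x - Q x)"
      by (intro Bochner_Integration.integrable_diff y integrable_continuous_interval Qc)
    fix \<phi> assume \<phi>: "test_function {\<alpha><..<\<beta>} \<phi>"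
    note s = test_function_smooth[OF \<phi>]
    have \<phi>0: "\<phi> \<alpha> = 0" "\<phi> \<beta> = 0" using \<phi> unfolding test_function_iff by auto
    have i: "integrable (lebesgue_on {\<alpha><..<\<beta>}) (\<lambda>x. y x * deriv \<phi> x)"
      "integrable (lebesgue_on {\<alpha><..<\<beta>}) (\<lambda>x. Q x * deriv \<phi> x)"
      "integrable (lebesgue_on {\<alpha><..<\<beta>}) (\<lambda>x. q x * \<phi> x)"
      by (intro integrable_mult_continuous y integrable_continuous_interval Qc q
          smooth_continuous smooth_deriv s)+
    have "(LINT x|lebesgue_on {\<alpha><..<\<beta>}. Q x * deriv \<phi> x + q x * \<phi> x) = Q \<beta> * \<phi> \<beta> - Q \<alpha> * \<phi> \<alpha>"
    proof (rule integral_deriv_interval)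
      show "((\<lambda>x. Q x * \<phi> x) has_real_derivative Q x * deriv \<phi> x + q x * \<phi> x) (at x within {\<alpha>..\<beta>})"
        if "x \<in> {\<alpha>..\<beta>}" for x
        using DERIV_mult[OF Q[OF that] has_field_derivative_at_within[OF smooth_DERIV[OF s]]]
        by (simp add: algebra_simps)
      show "continuous_on {\<alpha>..\<beta>} (\<lambda>x. Q x * deriv \<phi> x + q x * \<phi> x)"
        by (intro continuous_on_add continuous_on_mult Qc q smooth_continuous smooth_deriv s)
    qed (use \<open>\<alpha> < \<beta>\<close> in simp)
    then show "(LINT x|lebesgue_on {\<alpha><..<\<beta>}. (y x - Q x) * deriv \<phi> x) = 0"
      using weak[OF \<phi>] i \<phi>0 by (simp add: left_diff_distrib)
  qed
  then obtain C where "AE x in lebesgue_on {\<alpha><..<\<beta>}. y x - Q x = C" by blast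
  then have "AE x in lebesgue_on {\<alpha><..<\<beta>}. y x = Q x + C" by eventually_elim simp
  moreover have "((\<lambda>x. Q x + C) has_real_derivative q x) (at x within {\<alpha>..\<beta>})" if "x \<in> {\<alpha>..\<beta>}" for x
    using Q[OF that] by (auto intro!: derivative_eq_intros)
  ultimately show thesis using that by blast
qed

lemma has_weak_deriv_cong_AE:
  assumes "has_weak_deriv u g" "g \<in> L2" "h \<in> L2" "AE x in lebesgue_on \<Omega>. g x = h x"
  shows "has_weak_deriv u h"
  unfolding has_weak_deriv_def
proof (intro allI impI)
  fix \<phi> assume "test_function \<Omega> \<phi>"
  then show "L2_inner u (deriv \<phi>) = - L2_inner h \<phi>"
    using assms L2_inner_cong_AE[of g h \<phi> \<phi>] test_function_L2 by (auto simp: has_weak_deriv_def)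
qed

lemma continuous_has_weak_deriv:
  assumes "u \<in> L2" "continuous_on {0..1} q" "has_weak_deriv u q"
  obtains U where "\<And>x. x \<in> {0..1} \<Longrightarrow> (U has_real_derivative q x) (at x within {0..1})"
    "AE x in lebesgue_on \<Omega>. u x = U x"
  using continuous_weak_deriv[OF L2_integrable[OF assms(1)] assms(2)] assms(3)
  unfolding has_weak_deriv_def L2_inner_def by auto

text \<open>The equation makes the second weak derivative continuous; integrating twice gives a
  classical solution. Continuity of \<open>z\<close> selects the representative for which the
  pointwise claims and the boundary values make sense.\<close>

lemma stationary_point_regular:
  assumes "stationary_point a f lam z" "continuous_on {0..1} z" "continuous_on UNIV f"
    and A: "A = a ((H10_norm z)\<^sup>2)" "A > 0"
  obtains z' where "\<And>x. x \<in> {0..1} \<Longrightarrow> (z has_real_derivative z' x) (at x within {0..1})"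
    "\<And>x. x \<in> {0..1} \<Longrightarrow> (z' has_real_derivative - (lam / A) * f (z x)) (at x within {0..1})"
    "z 0 = 0" "z 1 = 0"
proof -
  have z: "z \<in> H10" "wderiv z \<in> H1"
    "AE x in lebesgue_on \<Omega>. - A * wderiv (wderiv z) x = lam * f (z x)"
    using assms(1) A(1) by (auto simp: stationary_point_def H2_def)
  note h = H10_h10[OF z(1)]
  define q where "q = (\<lambda>x. - (lam / A) * f (z x))"
  have q: "continuous_on {0..1} q"
    unfolding q_def
    by (intro continuous_intros continuous_on_compose2[OF assms(3) assms(2)]) auto
  have "AE x in lebesgue_on \<Omega>. wderiv (wderiv z) x = q x"
    using z(3) by eventually_elim (use A(2) in \<open>simp add: q_def field_simps\<close>)
  then have "has_weak_deriv (wderiv z) q"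
    using wderiv_H1[OF z(2)] L2_continuous[OF q] by (auto intro: has_weak_deriv_cong_AE)
  then obtain z' where z': "\<And>x. x \<in> {0..1} \<Longrightarrow> (z' has_real_derivative q x) (at x within {0..1})"
      "AE x in lebesgue_on \<Omega>. wderiv z x = z' x"
    using continuous_has_weak_deriv[OF h10_L2(2)[OF h] q] by blast
  have z'c: "continuous_on {0..1} z'"
    using z'(1) by (meson DERIV_continuous continuous_on_eq_continuous_within)
  have "has_weak_deriv z z'"
    using h10_weak_deriv[OF h] h10_L2(2)[OF h] L2_continuous[OF z'c] z'(2)
    by (rule has_weak_deriv_cong_AE)
  then obtain U where U: "\<And>x. x \<in> {0..1} \<Longrightarrow> (U has_real_derivative z' x) (at x within {0..1})"
      "AE x in lebesgue_on \<Omega>. z x = U x"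
    using continuous_has_weak_deriv[OF h10_L2(1)[OF h] z'c] by blast
  have Uc: "continuous_on {0..1} U"
    using U(1) by (meson DERIV_continuous continuous_on_eq_continuous_within)
  have eq: "z x = U x" if "x \<in> {0..1}" for x
    using continuous_AE_eq[OF assms(2) Uc U(2) _ that] by simp
  obtain W where W: "continuous_on UNIV W" "W 0 = 0" "W 1 = 0" "AE x in lebesgue_on \<Omega>. z x = W x"
    using h10_continuous_representative[OF h] by metis
  have eqW: "z x = W x" if "x \<in> {0..1}" for x
    using continuous_AE_eq[OF assms(2) _ W(4) _ that] continuous_on_subset[OF W(1)] by simp
  show thesis
  proof (rule that)
    show "(z has_real_derivative z' x) (at x within {0..1})" if "x \<in> {0..1}" for x
      by (rule has_field_derivative_transform_within[OF U(1)[OF that], of 1]) (use that eq in auto)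
    show "(z' has_real_derivative - (lam / A) * f (z x)) (at x within {0..1})" if "x \<in> {0..1}" for x
      using z'(1)[OF that] by (simp add: q_def)
  qed (use eqW[of 0] eqW[of 1] W in auto)
qed

subsection \<open>Coercivity of the linearised energy\<close>

lemma L2_mult_bounded:
  assumes "k \<in> borel_measurable (lebesgue_on \<Omega>)" "\<And>x. x \<in> \<Omega> \<Longrightarrow> \<bar>k x\<bar> \<le> B" "u \<in> L2"
  shows "(\<lambda>x. k x * u x) \<in> L2" "L2_norm (\<lambda>x. k x * u x) \<le> B * L2_norm u"
proof -
  have B: "B \<ge> 0" using assms(2)[of "1/2"] by auto
  have k2: "(k x)\<^sup>2 \<le> B\<^sup>2" if "x \<in> \<Omega>" for x
    using assms(2)[OF that] B by (simp add: abs_le_square_iff[symmetric])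
  have u2: "integrable (lebesgue_on \<Omega>) (\<lambda>x. (u x)\<^sup>2)" using assms(3) by (simp add: L2_def)
  have i: "integrable (lebesgue_on \<Omega>) (\<lambda>x. (u x)\<^sup>2 * (k x)\<^sup>2)"
    by (rule integrable_lebesgue_on_mult_bounded[where B = "B\<^sup>2"]) (use assms u2 k2 in auto)
  then show "(\<lambda>x. k x * u x) \<in> L2"
    using assms L2_measurable[OF assms(3)] by (auto simp: L2_def power_mult_distrib mult.commute)
  have "(LINT x|lebesgue_on \<Omega>. (k x * u x)\<^sup>2) \<le> (LINT x|lebesgue_on \<Omega>. B\<^sup>2 * (u x)\<^sup>2)"
    using i u2 k2
    by (intro integral_mono)
      (auto simp: power_mult_distrib mult.commute[of "(k _)\<^sup>2"] mult.commute[of "B\<^sup>2"] intro!: mult_left_mono)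
  then have sq: "(L2_norm (\<lambda>x. k x * u x))\<^sup>2 \<le> (B * L2_norm u)\<^sup>2"
    unfolding power_mult_distrib[of B] L2_norm_sq L2_inner_def by (simp add: power2_eq_square)
  show "L2_norm (\<lambda>x. k x * u x) \<le> B * L2_norm u"
    by (rule power2_le_imp_le[OF sq]) (simp add: B)
qed

text \<open>Picone's identity: integrate \<open>(\<phi>' - \<phi> \<psi>' / \<psi>)\<^sup>2 \<ge> 0\<close>.\<close>

lemma supersolution_test_function:
  assumes \<phi>: "test_function \<Omega> \<phi>" and "A > 0"
    and \<psi>: "\<And>x. x \<in> {0..1} \<Longrightarrow> (\<psi> has_real_derivative \<psi>1 x) (at x within {0..1})"
      "\<And>x. x \<in> {0..1} \<Longrightarrow> (\<psi>1 has_real_derivative \<psi>2 x) (at x within {0..1})"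
      "continuous_on {0..1} \<psi>2" "\<And>x. x \<in> {0..1} \<Longrightarrow> 0 < \<psi> x"
    and k: "k \<in> borel_measurable (lebesgue_on \<Omega>)" "\<And>x. x \<in> \<Omega> \<Longrightarrow> \<bar>k x\<bar> \<le> B"
    and super: "\<And>x. x \<in> \<Omega> \<Longrightarrow> k x * \<psi> x \<le> - A * \<psi>2 x"
  shows "L2_inner (\<lambda>x. k x * \<phi> x) \<phi> \<le> A * (L2_norm (deriv \<phi>))\<^sup>2"
proof -
  note s = test_function_smooth[OF \<phi>]
  have c: "continuous_on {0..1} \<psi>" "continuous_on {0..1} \<psi>1"
    using \<psi>(1,2) by (meson DERIV_continuous continuous_on_eq_continuous_within)+
  have ne: "\<psi> x \<noteq> 0" if "x \<in> {0..1}" for x using \<psi>(4)[OF that] by simp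
  define \<rho> where "\<rho> = (\<lambda>x. \<psi>1 x / \<psi> x)"
  have \<rho>c: "continuous_on {0..1} \<rho>"
    unfolding \<rho>_def by (intro continuous_intros c) (use ne in auto)
  have qc: "continuous_on {0..1} (\<lambda>x. \<psi>2 x / \<psi> x)"
    by (intro continuous_intros c \<psi>(3)) (use ne in auto)
  have \<phi>c: "continuous_on {0..1} \<phi>" "continuous_on {0..1} (deriv \<phi>)"
    by (intro smooth_continuous smooth_deriv s)+
  \<comment> \<open>The integrand is the derivative of \<open>\<rho> x * (\<phi> x)\<^sup>2\<close>,
    which vanishes at both ends.\<close>
  have "(LINT x|lebesgue_on \<Omega>. (\<psi>2 x / \<psi> x - (\<rho> x)\<^sup>2) * (\<phi> x)\<^sup>2 + 2 * \<rho> x * \<phi> x * deriv \<phi> x)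
      = \<rho> 1 * (\<phi> 1)\<^sup>2 - \<rho> 0 * (\<phi> 0)\<^sup>2"
  proof (rule integral_deriv_interval)
    show "((\<lambda>x. \<rho> x * (\<phi> x)\<^sup>2) has_real_derivative
        (\<psi>2 x / \<psi> x - (\<rho> x)\<^sup>2) * (\<phi> x)\<^sup>2 + 2 * \<rho> x * \<phi> x * deriv \<phi> x) (at x within {0..1})"
      if x: "x \<in> {0..1}" for x
    proof -
      have "(\<rho> has_real_derivative \<psi>2 x / \<psi> x - (\<rho> x)\<^sup>2) (at x within {0..1})"
        unfolding \<rho>_def using \<psi>(1)[OF x] \<psi>(2)[OF x] ne[OF x]
        by (auto intro!: derivative_eq_intros simp: field_simps power2_eq_square)
      moreover have "((\<lambda>x. (\<phi> x)\<^sup>2) has_real_derivative 2 * \<phi> x * deriv \<phi> x) (at x within {0..1})"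
        using has_field_derivative_at_within[OF smooth_DERIV[OF s]]
        by (auto intro!: derivative_eq_intros)
      ultimately have "((\<lambda>x. \<rho> x * (\<phi> x)\<^sup>2) has_real_derivative
          (\<psi>2 x / \<psi> x - (\<rho> x)\<^sup>2) * (\<phi> x)\<^sup>2 + (2 * \<phi> x * deriv \<phi> x) * \<rho> x) (at x within {0..1})"
        by (rule DERIV_mult)
      then show ?thesis by (simp add: mult_ac)
    qed
    show "continuous_on {0..1} (\<lambda>x. (\<psi>2 x / \<psi> x - (\<rho> x)\<^sup>2) * (\<phi> x)\<^sup>2 + 2 * \<rho> x * \<phi> x * deriv \<phi> x)"
      by (intro continuous_on_add continuous_on_mult continuous_on_diff continuous_on_power
          continuous_on_const \<rho>c qc \<phi>c)
  qed simp
  also have "\<dots> = 0" using test_function_eq_0[OF \<phi>] by simp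
  finally have zero: "(LINT x|lebesgue_on \<Omega>.
      (\<psi>2 x / \<psi> x - (\<rho> x)\<^sup>2) * (\<phi> x)\<^sup>2 + 2 * \<rho> x * \<phi> x * deriv \<phi> x) = 0" .
  let ?R = "\<lambda>x. A * ((\<psi>2 x / \<psi> x - (\<rho> x)\<^sup>2) * (\<phi> x)\<^sup>2 + 2 * \<rho> x * \<phi> x * deriv \<phi> x)"
  have Ri: "integrable (lebesgue_on \<Omega>) ?R"
    by (intro integrable_continuous_interval continuous_on_add continuous_on_mult
        continuous_on_diff continuous_on_power continuous_on_const \<rho>c qc \<phi>c)
  have di: "integrable (lebesgue_on \<Omega>) (\<lambda>x. A * (deriv \<phi> x)\<^sup>2)"
    by (intro integrable_continuous_interval continuous_intros \<phi>c)
  have "L2_inner (\<lambda>x. k x * \<phi> x) \<phi> \<le> (LINT x|lebesgue_on \<Omega>. A * (deriv \<phi> x)\<^sup>2 - ?R x)"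
    unfolding L2_inner_def
  proof (rule integral_mono)
    show "integrable (lebesgue_on \<Omega>) (\<lambda>x. k x * \<phi> x * \<phi> x)"
      by (intro L2_mult_integrable L2_mult_bounded(1)[OF k] test_function_L2 \<phi>)
    show "integrable (lebesgue_on \<Omega>) (\<lambda>x. A * (deriv \<phi> x)\<^sup>2 - ?R x)"
      by (intro Bochner_Integration.integrable_diff di Ri)
    fix x assume "x \<in> space (lebesgue_on \<Omega>)"
    then have x: "x \<in> \<Omega>" "x \<in> {0..1}" by auto
    \<comment> \<open>The upper integrand equals A (\<phi>' - \<rho> \<phi>)^2 - A (\<psi>2 /
      \<psi>) \<phi>^2, so the supersolution inequality divided by \<psi> settles the pointwise
      comparison.\<close>
    have "k x \<le> - A * (\<psi>2 x / \<psi> x)"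
      using super[OF x(1)] \<psi>(4)[OF x(2)] by (simp add: field_simps)
    then have "k x * (\<phi> x)\<^sup>2 \<le> - A * (\<psi>2 x / \<psi> x) * (\<phi> x)\<^sup>2"
      by (intro mult_right_mono) auto
    moreover have "0 \<le> A * (deriv \<phi> x - \<rho> x * \<phi> x)\<^sup>2" using \<open>A > 0\<close> by simp
    ultimately show "k x * \<phi> x * \<phi> x \<le> A * (deriv \<phi> x)\<^sup>2 - ?R x"
      by (simp add: power2_eq_square algebra_simps)
  qed
  also have "\<dots> = A * (LINT x|lebesgue_on \<Omega>. (deriv \<phi> x)\<^sup>2) - integral\<^sup>L (lebesgue_on \<Omega>) ?R"
    using di Ri by (subst Bochner_Integration.integral_diff) auto
  also have "integral\<^sup>L (lebesgue_on \<Omega>) ?R = 0"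
    using zero by simp
  also have "(LINT x|lebesgue_on \<Omega>. (deriv \<phi> x)\<^sup>2) = (L2_norm (deriv \<phi>))\<^sup>2"
    unfolding L2_norm_sq L2_inner_def by (simp add: power2_eq_square)
  finally show ?thesis by simp
qed

text \<open>Multiplication by the bounded \<open>k\<close> is continuous on L2, so both sides pass
  to the limit along the approximating test functions.\<close>

lemma supersolution_h10:
  assumes wg: "h10 w g" and "A > 0"
    and \<psi>: "\<And>x. x \<in> {0..1} \<Longrightarrow> (\<psi> has_real_derivative \<psi>1 x) (at x within {0..1})"
      "\<And>x. x \<in> {0..1} \<Longrightarrow> (\<psi>1 has_real_derivative \<psi>2 x) (at x within {0..1})"
      "continuous_on {0..1} \<psi>2" "\<And>x. x \<in> {0..1} \<Longrightarrow> 0 < \<psi> x"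
    and k: "k \<in> borel_measurable (lebesgue_on \<Omega>)" "\<And>x. x \<in> \<Omega> \<Longrightarrow> \<bar>k x\<bar> \<le> B"
    and super: "\<And>x. x \<in> \<Omega> \<Longrightarrow> k x * \<psi> x \<le> - A * \<psi>2 x"
  shows "L2_inner (\<lambda>x. k x * w x) w \<le> A * (L2_norm g)\<^sup>2"
proof -
  obtain \<phi> where \<phi>: "\<And>n::nat. test_function \<Omega> (\<phi> n)"
    and lim: "(\<lambda>n. L2_norm (\<phi> n - w)) \<longlonglongrightarrow> 0" "(\<lambda>n. L2_norm (deriv (\<phi> n) - g)) \<longlonglongrightarrow> 0"
    using h10E[OF wg] by blast
  note L = h10_L2[OF wg]
  have "(\<lambda>n. B * L2_norm (\<phi> n - w)) \<longlonglongrightarrow> 0"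
    using tendsto_mult_left[OF lim(1), of B] by simp
  then have lim': "(\<lambda>n. L2_norm ((\<lambda>x. k x * \<phi> n x) - (\<lambda>x. k x * w x))) \<longlonglongrightarrow> 0"
  proof (rule Lim_null_comparison[rotated], intro always_eventually allI)
    fix n
    have "(\<lambda>x. k x * \<phi> n x) - (\<lambda>x. k x * w x) = (\<lambda>x. k x * (\<phi> n - w) x)"
      by (auto simp: algebra_simps)
    then show "norm (L2_norm ((\<lambda>x. k x * \<phi> n x) - (\<lambda>x. k x * w x))) \<le> B * L2_norm (\<phi> n - w)"
      using L2_mult_bounded(2)[OF k L2_diff[OF test_function_L2[OF \<phi>] L(1)]] by simp
  qed
  show ?thesis
  proof (rule LIMSEQ_le)
    show "(\<lambda>n. L2_inner (\<lambda>x. k x * \<phi> n x) (\<phi> n)) \<longlonglongrightarrow> L2_inner (\<lambda>x. k x * w x) w"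
      by (intro L2_inner_tendsto lim lim' L2_mult_bounded(1)[OF k] test_function_L2 \<phi> L)
    show "(\<lambda>n. A * (L2_norm (deriv (\<phi> n)))\<^sup>2) \<longlonglongrightarrow> A * (L2_norm g)\<^sup>2"
      by (intro tendsto_intros L2_norm_tendsto lim L test_function_deriv_L2 \<phi>)
    show "\<exists>N. \<forall>n\<ge>N. L2_inner (\<lambda>x. k x * \<phi> n x) (\<phi> n) \<le> A * (L2_norm (deriv (\<phi> n)))\<^sup>2"
      using supersolution_test_function[OF \<phi> \<open>A > 0\<close> \<psi> k super] by blast
  qed
qed

section \<open>Composition of \<open>H10\<close> functions with continuous functions\<close>

lemma h10_compose_L2:
  assumes "h10 u g" "continuous_on UNIV q"
  shows "(\<lambda>x. q (u x)) \<in> L2"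
proof -
  obtain B where B: "\<And>y. y \<in> {- L2_norm g..L2_norm g} \<Longrightarrow> \<bar>q y\<bar> \<le> B"
    using continuous_bounded_Icc[of "- L2_norm g" "L2_norm g" q] continuous_on_subset[OF assms(2)] by blast
  show ?thesis
  proof (rule L2_bounded[where B = B])
    show "(\<lambda>x. q (u x)) \<in> borel_measurable (lebesgue_on \<Omega>)"
      by (rule measurable_compose[OF L2_measurable[OF h10_L2(1)[OF assms(1)]]
            borel_measurable_continuous_onI[OF assms(2)]])
    show "AE x in lebesgue_on \<Omega>. \<bar>q (u x)\<bar> \<le> B"
      using h10_sup_bound[OF assms(1)] by eventually_elim (intro B, simp add: abs_le_iff)
  qed
qed

text \<open>Convergence of the derivatives in L2 gives uniform convergence up to null sets, with
  values in one compact interval, where \<open>q\<close> is uniformly continuous. The filter is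
  general so that it covers sequences as well as limits in time.\<close>

lemma h10_compose_tendsto:
  assumes u: "\<And>n. h10 (u n) (g n)" "h10 u0 g0" and q: "continuous_on UNIV q"
    and lim: "((\<lambda>n. L2_norm (g n - g0)) \<longlongrightarrow> 0) F"
  shows "((\<lambda>n. L2_norm ((\<lambda>x. q (u n x)) - (\<lambda>x. q (u0 x)))) \<longlongrightarrow> 0) F"
proof (rule tendstoI)
  fix e :: real assume e: "0 < e"
  define M where "M = L2_norm g0 + 1"
  have "uniformly_continuous_on {- M..M} q"
    by (intro compact_uniformly_continuous continuous_on_subset[OF q]) auto
  then obtain d where d: "d > 0"
    "\<And>y y'. y \<in> {- M..M} \<Longrightarrow> y' \<in> {- M..M} \<Longrightarrow> dist y' y < d \<Longrightarrow> dist (q y') (q y) < e / 2"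
    unfolding uniformly_continuous_on_def using e by (meson half_gt_zero)
  have "\<forall>\<^sub>F n in F. L2_norm (g n - g0) < min d 1"
    by (rule order_tendstoD(2)[OF lim]) (use d in simp)
  then show "\<forall>\<^sub>F n in F. dist (L2_norm ((\<lambda>x. q (u n x)) - (\<lambda>x. q (u0 x)))) 0 < e"
  proof eventually_elim
    case (elim n)
    have "AE x in lebesgue_on \<Omega>. \<bar>((\<lambda>x. q (u n x)) - (\<lambda>x. q (u0 x))) x\<bar> \<le> e / 2"
      using h10_sup_bound[OF u(2)] h10_sup_bound[OF h10_diff[OF u(1)[of n] u(2)]]
    proof eventually_elim
      case (elim x)
      then have "\<bar>u n x - u0 x\<bar> < min d 1" using \<open>L2_norm (g n - g0) < min d 1\<close> by simp
      then have "dist (q (u n x)) (q (u0 x)) < e / 2"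
        using elim by (intro d(2)) (auto simp: M_def dist_real_def abs_real_def split: if_splits)
      then show ?case by (simp add: dist_real_def)
    qed
    then have "L2_norm ((\<lambda>x. q (u n x)) - (\<lambda>x. q (u0 x))) \<le> e / 2"
      using e by (intro L2_norm_le_bound L2_diff h10_compose_L2[OF u(1) q] h10_compose_L2[OF u(2) q]) auto
    then show ?case using e by simp
  qed
qed

section \<open>Coercivity at a positive solution\<close>

context reaction
begin

lemma slope_bound_measurable: "slope_bound \<zeta> \<in> borel_measurable borel"
proof -
  have [measurable]: "f \<in> borel_measurable borel"
    using cont by (rule borel_measurable_continuous_onI)
  have "(\<lambda>z. if z < \<zeta> then 1 else 2 * (f z - f (z / 2)) / z) \<in> borel_measurable borel"
    by measurable
  then show ?thesis by (simp add: slope_bound_def[abs_def])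
qed

lemma slope_bound_bounded:
  assumes "0 < \<zeta>"
  obtains B where "\<And>z. 0 \<le> z \<Longrightarrow> z \<le> Z \<Longrightarrow> \<bar>slope_bound \<zeta> z\<bar> \<le> B"
proof -
  obtain B where B: "\<And>y. y \<in> {0..Z} \<Longrightarrow> \<bar>f y\<bar> \<le> B"
    using continuous_bounded_Icc[of 0 Z f] continuous_on_subset[OF cont] by blast
  show thesis
  proof (rule that[of "1 + 4 * B / \<zeta>"])
    fix z assume z: "0 \<le> z" "z \<le> Z"
    have Bz: "\<bar>f z\<bar> \<le> B" "\<bar>f (z / 2)\<bar> \<le> B" using z by (auto intro!: B)
    then have "0 \<le> B" by linarith
    show "\<bar>slope_bound \<zeta> z\<bar> \<le> 1 + 4 * B / \<zeta>"
    proof (cases "z < \<zeta>")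
      case True
      then show ?thesis using \<open>0 \<le> B\<close> assms by (simp add: slope_bound_def)
    next
      case False
      have "\<bar>2 * (f z - f (z / 2)) / z\<bar> = \<bar>2 * (f z - f (z / 2))\<bar> / z" using False assms by simp
      also have "\<dots> \<le> (4 * B) / \<zeta>"
        using False assms Bz \<open>0 \<le> B\<close> by (intro frac_le) auto
      finally show ?thesis using False by (simp add: slope_bound_def)
    qed
  qed
qed

text \<open>
  A positive solution \<open>z\<close> of \<open>A z'' + lam f z = 0\<close> is perturbed to a strict supersolution
  \<open>z + \<kappa> h\<close> with \<open>h = 1 + K x (1 - x)\<close>. Strict concavity of \<open>f\<close> gives room for this away
  from the boundary; near the boundary, where \<open>z\<close> is small, the concavity of \<open>h\<close> does.
\<close>

lemma linearised_coercive:
  fixes lam A :: real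
  assumes "lam > 0" "A > 0"
    and z1: "\<And>x. x \<in> {0..1} \<Longrightarrow> (z has_real_derivative z' x) (at x within {0..1})"
    and z2: "\<And>x. x \<in> {0..1} \<Longrightarrow> (z' has_real_derivative - (lam / A) * f (z x)) (at x within {0..1})"
    and z0: "z 0 = 0" "z 1 = 0" and zpos: "\<And>x. x \<in> \<Omega> \<Longrightarrow> 0 < z x"
  shows "\<exists>\<zeta>>0. \<exists>c>0. \<forall>w g. h10 w g \<longrightarrow>
    (\<lambda>x. slope_bound \<zeta> (z x) * w x) \<in> L2 \<and>
    c * (L2_norm g)\<^sup>2 \<le> A * (L2_norm g)\<^sup>2 - lam * L2_inner (\<lambda>x. slope_bound \<zeta> (z x) * w x) w"
proof -
  have zc: "continuous_on {0..1} z"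
    using z1 by (meson DERIV_continuous continuous_on_eq_continuous_within)
  have fzc: "continuous_on {0..1} (\<lambda>x. f (z x))" "continuous_on {0..1} (\<lambda>x. f (z x / 2))"
    by (rule continuous_on_compose2[OF cont]; use zc in \<open>auto intro!: continuous_intros\<close>)+
  obtain Z where Z: "\<And>x. x \<in> {0..1} \<Longrightarrow> \<bar>z x\<bar> \<le> Z"
    using continuous_bounded_Icc[OF zc] by blast
  have "Z \<ge> 0" using order_trans[OF abs_ge_zero Z[of 0]] by simp
  \<comment> \<open>With this \<open>K\<close> the corrector contributes - A \<kappa> h'' = 2 A K
    \<kappa> = 4 (lam + 1) \<kappa>, that is, four units of size (lam + 1) \<kappa>.\<close>
  define K where "K = 2 * (lam + 1) / A"
  have K: "K > 0" "A * K = 2 * (lam + 1)" using assms by (auto simp: K_def)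
  \<comment> \<open>The set where h \<ge> 2. It is compact inside the open interval, so the
    concavity gap and \<open>z\<close> are bounded below on it; off this set the corrector costs at
    most two units.\<close>
  define mid where "mid = {x \<in> {0..1}. 1 \<le> K * (x * (1 - x))}"
  \<comment> \<open>The gap by which the chord slope over [z/2, z], multiplied by z, falls short of
    f(z).\<close>
  define d where "d = (\<lambda>x. 2 * f (z x / 2) - f (z x))"
  have dpos: "0 < d x" if "x \<in> \<Omega>" for x
    using strict_half[OF zpos[OF that]] by (simp add: d_def)
  have mid\<Omega>: "mid \<subseteq> \<Omega>"
  proof
    fix x assume "x \<in> mid"
    then have x: "0 \<le> x" "x \<le> 1" "1 \<le> K * (x * (1 - x))" by (auto simp: mid_def)
    then have "x \<noteq> 0" "x \<noteq> 1" by auto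
    then show "x \<in> \<Omega>" using x by simp
  qed
  have "\<exists>\<gamma>>0. \<forall>x\<in>mid. \<gamma> \<le> min (d x) (z x)"
  proof (cases "mid = {}")
    case False
    have "compact mid"
    proof -
      have "closed {x. 1 \<le> K * (x * (1 - x))}"
        by (intro closed_Collect_le continuous_intros)
      moreover have "mid = {0..1} \<inter> {x. 1 \<le> K * (x * (1 - x))}" by (auto simp: mid_def)
      ultimately show ?thesis using compact_Int_closed[OF compact_Icc] by metis
    qed
    moreover have "continuous_on mid (\<lambda>x. min (d x) (z x))"
      unfolding d_def
      by (rule continuous_on_subset[where s = "{0..1}"])
        (auto intro!: continuous_intros fzc zc simp: mid_def)
    ultimately obtain x0 where x0: "x0 \<in> mid" "\<And>x. x \<in> mid \<Longrightarrow> min (d x0) (z x0) \<le> min (d x) (z x)"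
      using continuous_attains_inf[of mid "\<lambda>x. min (d x) (z x)"] False by blast
    have "0 < min (d x0) (z x0)" using x0(1) mid\<Omega> dpos zpos by auto
    then show ?thesis using x0(2) by blast
  qed (auto intro: exI[of _ 1])
  then obtain \<gamma> where \<gamma>: "\<gamma> > 0" "\<And>x. x \<in> mid \<Longrightarrow> \<gamma> \<le> d x" "\<And>x. x \<in> mid \<Longrightarrow> \<gamma> \<le> z x"
    by auto
  \<comment> \<open>Chosen so that on \<open>mid\<close>, where only h \<le> 1 + K is known, the
    corrector costs half of the guaranteed gain \<open>lam * \<gamma>\<close>.\<close>
  define \<kappa> where "\<kappa> = lam * \<gamma> / 2 / ((lam + 1) * (1 + K))"
  have pos: "0 < (lam + 1) * (1 + K)"
    using assms(1) K(1) by (intro mult_pos_pos) auto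
  then have "((lam + 1) * (1 + K)) * \<kappa> = lam * \<gamma> / 2"
    unfolding \<kappa>_def by (metis less_irrefl nonzero_mult_div_cancel_left times_divide_eq_right)
  then have \<kappa>: "\<kappa> > 0" "(lam + 1) * \<kappa> * (1 + K) = lam * \<gamma> / 2"
    using assms(1) \<gamma>(1) pos unfolding \<kappa>_def by (auto simp only: mult_ac intro!: divide_pos_pos mult_pos_pos)
  \<comment> \<open>The strictness of the supersolution. The term \<epsilon> z must fit both into
    one unit (lam + 1) \<kappa> and into the remaining half of the gain on \<open>mid\<close>;
    \<open>Z + 1\<close> keeps the denominator positive.\<close>
  define \<epsilon> where "\<epsilon> = min 1 (min ((lam + 1) * \<kappa>) (lam * \<gamma> / 2) / (Z + 1))"
  have \<epsilon>: "\<epsilon> > 0" "\<epsilon> \<le> 1"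
    using assms(1) \<gamma>(1) \<kappa>(1) \<open>Z \<ge> 0\<close> by (auto simp: \<epsilon>_def)
  have \<epsilon>z: "\<epsilon> * z x \<le> (lam + 1) * \<kappa>" "\<epsilon> * z x \<le> lam * \<gamma> / 2" if x: "x \<in> {0..1}" for x
  proof -
    have "\<epsilon> * z x \<le> \<epsilon> * (Z + 1)"
      using Z[OF x] \<epsilon>(1) by (intro mult_left_mono) auto
    also have "\<dots> \<le> min ((lam + 1) * \<kappa>) (lam * \<gamma> / 2) / (Z + 1) * (Z + 1)"
      using \<open>Z \<ge> 0\<close> by (intro mult_right_mono) (auto simp: \<epsilon>_def)
    also have "\<dots> = min ((lam + 1) * \<kappa>) (lam * \<gamma> / 2)" using \<open>Z \<ge> 0\<close> by simp
    finally show "\<epsilon> * z x \<le> (lam + 1) * \<kappa>" "\<epsilon> * z x \<le> lam * \<gamma> / 2" by auto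
  qed
  have "\<exists>e>0. \<forall>y. \<bar>y\<bar> < e \<longrightarrow> lam * (y - f y) \<le> (lam + 1) * \<kappa>"
  proof -
    have "(f \<longlongrightarrow> f 0) (at 0)"
      using cont by (metis UNIV_I continuous_on_def)
    then have "((\<lambda>y. lam * (y - f y)) \<longlongrightarrow> lam * (0 - f 0)) (at 0)"
      by (intro tendsto_intros)
    then have "\<forall>\<^sub>F y in at 0. lam * (y - f y) < (lam + 1) * \<kappa>"
      by (rule order_tendstoD(2)) (use assms(1) \<kappa>(1) in simp)
    then obtain e where "e > 0" "\<And>y. y \<noteq> 0 \<Longrightarrow> dist y 0 < e \<Longrightarrow> lam * (y - f y) < (lam + 1) * \<kappa>"
      by (auto simp: eventually_at)
    moreover have "lam * (0 - f 0) \<le> (lam + 1) * \<kappa>" using assms(1) \<kappa>(1) by simp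
    ultimately show ?thesis by (metis dist_0_norm dist_commute less_imp_le real_norm_def)
  qed
  then obtain e where e: "e > 0" "\<And>y. \<bar>y\<bar> < e \<Longrightarrow> lam * (y - f y) \<le> (lam + 1) * \<kappa>" by blast
  \<comment> \<open>Below \<open>e\<close> the defect z - f(z) costs at most one unit, and below
    \<open>\<gamma>\<close> the point is outside \<open>mid\<close>.\<close>
  define \<zeta> where "\<zeta> = min e \<gamma>"
  have \<zeta>: "\<zeta> > 0" using e(1) \<gamma>(1) by (simp add: \<zeta>_def)
  define s where "s = (\<lambda>x. slope_bound \<zeta> (z x))"
  define k where "k = (\<lambda>x. lam * s x + \<epsilon>)"
  define \<psi> where "\<psi> = (\<lambda>x. z x + \<kappa> * (1 + K * (x * (1 - x))))"
  define \<psi>1 where "\<psi>1 = (\<lambda>x. z' x + \<kappa> * (K * (1 - 2 * x)))"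
  define \<psi>2 where "\<psi>2 = (\<lambda>x. - (lam / A) * f (z x) - 2 * \<kappa> * K)"
  have \<psi>: "(\<psi> has_real_derivative \<psi>1 x) (at x within {0..1})"
    "(\<psi>1 has_real_derivative \<psi>2 x) (at x within {0..1})" if "x \<in> {0..1}" for x
    unfolding \<psi>_def \<psi>1_def \<psi>2_def using z1[OF that] z2[OF that]
    by (auto intro!: derivative_eq_intros simp: algebra_simps)
  have \<psi>2c: "continuous_on {0..1} \<psi>2"
    unfolding \<psi>2_def by (intro continuous_intros fzc)
  have znn: "0 \<le> z x" if "x \<in> {0..1}" for x
    using zpos[of x] z0 that by (cases "x = 0"; cases "x = 1") (auto intro: less_imp_le)
  have \<psi>pos: "0 < \<psi> x" if "x \<in> {0..1}" for x
  proof -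
    have "0 \<le> K * (x * (1 - x))" using that K(1) by simp
    then have "0 < \<kappa> * (1 + K * (x * (1 - x)))" using \<kappa>(1) by (intro mult_pos_pos) auto
    then show ?thesis using znn[OF that] by (simp add: \<psi>_def)
  qed
  have A\<psi>2: "- A * \<psi>2 x = lam * f (z x) + 4 * ((lam + 1) * \<kappa>)" for x
  proof -
    have "- A * \<psi>2 x = lam * f (z x) + 2 * \<kappa> * (A * K)"
      using \<open>A > 0\<close> by (simp add: \<psi>2_def field_simps)
    then show ?thesis unfolding K(2) by (simp add: algebra_simps)
  qed
  have super: "k x * \<psi> x \<le> - A * \<psi>2 x" if x: "x \<in> \<Omega>" for x
  proof -
    have x': "x \<in> {0..1}" using x by simp
    define h where "h = 1 + K * (x * (1 - x))"
    have "x * (1 - x) \<le> 1 * 1" using x by (intro mult_mono) auto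
    then have "K * (x * (1 - x)) \<le> K * 1" using K(1) by (intro mult_left_mono) auto
    then have h: "0 < h" "h \<le> 1 + K" using x K(1) by (auto simp: h_def add_pos_nonneg)
    have L: "0 < (lam + 1) * \<kappa>" using assms(1) \<kappa>(1) by simp
    have hh: "(lam + \<epsilon>) * (\<kappa> * h) \<le> (lam + 1) * \<kappa> * h"
      using \<epsilon>(2) \<kappa>(1) h(1) by (simp add: mult_right_mono)
    have near: "(lam + 1) * \<kappa> * h \<le> 2 * ((lam + 1) * \<kappa>)" if "x \<notin> mid"
    proof -
      have "h \<le> 2" using that x by (simp add: mid_def h_def)
      then have "(lam + 1) * \<kappa> * h \<le> (lam + 1) * \<kappa> * 2"
        using L by (intro mult_left_mono) auto
      then show ?thesis by simp
    qed
    show ?thesis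
    proof (cases "z x < \<zeta>")
      case True
      then have "x \<notin> mid" using \<gamma>(3)[of x] by (auto simp: \<zeta>_def)
      \<comment> \<open>Here the slope bound is 1. The defect z - f(z) and \<epsilon> z cost one
        unit each and the corrector at most two, which matches the four units available.\<close>
      have "lam * (z x - f (z x)) \<le> (lam + 1) * \<kappa>"
        using True zpos[OF x] by (intro e(2)) (simp add: \<zeta>_def)
      then have "lam * z x + \<epsilon> * z x + (lam + \<epsilon>) * (\<kappa> * h) \<le> lam * f (z x) + 4 * ((lam + 1) * \<kappa>)"
        using hh near[OF \<open>x \<notin> mid\<close>] \<epsilon>z(1)[OF x'] by (simp add: right_diff_distrib)
      moreover have "k x * \<psi> x = lam * z x + \<epsilon> * z x + (lam + \<epsilon>) * (\<kappa> * h)"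
        using True by (simp add: k_def s_def slope_bound_def \<psi>_def h_def algebra_simps)
      ultimately show ?thesis unfolding A\<psi>2 by simp
    next
      case False
      \<comment> \<open>The chord slope replaces lam z by lam (f(z) - d). On \<open>mid\<close> this
        gain pays for the corrector and for \<epsilon> z; off \<open>mid\<close> these cost at most
        three of the four units.\<close>
      have sz: "s x * z x = f (z x) - d x"
        using False zpos[OF x] by (simp add: s_def slope_bound_def d_def)
      have "k x * \<psi> x = lam * (s x * z x) + \<epsilon> * z x + (lam * s x + \<epsilon>) * (\<kappa> * h)"
        unfolding k_def \<psi>_def h_def[symmetric] by (simp add: algebra_simps)
      then have "k x * \<psi> x = lam * (f (z x) - d x) + \<epsilon> * z x + (lam * s x + \<epsilon>) * (\<kappa> * h)"
        unfolding sz .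
      moreover have "(lam * s x + \<epsilon>) * (\<kappa> * h) \<le> (lam + \<epsilon>) * (\<kappa> * h)"
        using slope_bound_le_1[OF \<zeta>, of "z x"] assms(1) \<kappa>(1) h(1)
        by (intro mult_right_mono add_right_mono) (auto simp: s_def)
      ultimately have *: "k x * \<psi> x \<le> lam * f (z x) - lam * d x + \<epsilon> * z x + (lam + 1) * \<kappa> * h"
        using hh by (simp add: right_diff_distrib)
      show ?thesis
      proof (cases "x \<in> mid")
        case True
        have "lam * \<gamma> \<le> lam * d x" using \<gamma>(2)[OF True] assms(1) by simp
        moreover have "(lam + 1) * \<kappa> * h \<le> (lam + 1) * \<kappa> * (1 + K)"
          using h(2) L by (intro mult_left_mono) auto
        ultimately have "k x * \<psi> x \<le> lam * f (z x)"
          using * \<kappa>(2) \<epsilon>z(2)[OF x'] by linarith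
        then show ?thesis using L unfolding A\<psi>2 by simp
      next
        case False
        have "0 \<le> lam * d x" using dpos[OF x] assms(1) by simp
        then show ?thesis using * near[OF False] \<epsilon>z(1)[OF x'] L unfolding A\<psi>2 by linarith
      qed
    qed
  qed
  have zm: "z \<in> borel_measurable (lebesgue_on \<Omega>)"
    by (rule continuous_borel_measurable_lebesgue_on[OF zc])
  have sm: "s \<in> borel_measurable (lebesgue_on \<Omega>)"
    unfolding s_def by (rule measurable_compose[OF zm slope_bound_measurable])
  obtain B where B: "\<And>y. 0 \<le> y \<Longrightarrow> y \<le> Z \<Longrightarrow> \<bar>slope_bound \<zeta> y\<bar> \<le> B"
    using slope_bound_bounded[OF \<zeta>] by blast
  have sB: "\<bar>s x\<bar> \<le> B" if "x \<in> \<Omega>" for x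
    unfolding s_def using zpos[OF that] Z[of x] that by (intro B) auto
  have km: "k \<in> borel_measurable (lebesgue_on \<Omega>)" unfolding k_def using sm by simp
  have kB: "\<bar>k x\<bar> \<le> lam * B + \<epsilon>" if "x \<in> \<Omega>" for x
  proof -
    have "\<bar>k x\<bar> \<le> \<bar>lam * s x\<bar> + \<bar>\<epsilon>\<bar>" unfolding k_def by (rule abs_triangle_ineq)
    also have "\<bar>lam * s x\<bar> = lam * \<bar>s x\<bar>" using assms(1) by (simp add: abs_mult)
    also have "lam * \<bar>s x\<bar> \<le> lam * B" using sB[OF that] assms(1) by simp
    finally show ?thesis using \<epsilon>(1) by simp
  qed
  \<comment> \<open>The supersolution yields lam S + \<epsilon> N \<le> X, with S \<le> N because
    the slope is at most 1. Hence (lam + \<epsilon>) S \<le> X, which leaves the fraction \<epsilon>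
    / (\<epsilon> + lam) of X for coercivity.\<close>
  define c where "c = \<epsilon> / (\<epsilon> + lam) * A"
  show ?thesis
  proof (rule exI[of _ \<zeta>], rule conjI[OF \<zeta>], rule exI[of _ c], intro conjI allI impI)
    show "c > 0" using \<epsilon>(1) assms by (simp add: c_def)
    fix w g assume wg: "h10 w g"
    note w = h10_L2(1)[OF wg]
    show sw: "(\<lambda>x. slope_bound \<zeta> (z x) * w x) \<in> L2"
      using L2_mult_bounded(1)[OF sm sB w] by (simp add: s_def)
    define S where "S = L2_inner (\<lambda>x. slope_bound \<zeta> (z x) * w x) w"
    define N where "N = (L2_norm w)\<^sup>2"
    define X where "X = A * (L2_norm g)\<^sup>2"
    have "L2_inner (\<lambda>x. k x * w x) w \<le> X"
      unfolding X_def
      by (rule supersolution_h10[OF wg \<open>A > 0\<close> \<psi> \<psi>2c \<psi>pos km kB super])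
    moreover have "L2_inner (\<lambda>x. k x * w x) w = lam * S + \<epsilon> * N"
      using L2_inner_lincomb_left[OF sw w w, of lam \<epsilon>]
      by (simp add: k_def s_def S_def N_def L2_norm_sq algebra_simps)
    ultimately have X: "lam * S + \<epsilon> * N \<le> X" by simp
    have SN: "S \<le> N"
      unfolding S_def N_def L2_norm_sq L2_inner_def
    proof (rule integral_mono)
      show "slope_bound \<zeta> (z x) * w x * w x \<le> w x * w x" for x
        using slope_bound_le_1[OF \<zeta>, of "z x"] mult_right_mono[of "slope_bound \<zeta> (z x)" 1 "w x * w x"]
        by (simp add: mult.assoc)
    qed (intro L2_mult_integrable sw w)+
    have "c * (L2_norm g)\<^sup>2 = \<epsilon> * X / (\<epsilon> + lam)" by (simp add: c_def X_def)
    also have "\<dots> \<le> X - lam * S"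
    proof -
      have "lam * (lam * S + \<epsilon> * N) \<le> lam * X" using X assms(1) by simp
      moreover have "\<epsilon> * lam * S \<le> \<epsilon> * lam * N" using SN \<epsilon>(1) assms(1) by simp
      ultimately have "\<epsilon> * X \<le> (X - lam * S) * (\<epsilon> + lam)" by (simp add: algebra_simps)
      then show ?thesis using \<epsilon>(1) assms(1) by (simp add: divide_le_eq)
    qed
    finally show "c * (L2_norm g)\<^sup>2 \<le> A * (L2_norm g)\<^sup>2 - lam * L2_inner (\<lambda>x. slope_bound \<zeta> (z x) * w x) w"
      by (simp add: X_def S_def)
  qed
qed

text \<open>The radius is \<open>\<zeta> / 2\<close>: the sup bound turns \<open>H10\<close>
  closeness into pointwise closeness, where the secant bound replaces \<open>f\<close> by the linear
  term with \<open>slope_bound\<close>. The first inequality drives the decay of the distance to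
  \<open>z\<close>, the second makes \<open>z\<close> a strict minimum of the energy.\<close>

lemma locally_coercive:
  fixes lam A :: real
  assumes "lam > 0" "A > 0" and zh: "h10 z gz"
    and z1: "\<And>x. x \<in> {0..1} \<Longrightarrow> (z has_real_derivative z' x) (at x within {0..1})"
    and z2: "\<And>x. x \<in> {0..1} \<Longrightarrow> (z' has_real_derivative - (lam / A) * f (z x)) (at x within {0..1})"
    and z0: "z 0 = 0" "z 1 = 0" and zpos: "\<And>x. x \<in> \<Omega> \<Longrightarrow> 0 < z x"
    and F: "\<And>x. (F has_real_derivative f x) (at x)"
  shows "\<exists>r>0. \<exists>c>0. \<forall>u g. h10 u g \<longrightarrow> L2_norm (g - gz) \<le> r \<longrightarrow>
    c * (L2_norm (g - gz))\<^sup>2 \<le>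
      A * (L2_norm (g - gz))\<^sup>2 - lam * L2_inner (\<lambda>x. f (u x) - f (z x)) (u - z) \<and>
    c * (L2_norm (g - gz))\<^sup>2 \<le> A * (L2_norm (g - gz))\<^sup>2
      - 2 * lam * (LINT x|lebesgue_on \<Omega>. F (u x) - F (z x) - f (z x) * (u x - z x))"
proof -
  obtain \<zeta> c where \<zeta>: "\<zeta> > 0" and c: "c > 0"
    and sL: "\<And>w g. h10 w g \<Longrightarrow> (\<lambda>x. slope_bound \<zeta> (z x) * w x) \<in> L2"
    and coercive: "\<And>w g. h10 w g \<Longrightarrow> c * (L2_norm g)\<^sup>2 \<le>
        A * (L2_norm g)\<^sup>2 - lam * L2_inner (\<lambda>x. slope_bound \<zeta> (z x) * w x) w"
    using linearised_coercive[OF assms(1,2) z1 z2 z0 zpos] by blast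
  have Fc: "continuous_on UNIV F"
    by (intro continuous_at_imp_continuous_on ballI DERIV_isCont[OF F])
  have *: "L2_inner (\<lambda>x. f (u x) - f (z x)) (u - z) \<le> L2_inner (\<lambda>x. slope_bound \<zeta> (z x) * (u - z) x) (u - z)"
      "2 * (LINT x|lebesgue_on \<Omega>. F (u x) - F (z x) - f (z x) * (u x - z x))
        \<le> L2_inner (\<lambda>x. slope_bound \<zeta> (z x) * (u - z) x) (u - z)"
    if u: "h10 u g" and small: "L2_norm (g - gz) \<le> \<zeta> / 2" for u g
  proof -
    note wh = h10_diff[OF u zh]
    note w = h10_L2(1)[OF wh]
    have bound: "AE x in lebesgue_on \<Omega>. \<bar>u x - z x\<bar> \<le> \<zeta> / 2 \<and> 0 \<le> z x"
    proof -
      have "AE x in lebesgue_on \<Omega>. x \<in> \<Omega>" by (rule AE_I2) simp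
      with h10_sup_bound[OF wh] show ?thesis
        by eventually_elim (use small zpos in \<open>auto intro: less_imp_le\<close>)
    qed
    have fz: "(\<lambda>x. f (z x)) \<in> L2" by (rule h10_compose_L2[OF zh cont])
    have fd: "(\<lambda>x. f (u x)) - (\<lambda>x. f (z x)) \<in> L2"
      by (intro L2_diff h10_compose_L2[OF u cont] fz)
    show "L2_inner (\<lambda>x. f (u x) - f (z x)) (u - z) \<le> L2_inner (\<lambda>x. slope_bound \<zeta> (z x) * (u - z) x) (u - z)"
      unfolding L2_inner_def
    proof (rule integral_mono_AE)
      show "AE x in lebesgue_on \<Omega>. (f (u x) - f (z x)) * (u - z) x \<le> slope_bound \<zeta> (z x) * (u - z) x * (u - z) x"
        using bound
        by eventually_elim (use secant_le_slope_bound[OF \<zeta>] in \<open>auto simp: power2_eq_square mult.assoc\<close>)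
      show "integrable (lebesgue_on \<Omega>) (\<lambda>x. (f (u x) - f (z x)) * (u - z) x)"
        using L2_mult_integrable[OF fd w] by simp
      show "integrable (lebesgue_on \<Omega>) (\<lambda>x. slope_bound \<zeta> (z x) * (u - z) x * (u - z) x)"
        by (intro L2_mult_integrable sL[OF wh] w)
    qed
    have "(LINT x|lebesgue_on \<Omega>. F (u x) - F (z x) - f (z x) * (u x - z x))
        \<le> (LINT x|lebesgue_on \<Omega>. 1 / 2 * (slope_bound \<zeta> (z x) * (u - z) x * (u - z) x))"
    proof (rule integral_mono_AE)
      have "integrable (lebesgue_on \<Omega>) (\<lambda>x. f (z x) * (u x - z x))"
        using L2_mult_integrable[OF fz w] by simp
      then show "integrable (lebesgue_on \<Omega>) (\<lambda>x. F (u x) - F (z x) - f (z x) * (u x - z x))"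
        using L2_integrable[OF h10_compose_L2[OF u Fc]] L2_integrable[OF h10_compose_L2[OF zh Fc]]
        by (intro Bochner_Integration.integrable_diff)
      show "integrable (lebesgue_on \<Omega>) (\<lambda>x. 1 / 2 * (slope_bound \<zeta> (z x) * (u - z) x * (u - z) x))"
        by (intro integrable_mult_right L2_mult_integrable sL[OF wh] w)
      show "AE x in lebesgue_on \<Omega>. F (u x) - F (z x) - f (z x) * (u x - z x)
          \<le> 1 / 2 * (slope_bound \<zeta> (z x) * (u - z) x * (u - z) x)"
        using bound
      proof eventually_elim
        case (elim x)
        have "F (u x) - F (z x) - f (z x) * (u x - z x) \<le> slope_bound \<zeta> (z x) / 2 * (u x - z x)\<^sup>2"
          by (rule antiderivative_quadratic_bound[OF F], rule secant_le_slope_bound[OF \<zeta>])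
            (use elim in auto)
        then show ?case by (simp add: power2_eq_square)
      qed
    qed
    then show "2 * (LINT x|lebesgue_on \<Omega>. F (u x) - F (z x) - f (z x) * (u x - z x))
        \<le> L2_inner (\<lambda>x. slope_bound \<zeta> (z x) * (u - z) x) (u - z)"
      by (simp add: L2_inner_def)
  qed
  have r: "\<zeta> / 2 > 0" using \<zeta> by simp
  show ?thesis
  proof (rule exI[of _ "\<zeta> / 2"], rule conjI[OF r], rule exI[of _ c], rule conjI[OF c], intro allI impI conjI)
    fix u g assume ug: "h10 u g" "L2_norm (g - gz) \<le> \<zeta> / 2"
    have co: "c * (L2_norm (g - gz))\<^sup>2 \<le>
        A * (L2_norm (g - gz))\<^sup>2 - lam * L2_inner (\<lambda>x. slope_bound \<zeta> (z x) * (u - z) x) (u - z)"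
      by (rule coercive[OF h10_diff[OF ug(1) zh]])
    have "lam * L2_inner (\<lambda>x. f (u x) - f (z x)) (u - z)
        \<le> lam * L2_inner (\<lambda>x. slope_bound \<zeta> (z x) * (u - z) x) (u - z)"
      using *(1)[OF ug] assms(1) by (intro mult_left_mono) auto
    with co show "c * (L2_norm (g - gz))\<^sup>2 \<le>
        A * (L2_norm (g - gz))\<^sup>2 - lam * L2_inner (\<lambda>x. f (u x) - f (z x)) (u - z)" by linarith
    have "lam * (2 * (LINT x|lebesgue_on \<Omega>. F (u x) - F (z x) - f (z x) * (u x - z x)))
        \<le> lam * L2_inner (\<lambda>x. slope_bound \<zeta> (z x) * (u - z) x) (u - z)"
      using *(2)[OF ug] assms(1) by (intro mult_left_mono) auto
    with co show "c * (L2_norm (g - gz))\<^sup>2 \<le> A * (L2_norm (g - gz))\<^sup>2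
        - 2 * lam * (LINT x|lebesgue_on \<Omega>. F (u x) - F (z x) - f (z x) * (u x - z x))" by simp
  qed
qed

end

subsection \<open>Energy and weak flows\<close>

lemma L2_norm_diff_self [simp]: "L2_norm (u - u) = 0"
  by (simp add: L2_norm_def L2_inner_def)

lemma L2_norm_diff_sq:
  assumes "u \<in> L2" "v \<in> L2"
  shows "(L2_norm (u - v))\<^sup>2 = (L2_norm u)\<^sup>2 - 2 * L2_inner u v + (L2_norm v)\<^sup>2"
  using assms
  by (simp add: L2_norm_sq L2_inner_diff_left L2_inner_diff_right L2_diff L2_inner_commute[of v u])

lemma L2_norm_sq_split:
  assumes "u \<in> L2" "v \<in> L2"
  shows "(L2_norm u)\<^sup>2 = (L2_norm v)\<^sup>2 + 2 * L2_inner v (u - v) + (L2_norm (u - v))\<^sup>2"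
  using L2_norm_diff_sq[OF assms] L2_inner_diff_right[OF assms assms(2)]
  by (simp add: L2_inner_commute[of v u] flip: L2_norm_sq)

text \<open>\<open>\<Phi>\<close> is an antiderivative of \<open>a\<close> extended by
  \<open>a 0\<close> to negative arguments, so that it is differentiable in the two-sided sense at 0
  too. It is only evaluated at squared norms.\<close>

locale gradient_system = reaction f for f :: "real \<Rightarrow> real" +
  fixes a F \<Phi> :: "real \<Rightarrow> real" and lam :: real
  assumes lam: "lam > 0"
    and a_cont: "continuous_on {0..} a" and a_mono: "mono_on {0..} a"
    and a_pos: "\<And>s. s \<ge> 0 \<Longrightarrow> 0 < a s"
    and F: "\<And>x. (F has_real_derivative f x) (at x)"
    and \<Phi>: "\<And>s. (\<Phi> has_real_derivative a (max 0 s)) (at s)"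
begin

lemma F_cont: "continuous_on UNIV F"
  by (intro continuous_at_imp_continuous_on ballI DERIV_isCont[OF F])

lemma \<Phi>_tangent:
  assumes "0 \<le> s" "0 \<le> t"
  shows "\<Phi> s + a s * (t - s) \<le> \<Phi> t"
proof -
  consider "s < t" | "t < s" | "s = t" by linarith
  then show ?thesis
  proof cases
    case 1
    then obtain \<xi> where \<xi>: "s < \<xi>" "\<xi> < t" "\<Phi> t - \<Phi> s = (t - s) * a (max 0 \<xi>)"
      using MVT2[OF 1 \<Phi>] by blast
    have "a s \<le> a (max 0 \<xi>)"
      using assms \<xi> by (intro mono_onD[OF a_mono]) auto
    then have "(t - s) * a s \<le> (t - s) * a (max 0 \<xi>)" using 1 by (intro mult_left_mono) auto
    then show ?thesis using \<xi>(3) by (simp add: mult.commute)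
  next
    case 2
    then obtain \<xi> where \<xi>: "t < \<xi>" "\<xi> < s" "\<Phi> s - \<Phi> t = (s - t) * a (max 0 \<xi>)"
      using MVT2[OF 2 \<Phi>] by blast
    have "a (max 0 \<xi>) \<le> a s"
      using assms \<xi> by (intro mono_onD[OF a_mono]) auto
    then have "(s - t) * a (max 0 \<xi>) \<le> (s - t) * a s" using 2 by (intro mult_left_mono) auto
    then show ?thesis using \<xi>(3) by (simp add: algebra_simps)
  qed simp
qed

definition energy :: "(real \<Rightarrow> real) \<Rightarrow> (real \<Rightarrow> real) \<Rightarrow> real" where
  "energy u g = 1 / 2 * \<Phi> ((L2_norm g)\<^sup>2) - lam * (LINT x|lebesgue_on \<Omega>. F (u x))"

lemma energy_tendsto:
  assumes u: "\<And>n. h10 (u n) (g n)" "h10 u0 g0" and lim: "((\<lambda>n. L2_norm (g n - g0)) \<longlongrightarrow> 0) X"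
  shows "((\<lambda>n. energy (u n) (g n)) \<longlongrightarrow> energy u0 g0) X"
proof -
  note L = h10_L2(2)[OF u(1)] h10_L2(2)[OF u(2)]
  have 1: "((\<lambda>n. \<Phi> ((L2_norm (g n))\<^sup>2)) \<longlongrightarrow> \<Phi> ((L2_norm g0)\<^sup>2)) X"
    by (rule isCont_tendsto_compose[OF DERIV_isCont[OF \<Phi>]])
      (intro tendsto_intros L2_norm_tendsto L lim)
  have one: "(\<lambda>_. 1::real) \<in> L2" by (intro L2_continuous continuous_intros)
  have "((\<lambda>n. L2_inner (\<lambda>x. F (u n x)) (\<lambda>_. 1)) \<longlongrightarrow> L2_inner (\<lambda>x. F (u0 x)) (\<lambda>_. 1)) X"
  proof (rule L2_inner_tendsto)
    show "((\<lambda>n. L2_norm ((\<lambda>x. F (u n x)) - (\<lambda>x. F (u0 x)))) \<longlongrightarrow> 0) X"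
      by (rule h10_compose_tendsto[OF u F_cont lim])
  qed (auto intro: h10_compose_L2[OF u(1) F_cont] h10_compose_L2[OF u(2) F_cont] one)
  then have 2: "((\<lambda>n. LINT x|lebesgue_on \<Omega>. F (u n x)) \<longlongrightarrow> (LINT x|lebesgue_on \<Omega>. F (u0 x))) X"
    by (simp add: L2_inner_def)
  show ?thesis
    unfolding energy_def by (intro tendsto_intros 1 2)
qed

text \<open>
  With \<open>g = u_x\<close> and \<open>h = v_x\<close> this is the value that the equation prescribes for
  \<open>d/dt (u, v)\<close>.
\<close>

definition velocity :: "(real \<Rightarrow> real) \<Rightarrow> (real \<Rightarrow> real) \<Rightarrow> (real \<Rightarrow> real) \<Rightarrow> (real \<Rightarrow> real) \<Rightarrow> real" where
  "velocity u g v h = lam * L2_inner (\<lambda>x. f (u x)) v - a ((L2_norm g)\<^sup>2) * L2_inner g h"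

text \<open>The features of a solution on which the stability argument rests: continuity into
  \<open>H10\<close> at all real times, and the equation in classical form for each fixed
  \<open>v\<close>, at positive times only.\<close>

definition weak_flow :: "(real \<Rightarrow> real \<Rightarrow> real) \<Rightarrow> (real \<Rightarrow> real \<Rightarrow> real) \<Rightarrow> bool" where
  "weak_flow u g \<longleftrightarrow> (\<forall>t. h10 (u t) (g t)) \<and> (\<forall>t. ((\<lambda>s. L2_norm (g s - g t)) \<longlongrightarrow> 0) (at t)) \<and>
     (\<forall>v h t. h10 v h \<longrightarrow> 0 < t \<longrightarrow>
        ((\<lambda>t. L2_inner (u t) v) has_real_derivative velocity (u t) (g t) v h) (at t))"

lemma velocity_tendsto:
  assumes u: "\<And>n. h10 (u n) (g n)" "h10 u0 g0" and v: "\<And>n. h10 (v n) (h n)" "h10 v0 h0"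
    and lim: "((\<lambda>n. L2_norm (g n - g0)) \<longlongrightarrow> 0) X" "((\<lambda>n. L2_norm (h n - h0)) \<longlongrightarrow> 0) X"
  shows "((\<lambda>n. velocity (u n) (g n) (v n) (h n)) \<longlongrightarrow> velocity u0 g0 v0 h0) X"
proof -
  note L = h10_L2[OF u(1)] h10_L2[OF u(2)] h10_L2[OF v(1)] h10_L2[OF v(2)]
  have vlim: "((\<lambda>n. L2_norm (v n - v0)) \<longlongrightarrow> 0) X"
    by (rule Lim_null_comparison[OF always_eventually lim(2)])
      (simp add: h10_L2_norm_le[OF h10_diff[OF v]])
  have "((\<lambda>n. L2_inner (\<lambda>x. f (u n x)) (v n)) \<longlongrightarrow> L2_inner (\<lambda>x. f (u0 x)) v0) X"
    by (rule L2_inner_tendsto[OF _ _ _ _ h10_compose_tendsto[OF u cont lim(1)] vlim])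
      (auto intro: h10_compose_L2[OF u(1) cont] h10_compose_L2[OF u(2) cont] L)
  moreover have "((\<lambda>n. L2_inner (g n) (h n)) \<longlongrightarrow> L2_inner g0 h0) X"
    by (intro L2_inner_tendsto lim L)
  moreover have "((\<lambda>n. a ((L2_norm (g n))\<^sup>2)) \<longlongrightarrow> a ((L2_norm g0)\<^sup>2)) X"
    by (rule continuous_on_tendsto_compose[OF a_cont])
      (auto intro!: tendsto_intros L2_norm_tendsto L lim)
  ultimately show ?thesis
    unfolding velocity_def by (intro tendsto_intros)
qed

lemma velocity_diff:
  assumes "h10 u g" "h10 v h" "h10 w k"
  shows "velocity u g v h - velocity u g w k = velocity u g (v - w) (h - k)"
  using assms h10_L2 h10_compose_L2[OF assms(1) cont]
  by (simp add: velocity_def L2_inner_diff_right algebra_simps)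

section \<open>Derivatives of squared distances along a flow\<close>

context
  fixes u g :: "real \<Rightarrow> real \<Rightarrow> real"
  assumes flow: "weak_flow u g"
begin

lemma flow_h10: "h10 (u t) (g t)"
  using flow by (simp add: weak_flow_def)

lemma flow_cont: "((\<lambda>s. L2_norm (g s - g t)) \<longlongrightarrow> 0) (at t)"
  using flow by (simp add: weak_flow_def)

lemma flow_deriv:
  "h10 v h \<Longrightarrow> 0 < t \<Longrightarrow>
    ((\<lambda>t. L2_inner (u t) v) has_real_derivative velocity (u t) (g t) v h) (at t)"
  using flow by (simp add: weak_flow_def)

lemma flow_L2: "u t \<in> L2" "g t \<in> L2"
  using h10_L2[OF flow_h10] by auto

lemma flow_isCont: "isCont (\<lambda>s. L2_norm (g s - g t)) t"
  using flow_cont by (simp add: isCont_def)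

lemma flow_cont_u: "((\<lambda>s. L2_norm (u s - u t)) \<longlongrightarrow> 0) (at t)"
  by (rule Lim_null_comparison[OF always_eventually flow_cont])
    (simp add: h10_L2_norm_le[OF h10_diff[OF flow_h10 flow_h10]])

lemma flow_norm_isCont:
  assumes "h10 v h"
  shows "isCont (\<lambda>t. L2_norm (g t - h)) t" "isCont (\<lambda>t. (L2_norm (u t - v))\<^sup>2) t"
proof -
  note L = flow_L2 h10_L2[OF assms]
  have eq: "(p - r) - (q - r) = p - q" for p q r :: "real \<Rightarrow> real" by auto
  have "((\<lambda>s. L2_norm ((g s - h) - (g t - h))) \<longlongrightarrow> 0) (at t)"
    unfolding eq by (rule flow_cont)
  then show "isCont (\<lambda>t. L2_norm (g t - h)) t"
    unfolding isCont_def
    by (rule L2_norm_tendsto[OF L2_diff[OF flow_L2(2) L(4)] L2_diff[OF flow_L2(2) L(4)]])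
  have "((\<lambda>s. L2_norm ((u s - v) - (u t - v))) \<longlongrightarrow> 0) (at t)"
    unfolding eq by (rule flow_cont_u)
  then have "((\<lambda>t. L2_norm (u t - v)) \<longlongrightarrow> L2_norm (u t - v)) (at t)"
    by (rule L2_norm_tendsto[OF L2_diff[OF flow_L2(1) L(3)] L2_diff[OF flow_L2(1) L(3)]])
  then show "isCont (\<lambda>t. (L2_norm (u t - v))\<^sup>2) t"
    unfolding isCont_def by (rule tendsto_power)
qed

text \<open>The increment of the squared norm splits as (u(s) - u(t), u(s)) + (u(s) - u(t), u(t)).
  The second term is a pairing with a fixed element. In the first, the mean value theorem is applied
  with u(s) frozen as test element, and continuity of \<open>velocity\<close> in all its arguments
  gives the limit.\<close>

lemma flow_norm_sq_deriv:
  assumes "0 < t"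
  shows "((\<lambda>t. L2_inner (u t) (u t)) has_real_derivative 2 * velocity (u t) (g t) (u t) (g t)) (at t)"
proof -
  have "\<exists>\<xi>. \<bar>\<xi> - t\<bar> \<le> \<bar>s - t\<bar> \<and> (0 < s \<and> s \<noteq> t \<longrightarrow>
      L2_inner (u s) (u s) - L2_inner (u t) (u s) = (s - t) * velocity (u \<xi>) (g \<xi>) (u s) (g s))" for s
  proof -
    have deriv: "((\<lambda>\<tau>. L2_inner (u \<tau>) (u s)) has_real_derivative velocity (u \<tau>) (g \<tau>) (u s) (g s)) (at \<tau>)"
      if "min s t \<le> \<tau>" "0 < min s t" for \<tau>
      by (rule flow_deriv[OF flow_h10]) (use that in auto)
    consider "0 < s" "s < t" | "t < s" | "s \<le> 0 \<or> s = t" by linarith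
    then show ?thesis
    proof cases
      case 1
      then obtain \<xi> where "s < \<xi>" "\<xi> < t" "L2_inner (u t) (u s) - L2_inner (u s) (u s)
          = (t - s) * velocity (u \<xi>) (g \<xi>) (u s) (g s)"
        using MVT2[OF 1(2) deriv] by auto
      then show ?thesis by (intro exI[of _ \<xi>]) (auto simp: algebra_simps)
    next
      case 2
      then obtain \<xi> where "t < \<xi>" "\<xi> < s" "L2_inner (u s) (u s) - L2_inner (u t) (u s)
          = (s - t) * velocity (u \<xi>) (g \<xi>) (u s) (g s)"
        using MVT2[OF 2 deriv] assms by auto
      then show ?thesis by (intro exI[of _ \<xi>]) auto
    qed (auto intro: exI[of _ t])
  qed
  then obtain \<xi> where \<xi>: "\<And>s. \<bar>\<xi> s - t\<bar> \<le> \<bar>s - t\<bar>"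
    "\<And>s. 0 < s \<Longrightarrow> s \<noteq> t \<Longrightarrow>
      L2_inner (u s) (u s) - L2_inner (u t) (u s) = (s - t) * velocity (u (\<xi> s)) (g (\<xi> s)) (u s) (g s)"
    by metis
  have "(\<xi> \<longlongrightarrow> t) (at t)"
  proof (rule LIM_zero_cancel, rule Lim_null_comparison[OF always_eventually])
    have "((\<lambda>s. \<bar>s - t\<bar>) \<longlongrightarrow> \<bar>t - t\<bar>) (at t)" by (intro tendsto_intros)
    then show "((\<lambda>s. \<bar>s - t\<bar>) \<longlongrightarrow> 0) (at t)" by simp
  qed (use \<xi>(1) in auto)
  then have "((\<lambda>s. L2_norm (g (\<xi> s) - g t)) \<longlongrightarrow> L2_norm (g t - g t)) (at t)"
    by (rule isCont_tendsto_compose[OF flow_isCont])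
  then have lim: "((\<lambda>s. velocity (u (\<xi> s)) (g (\<xi> s)) (u s) (g s)) \<longlongrightarrow> velocity (u t) (g t) (u t) (g t)) (at t)"
    using flow_cont by (intro velocity_tendsto flow_h10) auto
  have lim2: "((\<lambda>s. (L2_inner (u s) (u t) - L2_inner (u t) (u t)) / (s - t)) \<longlongrightarrow> velocity (u t) (g t) (u t) (g t)) (at t)"
    using flow_deriv[OF flow_h10 assms] by (simp add: has_field_derivative_iff)
  have "((\<lambda>s. (L2_inner (u s) (u s) - L2_inner (u t) (u t)) / (s - t)) \<longlongrightarrow>
      velocity (u t) (g t) (u t) (g t) + velocity (u t) (g t) (u t) (g t)) (at t)"
  proof (rule Lim_transform_eventually[OF tendsto_add[OF lim lim2]])
    have "\<forall>\<^sub>F s in at t. 0 < s"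
      using order_tendstoD(1)[OF tendsto_ident_at assms] .
    moreover have "\<forall>\<^sub>F s in at t. s \<noteq> t" by (simp add: eventually_at_filter)
    ultimately show "\<forall>\<^sub>F s in at t. velocity (u (\<xi> s)) (g (\<xi> s)) (u s) (g s)
        + (L2_inner (u s) (u t) - L2_inner (u t) (u t)) / (s - t)
        = (L2_inner (u s) (u s) - L2_inner (u t) (u t)) / (s - t)"
    proof eventually_elim
      case (elim s)
      have "velocity (u (\<xi> s)) (g (\<xi> s)) (u s) (g s) = (L2_inner (u s) (u s) - L2_inner (u t) (u s)) / (s - t)"
        using \<xi>(2)[of s] elim by simp
      then show ?case by (simp add: L2_inner_commute[of "u t" "u s"] flip: add_divide_distrib)
    qed
  qed
  then show ?thesis by (simp add: has_field_derivative_iff)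
qed

lemma flow_dist_deriv:
  assumes v: "h10 v h" and "0 < t"
  shows "((\<lambda>t. (L2_norm (u t - v))\<^sup>2) has_real_derivative 2 * velocity (u t) (g t) (u t - v) (g t - h)) (at t)"
proof -
  have "((\<lambda>t. L2_inner (u t) (u t) - 2 * L2_inner (u t) v + L2_inner v v) has_real_derivative
      2 * velocity (u t) (g t) (u t) (g t) - 2 * velocity (u t) (g t) v h) (at t)"
    using flow_norm_sq_deriv[OF assms(2)] flow_deriv[OF assms]
    by (auto intro!: derivative_eq_intros)
  moreover have "2 * velocity (u t) (g t) (u t) (g t) - 2 * velocity (u t) (g t) v h
      = 2 * velocity (u t) (g t) (u t - v) (g t - h)"
    using velocity_diff[OF flow_h10 flow_h10 v, of t t] by simp
  moreover have "(L2_norm (u t - v))\<^sup>2 = L2_inner (u t) (u t) - 2 * L2_inner (u t) v + L2_inner v v" for t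
    using L2_norm_diff_sq[OF flow_L2(1) h10_L2(1)[OF v]] by (simp add: L2_norm_sq)
  ultimately show ?thesis by simp
qed

end

text \<open>
  The evolution variational inequality: \<open>\<Phi>\<close> is convex, and \<open>F\<close> is semiconcave because
  the slopes of \<open>f\<close> do not exceed 1.
\<close>

lemma velocity_le_energy:
  assumes u: "h10 u g" and v: "h10 v h"
  shows "2 * velocity u g (u - v) (g - h) \<le> 2 * (energy v h - energy u g) + lam * (L2_norm (u - v))\<^sup>2"
proof -
  note L = h10_L2[OF u] h10_L2[OF v]
  note C = h10_compose_L2[OF u cont] L2_integrable[OF h10_compose_L2[OF u F_cont]]
    L2_integrable[OF h10_compose_L2[OF v F_cont]]
  have w: "u - v \<in> L2" by (intro L2_diff L)
  have i: "integrable (lebesgue_on \<Omega>) (\<lambda>x. 1 / 2 * ((u - v) x * (u - v) x))"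
    by (intro integrable_mult_right L2_mult_integrable w)
  have "L2_inner (\<lambda>x. f (u x)) (u - v)
      \<le> (LINT x|lebesgue_on \<Omega>. F (u x) - F (v x) + 1 / 2 * ((u - v) x * (u - v) x))"
    unfolding L2_inner_def
  proof (rule integral_mono)
    show "integrable (lebesgue_on \<Omega>) (\<lambda>x. f (u x) * (u - v) x)"
      by (intro L2_mult_integrable C w)
    show "integrable (lebesgue_on \<Omega>) (\<lambda>x. F (u x) - F (v x) + 1 / 2 * ((u - v) x * (u - v) x))"
      by (intro Bochner_Integration.integrable_add Bochner_Integration.integrable_diff C i)
    fix x
    have "F (v x) - F (u x) - f (u x) * (v x - u x) \<le> 1 / 2 * (v x - u x)\<^sup>2"
      by (rule antiderivative_quadratic_bound[OF F]) (simp add: one_sided_Lipschitz)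
    then show "f (u x) * (u - v) x \<le> F (u x) - F (v x) + 1 / 2 * ((u - v) x * (u - v) x)"
      by (simp add: power2_eq_square algebra_simps)
  qed
  also have "\<dots> = (LINT x|lebesgue_on \<Omega>. F (u x)) - (LINT x|lebesgue_on \<Omega>. F (v x)) + 1 / 2 * (L2_norm (u - v))\<^sup>2"
    using C i by (simp add: L2_norm_sq L2_inner_def)
  finally have "lam * (2 * L2_inner (\<lambda>x. f (u x)) (u - v)) \<le> lam * (2 * (LINT x|lebesgue_on \<Omega>. F (u x))
      - 2 * (LINT x|lebesgue_on \<Omega>. F (v x)) + (L2_norm (u - v))\<^sup>2)"
    using lam by (intro mult_left_mono) auto
  moreover have "- (2 * a ((L2_norm g)\<^sup>2) * L2_inner g (g - h)) \<le> \<Phi> ((L2_norm h)\<^sup>2) - \<Phi> ((L2_norm g)\<^sup>2)"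
  proof -
    \<comment> \<open>The square |g|^2 lies above its tangent; with the positive coefficient this
      combines with the tangent inequality for \<open>\<Phi>\<close>.\<close>
    have "0 \<le> (L2_norm g)\<^sup>2 - 2 * L2_inner g h + (L2_norm h)\<^sup>2"
      using L2_norm_diff_sq[OF L(2,4)] zero_le_power2[of "L2_norm (g - h)"] by simp
    then have "- (2 * L2_inner g (g - h)) \<le> (L2_norm h)\<^sup>2 - (L2_norm g)\<^sup>2"
      using L by (simp add: L2_inner_diff_right L2_norm_sq)
    then have "a ((L2_norm g)\<^sup>2) * - (2 * L2_inner g (g - h)) \<le> a ((L2_norm g)\<^sup>2) * ((L2_norm h)\<^sup>2 - (L2_norm g)\<^sup>2)"
      using a_pos[of "(L2_norm g)\<^sup>2"] by (intro mult_left_mono) auto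
    then show ?thesis
      using \<Phi>_tangent[of "(L2_norm g)\<^sup>2" "(L2_norm h)\<^sup>2"] by (simp add: algebra_simps)
  qed
  ultimately show ?thesis
    by (simp add: velocity_def energy_def algebra_simps)
qed

text \<open>
  If the energy increased from \<open>s\<close> to \<open>t\<close>, then after its last minimum \<open>\<sigma>\<close> on
  \<open>[s, t]\<close> the variational inequality would make \<open>exp (- lam \<tau>) |u \<tau> - u \<sigma>|\<^sup>2\<close>
  strictly decrease from zero.
\<close>

lemma energy_nonincreasing:
  assumes flow: "weak_flow u g" and "0 \<le> s" "s \<le> t"
  shows "energy (u t) (g t) \<le> energy (u s) (g s)"
proof (rule ccontr)
  define e where "e = (\<lambda>t. energy (u t) (g t))"
  assume "\<not> energy (u t) (g t) \<le> energy (u s) (g s)"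
  then have lt: "e s < e t" by (simp add: e_def)
  have "isCont e \<tau>" for \<tau>
    unfolding e_def isCont_def by (intro energy_tendsto flow_h10[OF flow] flow_cont[OF flow])
  then have ec: "continuous_on S e" for S by (simp add: continuous_at_imp_continuous_on)
  obtain m where m: "m \<in> {s..t}" "\<And>\<tau>. \<tau> \<in> {s..t} \<Longrightarrow> e m \<le> e \<tau>"
    using continuous_attains_inf[of "{s..t}" e] ec \<open>s \<le> t\<close> by auto
  define M where "M = {s..t} \<inter> {\<tau>. e \<tau> \<le> e m}"
  have "compact M"
    unfolding M_def
    by (intro compact_Int_closed compact_Icc closed_Collect_le ec continuous_on_const)
  moreover have "M \<noteq> {}" using m by (auto simp: M_def)
  ultimately obtain \<sigma> where \<sigma>: "\<sigma> \<in> M" "\<And>\<tau>. \<tau> \<in> M \<Longrightarrow> \<tau> \<le> \<sigma>"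
    using compact_attains_sup[of M] by auto
  have \<sigma>I: "s \<le> \<sigma>" "\<sigma> \<le> t" "e \<sigma> \<le> e m" using \<sigma>(1) by (auto simp: M_def)
  have "e \<sigma> \<le> e s" using m(2)[of s] \<sigma>I \<open>s \<le> t\<close> by auto
  then have "\<sigma> < t" using lt \<sigma>I(2) by (cases "\<sigma> = t") auto
  have after: "e \<sigma> < e \<tau>" if "\<sigma> < \<tau>" "\<tau> \<le> t" for \<tau>
    using \<sigma>(2)[of \<tau>] that \<sigma>I by (fastforce simp: M_def)
  note h\<sigma> = flow_h10[OF flow, of \<sigma>]
  let ?Y = "\<lambda>\<tau>. exp (- lam * \<tau>) * (L2_norm (u \<tau> - u \<sigma>))\<^sup>2"
  have "?Y t < ?Y \<sigma>"
  proof (rule DERIV_neg_imp_decreasing_open[OF \<open>\<sigma> < t\<close>])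
    show "continuous_on {\<sigma>..t} ?Y"
      by (intro continuous_intros continuous_at_imp_continuous_on ballI flow_norm_isCont(2)[OF flow h\<sigma>])
    fix \<tau> assume \<tau>: "\<sigma> < \<tau>" "\<tau> < t"
    let ?D = "2 * velocity (u \<tau>) (g \<tau>) (u \<tau> - u \<sigma>) (g \<tau> - g \<sigma>)"
    have "((\<lambda>\<tau>. exp (- lam * \<tau>)) has_real_derivative - lam * exp (- lam * \<tau>)) (at \<tau>)"
      by (auto intro!: derivative_eq_intros)
    moreover have "((\<lambda>\<tau>. (L2_norm (u \<tau> - u \<sigma>))\<^sup>2) has_real_derivative ?D) (at \<tau>)"
      using flow_dist_deriv[OF flow h\<sigma>] \<tau> \<sigma>I \<open>0 \<le> s\<close> by simp
    ultimately have "(?Y has_real_derivative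
        - lam * exp (- lam * \<tau>) * (L2_norm (u \<tau> - u \<sigma>))\<^sup>2 + ?D * exp (- lam * \<tau>)) (at \<tau>)"
      by (rule DERIV_mult)
    then have "(?Y has_real_derivative
        exp (- lam * \<tau>) * (?D - lam * (L2_norm (u \<tau> - u \<sigma>))\<^sup>2)) (at \<tau>)"
      by (simp add: algebra_simps)
    moreover have "?D - lam * (L2_norm (u \<tau> - u \<sigma>))\<^sup>2 < 0"
      using velocity_le_energy[OF flow_h10[OF flow, of \<tau>] h\<sigma>] after[of \<tau>] \<tau> by (simp add: e_def)
    ultimately show "\<exists>y. (?Y has_real_derivative y) (at \<tau>) \<and> y < 0"
      by (meson exp_gt_zero mult_pos_neg)
  qed
  then have "?Y t < 0" by simp
  moreover have "0 \<le> ?Y t" by (intro mult_nonneg_nonneg) auto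
  ultimately show False by linarith
qed

end

subsection \<open>Stability of a coercive equilibrium\<close>

text \<open>The coercivity estimates appear as assumptions so that the stability proof applies to
  the positive equilibrium and, by symmetry, to its negative, although they are derived only for a
  positive profile.\<close>

locale coercive_equilibrium = gradient_system +
  fixes z gz :: "real \<Rightarrow> real" and r c L :: real
  assumes z: "h10 z gz"
    and stationary: "\<And>v h. h10 v h \<Longrightarrow> velocity z gz v h = 0"
    and L: "L-lipschitz_on {0..} a"
    and r: "r > 0" and c: "c > 0"
    and coercive1: "\<And>u g. h10 u g \<Longrightarrow> L2_norm (g - gz) \<le> r \<Longrightarrow> c * (L2_norm (g - gz))\<^sup>2 \<le>
        a ((L2_norm gz)\<^sup>2) * (L2_norm (g - gz))\<^sup>2 - lam * L2_inner (\<lambda>x. f (u x) - f (z x)) (u - z)"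
    and coercive2: "\<And>u g. h10 u g \<Longrightarrow> L2_norm (g - gz) \<le> r \<Longrightarrow> c * (L2_norm (g - gz))\<^sup>2 \<le>
        a ((L2_norm gz)\<^sup>2) * (L2_norm (g - gz))\<^sup>2
        - 2 * lam * (LINT x|lebesgue_on \<Omega>. F (u x) - F (z x) - f (z x) * (u x - z x))"
begin

text \<open>The tangent of \<open>\<Phi>\<close> at |gz|^2 bounds the elastic part from below;
  stationarity cancels all first-order terms, and the remainder is the quadratic expression in
  \<open>coercive2\<close>.\<close>

lemma energy_lower_bound:
  assumes v: "h10 v h" and small: "L2_norm (h - gz) \<le> r"
  shows "energy z gz + c / 2 * (L2_norm (h - gz))\<^sup>2 \<le> energy v h"
proof -
  let ?A = "a ((L2_norm gz)\<^sup>2)"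
  note H = h10_L2[OF v] h10_L2[OF z]
  have fz: "(\<lambda>x. f (z x)) \<in> L2" by (rule h10_compose_L2[OF z cont])
  have "(L2_norm h)\<^sup>2 - (L2_norm gz)\<^sup>2 = 2 * L2_inner gz (h - gz) + (L2_norm (h - gz))\<^sup>2"
    using L2_norm_sq_split[OF H(2,4)] by simp
  then have "?A * ((L2_norm h)\<^sup>2 - (L2_norm gz)\<^sup>2)
      = 2 * (?A * L2_inner gz (h - gz)) + ?A * (L2_norm (h - gz))\<^sup>2"
    by (simp add: algebra_simps)
  moreover have "?A * L2_inner gz (h - gz) = lam * L2_inner (\<lambda>x. f (z x)) (v - z)"
    using stationary[OF h10_diff[OF v z]] by (simp add: velocity_def)
  moreover have J: "(LINT x|lebesgue_on \<Omega>. F (v x) - F (z x) - f (z x) * (v x - z x))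
      = (LINT x|lebesgue_on \<Omega>. F (v x)) - (LINT x|lebesgue_on \<Omega>. F (z x)) - L2_inner (\<lambda>x. f (z x)) (v - z)"
    using L2_mult_integrable[OF fz L2_diff[OF H(1,3)]] L2_integrable[OF h10_compose_L2[OF v F_cont]]
      L2_integrable[OF h10_compose_L2[OF z F_cont]]
    by (simp add: L2_inner_def)
  moreover have "lam * (LINT x|lebesgue_on \<Omega>. F (v x) - F (z x) - f (z x) * (v x - z x))
      = lam * (LINT x|lebesgue_on \<Omega>. F (v x)) - lam * (LINT x|lebesgue_on \<Omega>. F (z x))
        - lam * L2_inner (\<lambda>x. f (z x)) (v - z)"
    unfolding J by (simp add: right_diff_distrib)
  moreover have "\<Phi> ((L2_norm gz)\<^sup>2) + ?A * ((L2_norm h)\<^sup>2 - (L2_norm gz)\<^sup>2) \<le> \<Phi> ((L2_norm h)\<^sup>2)"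
    by (rule \<Phi>_tangent) auto
  ultimately show ?thesis
    using coercive2[OF v small] unfolding energy_def by linarith
qed

text \<open>Sequential continuity of the energy, turned into a ball by contradiction.\<close>

lemma energy_continuous_at_equilibrium:
  assumes "\<eta> > 0"
  shows "\<exists>\<delta>>0. \<forall>v h. h10 v h \<longrightarrow> L2_norm (h - gz) < \<delta> \<longrightarrow> energy v h < energy z gz + \<eta>"
proof (rule ccontr)
  assume "\<not> ?thesis"
  then have "\<forall>n. \<exists>v h. h10 v h \<and> L2_norm (h - gz) < 1 / real (Suc n) \<and> energy z gz + \<eta> \<le> energy v h"
    by (metis not_less of_nat_0_less_iff zero_less_Suc zero_less_divide_1_iff)
  then obtain v h where vh: "\<And>n. h10 (v n) (h n)" "\<And>n. L2_norm (h n - gz) < 1 / real (Suc n)"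
    "\<And>n. energy z gz + \<eta> \<le> energy (v n) (h n)"
    by metis
  have "(\<lambda>n. L2_norm (h n - gz)) \<longlonglongrightarrow> 0"
    by (rule Lim_null_comparison[OF always_eventually LIMSEQ_Suc[OF lim_const_over_n[of 1]]])
      (use vh(2) in \<open>auto intro: less_imp_le\<close>)
  then have "(\<lambda>n. energy (v n) (h n)) \<longlonglongrightarrow> energy z gz"
    by (rule energy_tendsto[OF vh(1) z])
  then have "energy z gz + \<eta> \<le> energy z gz"
    by (rule LIMSEQ_le_const) (use vh(3) in blast)
  then show False using assms by simp
qed

text \<open>An energy barrier: a flow that leaves must cross the sphere of radius
  \<open>\<epsilon>1\<close>, where the energy exceeds that of \<open>z\<close> by at least c/2
  \<open>\<epsilon>1\<^sup>2\<close>, more than it had at time \<open>s\<close>. The starting time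
  is arbitrary, so that the statement can be applied again once a flow has come close to
  \<open>z\<close>.\<close>

lemma flow_stable:
  assumes "\<epsilon> > 0"
  shows "\<exists>\<delta>>0. \<forall>u g. weak_flow u g \<longrightarrow> (\<forall>s\<ge>0. L2_norm (g s - gz) < \<delta> \<longrightarrow>
    (\<forall>t\<ge>s. L2_norm (g t - gz) < \<epsilon>))"
proof -
  define \<epsilon>1 where "\<epsilon>1 = min \<epsilon> r / 2"
  have \<epsilon>1: "0 < \<epsilon>1" "\<epsilon>1 < \<epsilon>" "\<epsilon>1 \<le> r" using assms r by (auto simp: \<epsilon>1_def)
  obtain \<delta>0 where \<delta>0: "\<delta>0 > 0"
    "\<And>v h. h10 v h \<Longrightarrow> L2_norm (h - gz) < \<delta>0 \<Longrightarrow> energy v h < energy z gz + c / 2 * \<epsilon>1\<^sup>2"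
    using energy_continuous_at_equilibrium[of "c / 2 * \<epsilon>1\<^sup>2"] c \<epsilon>1 by auto
  show ?thesis
  proof (intro exI[of _ "min \<delta>0 \<epsilon>1"] conjI allI impI)
    fix u g s t assume flow: "weak_flow u g" and s: "0 \<le> s" "L2_norm (g s - gz) < min \<delta>0 \<epsilon>1" and t: "s \<le> t"
    show "L2_norm (g t - gz) < \<epsilon>"
    proof (rule ccontr)
      assume "\<not> ?thesis"
      then have "\<exists>\<tau>\<ge>s. \<tau> \<le> t \<and> L2_norm (g \<tau> - gz) = \<epsilon>1"
        using s t \<epsilon>1 flow_norm_isCont(1)[OF flow z]
        by (intro IVT') (auto intro!: continuous_at_imp_continuous_on)
      then obtain \<tau> where \<tau>: "s \<le> \<tau>" "L2_norm (g \<tau> - gz) = \<epsilon>1" by blast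
      have "energy z gz + c / 2 * \<epsilon>1\<^sup>2 \<le> energy (u \<tau>) (g \<tau>)"
        using energy_lower_bound[OF flow_h10[OF flow], of \<tau>] \<tau> \<epsilon>1 by simp
      also have "\<dots> \<le> energy (u s) (g s)"
        by (rule energy_nonincreasing[OF flow s(1) \<tau>(1)])
      also have "\<dots> < energy z gz + c / 2 * \<epsilon>1\<^sup>2"
        using s by (intro \<delta>0(2) flow_h10[OF flow]) auto
      finally show False by simp
    qed
  qed (use \<delta>0 \<epsilon>1 in auto)
qed

text \<open>
  With \<open>n = |h - gz|\<^sup>2\<close> and \<open>b = (gz, h - gz)\<close> the increment of \<open>a\<close> has the sign of
  \<open>2 b + n\<close>, so the product is negative at most for \<open>- n < b < - n / 2\<close>, where the Lipschitz
  bound makes it quadratic in \<open>n\<close>.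
\<close>

lemma nonlocal_term_bound:
  assumes "h \<in> L2"
  shows "- (L / 2) * (L2_norm (h - gz))^4
    \<le> (a ((L2_norm h)\<^sup>2) - a ((L2_norm gz)\<^sup>2)) * L2_inner h (h - gz)"
proof -
  define n where "n = (L2_norm (h - gz))\<^sup>2"
  define b where "b = L2_inner gz (h - gz)"
  define s where "s = (L2_norm gz)\<^sup>2"
  note H = assms h10_L2(2)[OF z]
  have n: "n \<ge> 0" by (simp add: n_def)
  have s: "s \<ge> 0" by (simp add: s_def)
  have "(L2_norm h)\<^sup>2 = s + (2 * b + n)"
    using L2_norm_sq_split[OF H] by (simp add: n_def b_def s_def)
  moreover have inner: "L2_inner h (h - gz) = b + n"
    using H by (simp add: n_def b_def L2_norm_sq L2_inner_diff_left L2_diff)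
  ultimately have hs: "(L2_norm h)\<^sup>2 = s + (2 * b + n)" "0 \<le> s + (2 * b + n)"
    by (auto simp flip: \<open>(L2_norm h)\<^sup>2 = s + (2 * b + n)\<close>)
  have n4: "(L2_norm (h - gz))^4 = n * n" by (simp add: n_def power4_eq_xxxx power2_eq_square)
  let ?\<Delta> = "a (s + (2 * b + n)) - a s"
  have "- (L / 2) * (n * n) \<le> ?\<Delta> * (b + n)"
  proof (cases "0 \<le> 2 * b + n")
    case True
    have "0 \<le> ?\<Delta>"
      using mono_onD[OF a_mono, of s "s + (2 * b + n)"] s True by simp
    then have "0 \<le> ?\<Delta> * (b + n)" using True n by (intro mult_nonneg_nonneg) auto
    moreover have "0 \<le> L" using L by (rule lipschitz_on_nonneg)
    then have "- (L / 2) * (n * n) \<le> 0" by (simp add: mult_nonneg_nonneg)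
    ultimately show ?thesis by linarith
  next
    case False
    have \<Delta>: "?\<Delta> \<le> 0"
      using mono_onD[OF a_mono, of "s + (2 * b + n)" s] hs(2) s False by simp
    have L0: "0 \<le> L" using L by (rule lipschitz_on_nonneg)
    show ?thesis
    proof (cases "b + n \<le> 0")
      case True
      then have "0 \<le> ?\<Delta> * (b + n)" using \<Delta> by (simp add: mult_nonpos_nonpos)
      moreover have "- (L / 2) * (n * n) \<le> 0" using L0 by (simp add: mult_nonneg_nonneg)
      ultimately show ?thesis by linarith
    next
      case pos: False
      \<comment> \<open>Here |2 b + n| \<le> n and 0 < b + n \<le> n / 2, whence the constant L /
        2.\<close>
      have "\<bar>?\<Delta>\<bar> \<le> L * \<bar>2 * b + n\<bar>"
        using lipschitz_onD[OF L, of "s + (2 * b + n)" s] hs(2) s by (simp add: dist_real_def)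
      also have "\<dots> \<le> L * n" using False pos L0 by (intro mult_left_mono) auto
      finally have "- ?\<Delta> * (b + n) \<le> (L * n) * (n / 2)"
        using \<Delta> pos False L0 n by (intro mult_mono) auto
      moreover have "- ?\<Delta> * (b + n) = - (?\<Delta> * (b + n))" by (rule mult_minus_left)
      moreover have "(L * n) * (n / 2) = L / 2 * (n * n)" by simp
      ultimately show ?thesis by linarith
    qed
  qed
  then show ?thesis unfolding n4 inner hs(1) s_def[symmetric] by simp
qed

lemma velocity_coercive:
  assumes v: "h10 v h" and small: "L2_norm (h - gz) \<le> r" "L * (L2_norm (h - gz))\<^sup>2 \<le> c"
  shows "2 * velocity v h (v - z) (h - gz) \<le> - c * (L2_norm (h - gz))\<^sup>2"
proof -
  let ?A = "a ((L2_norm gz)\<^sup>2)" and ?n = "(L2_norm (h - gz))\<^sup>2"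
  note H = h10_L2[OF v] h10_L2[OF z]
  note fL = h10_compose_L2[OF v cont] h10_compose_L2[OF z cont]
  have w: "v - z \<in> L2" "h - gz \<in> L2" using H by (auto intro: L2_diff)
  have "lam * L2_inner (\<lambda>x. f (v x) - f (z x)) (v - z)
      = lam * L2_inner (\<lambda>x. f (v x)) (v - z) - lam * L2_inner (\<lambda>x. f (z x)) (v - z)"
    using L2_inner_diff_left[OF fL w(1)] by (simp add: fun_diff_def right_diff_distrib)
  moreover have "?A * L2_inner gz (h - gz) = lam * L2_inner (\<lambda>x. f (z x)) (v - z)"
    using stationary[OF h10_diff[OF v z]] by (simp add: velocity_def)
  moreover have "?A * ?n = ?A * L2_inner h (h - gz) - ?A * L2_inner gz (h - gz)"
    using L2_inner_diff_left[OF H(2,4) w(2)] by (simp add: L2_norm_sq flip: right_diff_distrib)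
  ultimately have "velocity v h (v - z) (h - gz)
      = - (?A * ?n - lam * L2_inner (\<lambda>x. f (v x) - f (z x)) (v - z))
        - (a ((L2_norm h)\<^sup>2) - ?A) * L2_inner h (h - gz)"
    unfolding velocity_def left_diff_distrib by linarith
  also have "\<dots> \<le> - (c * ?n) + L / 2 * (L2_norm (h - gz))^4"
    using coercive1[OF v small(1)] nonlocal_term_bound[OF H(2)] by simp
  also have "L / 2 * (L2_norm (h - gz))^4 = (L * ?n) * ?n / 2"
    by (simp add: power4_eq_xxxx power2_eq_square)
  also have "(L * ?n) * ?n / 2 \<le> c * ?n / 2"
    using mult_right_mono[OF small(2), of ?n] by simp
  finally show ?thesis by linarith
qed

text \<open>As long as the \<open>H10\<close> distance to \<open>z\<close> stays above
  \<open>\<delta>\<close>, the squared L2 distance falls at rate at least c \<delta>^2. It starts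
  below \<epsilon>^2 and cannot become negative, so by a time depending only on \<epsilon>, \<delta>
  and c the flow has entered the \<delta>-ball, which stability does not let it leave far.\<close>

lemma flow_attracted:
  "\<exists>\<epsilon>>0. \<forall>\<eta>>0. \<exists>T\<ge>0. \<forall>u g. weak_flow u g \<longrightarrow> L2_norm (g 0 - gz) < \<epsilon> \<longrightarrow>
    (\<forall>t\<ge>T. L2_norm (g t - gz) < \<eta>)"
proof -
  have L0: "0 \<le> L" using L by (rule lipschitz_on_nonneg)
  \<comment> \<open>As r1 \<le> 1, squares up to this radius are at most c / (L + 1), and L times
    that is at most c, also for L = 0.\<close>
  define r1 where "r1 = min r (min 1 (c / (L + 1)))"
  have r1: "0 < r1" "r1 \<le> r" "r1 \<le> 1" "r1 \<le> c / (L + 1)" using r c L0 by (auto simp: r1_def)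
  have Lr1: "L * x\<^sup>2 \<le> c" if "0 \<le> x" "x \<le> r1" for x
  proof -
    have "x\<^sup>2 \<le> 1 * x" unfolding power2_eq_square using that r1 by (intro mult_right_mono) auto
    then have "L * x\<^sup>2 \<le> L * (c / (L + 1))" using that r1 L0 by (intro mult_left_mono) auto
    also have "\<dots> \<le> c" using L0 c by (simp add: field_simps)
    finally show ?thesis .
  qed
  obtain \<epsilon> where \<epsilon>: "\<epsilon> > 0"
    "\<And>u g s t. weak_flow u g \<Longrightarrow> 0 \<le> s \<Longrightarrow> L2_norm (g s - gz) < \<epsilon> \<Longrightarrow> s \<le> t \<Longrightarrow> L2_norm (g t - gz) < r1"
    using flow_stable[OF r1(1)] by blast
  show ?thesis
  proof (rule exI[of _ \<epsilon>], rule conjI[OF \<epsilon>(1)], intro allI impI)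
    fix \<eta> :: real assume \<eta>: "\<eta> > 0"
    obtain \<delta> where \<delta>: "\<delta> > 0"
      "\<And>u g s t. weak_flow u g \<Longrightarrow> 0 \<le> s \<Longrightarrow> L2_norm (g s - gz) < \<delta> \<Longrightarrow> s \<le> t \<Longrightarrow> L2_norm (g t - gz) < \<eta>"
      using flow_stable[OF \<eta>] by blast
    define T where "T = \<epsilon>\<^sup>2 / (c * \<delta>\<^sup>2)"
    have T: "0 < T" "T * (c * \<delta>\<^sup>2) = \<epsilon>\<^sup>2" using \<epsilon>(1) c \<delta>(1) by (auto simp: T_def)
    have "\<exists>s\<ge>0. s \<le> T \<and> L2_norm (g s - gz) < \<delta>" if flow: "weak_flow u g" and g0: "L2_norm (g 0 - gz) < \<epsilon>" for u g
    proof (rule ccontr)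
      assume "\<not> ?thesis"
      then have far: "\<delta> \<le> L2_norm (g s - gz)" if "0 \<le> s" "s \<le> T" for s using that by force
      let ?Y = "\<lambda>t. (L2_norm (u t - z))\<^sup>2"
      have Y1: "continuous_on {0..T} ?Y"
        by (intro continuous_at_imp_continuous_on ballI flow_norm_isCont(2)[OF flow z])
      have Y2: "?Y differentiable (at s)" if "0 < s" "s < T" for s
        using flow_dist_deriv[OF flow z that(1)] real_differentiable_def by blast
      obtain l \<xi> where \<xi>: "0 < \<xi>" "\<xi> < T" "(?Y has_real_derivative l) (at \<xi>)" "?Y T - ?Y 0 = (T - 0) * l"
        using MVT[OF T(1) Y1 Y2] by auto
      have "l = 2 * velocity (u \<xi>) (g \<xi>) (u \<xi> - z) (g \<xi> - gz)"
        by (rule DERIV_unique[OF \<xi>(3) flow_dist_deriv[OF flow z \<xi>(1)]])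
      also have "\<dots> \<le> - c * (L2_norm (g \<xi> - gz))\<^sup>2"
      proof (rule velocity_coercive[OF flow_h10[OF flow]])
        have "L2_norm (g \<xi> - gz) < r1" using \<epsilon>(2)[OF flow _ g0] \<xi>(1) by simp
        then show "L2_norm (g \<xi> - gz) \<le> r" "L * (L2_norm (g \<xi> - gz))\<^sup>2 \<le> c"
          using r1 Lr1 by auto
      qed
      also have "\<dots> \<le> - c * \<delta>\<^sup>2"
        using far[of \<xi>] \<xi> c \<delta>(1) by (simp add: power_mono)
      finally have "T * l \<le> T * (- c * \<delta>\<^sup>2)" using T(1) by (intro mult_left_mono) auto
      then have "?Y T \<le> ?Y 0 - \<epsilon>\<^sup>2" using \<xi>(4) T(2) by simp
      moreover have "?Y 0 < \<epsilon>\<^sup>2"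
        using h10_L2_norm_le[OF h10_diff[OF flow_h10[OF flow, of 0] z]] g0
        by (intro power_strict_mono) auto
      moreover have "0 \<le> ?Y T" by simp
      ultimately show False by linarith
    qed
    then show "\<exists>T\<ge>0. \<forall>u g. weak_flow u g \<longrightarrow> L2_norm (g 0 - gz) < \<epsilon> \<longrightarrow>
        (\<forall>t\<ge>T. L2_norm (g t - gz) < \<eta>)"
      using T(1) \<delta>(2) by (intro exI[of _ T]) (meson less_imp_le order_trans)
  qed
qed

end

subsection \<open>Strong solutions are weak flows\<close>

lemma has_weak_deriv_cong_AE_left:
  assumes "has_weak_deriv u g" "u \<in> L2" "v \<in> L2" "AE x in lebesgue_on \<Omega>. u x = v x"
  shows "has_weak_deriv v g"
  unfolding has_weak_deriv_def
proof (intro allI impI)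
  fix \<phi> assume \<phi>: "test_function \<Omega> \<phi>"
  have "L2_inner u (deriv \<phi>) = L2_inner v (deriv \<phi>)"
    using assms(2-4) test_function_deriv_L2[OF \<phi>] by (intro L2_inner_cong_AE) auto
  then show "L2_inner v (deriv \<phi>) = - L2_inner g \<phi>"
    using assms(1) \<phi> by (simp add: has_weak_deriv_def)
qed

lemma test_function_h10: "test_function \<Omega> \<phi> \<Longrightarrow> h10 \<phi> (deriv \<phi>)"
  unfolding h10_def
  by (intro conjI exI[of _ "\<lambda>_. \<phi>"]) (simp_all add: test_function_L2 test_function_deriv_L2)

context gradient_system
begin

text \<open>For test functions this is the weak derivative of \<open>wderiv z\<close> inserted into
  the pointwise equation; continuity of \<open>velocity\<close> extends it to
  \<open>H10\<close>.\<close>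

lemma stationary_velocity:
  assumes st: "stationary_point a f lam z" and v: "h10 v h"
  shows "velocity z (wderiv z) v h = 0"
proof -
  define A where "A = a ((L2_norm (wderiv z))\<^sup>2)"
  have z: "h10 z (wderiv z)" "wderiv z \<in> H1"
    and eq: "AE x in lebesgue_on \<Omega>. - A * wderiv (wderiv z) x = lam * f (z x)"
    using st by (auto simp: stationary_point_def H2_def H10_norm_def A_def intro: H10_h10)
  obtain \<phi> where \<phi>: "\<And>n::nat. test_function \<Omega> (\<phi> n)"
    and lim: "(\<lambda>n. L2_norm (\<phi> n - v)) \<longlonglongrightarrow> 0" "(\<lambda>n. L2_norm (deriv (\<phi> n) - h)) \<longlonglongrightarrow> 0"
    using h10E[OF v] by blast
  have "velocity z (wderiv z) (\<phi> n) (deriv (\<phi> n)) = 0" for n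
  proof -
    note fz = h10_compose_L2[OF z(1) cont]
    have "A * L2_inner (wderiv z) (deriv (\<phi> n)) = L2_inner (\<lambda>x. - A * wderiv (wderiv z) x) (\<phi> n)"
      using wderiv_H1(2)[OF z(2)] \<phi> 
      unfolding L2_inner_cmult_left by (simp add: has_weak_deriv_def)
    also have "\<dots> = L2_inner (\<lambda>x. lam * f (z x)) (\<phi> n)"
      by (intro L2_inner_cong_AE L2_cmult wderiv_H1 z fz test_function_L2 \<phi> eq AE_I2 refl)
    finally show ?thesis
      by (simp add: velocity_def A_def L2_inner_cmult_left)
  qed
  moreover have "(\<lambda>n. velocity z (wderiv z) (\<phi> n) (deriv (\<phi> n))) \<longlonglongrightarrow> velocity z (wderiv z) v h"
    by (rule velocity_tendsto[OF z(1) z(1) test_function_h10[OF \<phi>] v _ lim(2)]) simp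
  ultimately show ?thesis by (simp add: LIMSEQ_const_iff)
qed

text \<open>Extension by the initial value makes all continuity conditions two-sided.\<close>

lemma strong_solution_weak_flow:
  assumes u: "strong_solution a f lam u"
  shows "weak_flow (\<lambda>t. u (max 0 t)) (\<lambda>t. wderiv (u (max 0 t)))"
proof -
  define w where "w = (\<lambda>t. u (max 0 t))"
  define g where "g = (\<lambda>t. wderiv (w t))"
  have H10: "u t \<in> H10" if "0 \<le> t" for t using u that by (simp add: strong_solution_def)
  have h: "h10 (w t) (g t)" for t
    unfolding g_def w_def by (intro H10_h10 H10) simp
  note hL = h10_L2[OF h]
  have gcont: "((\<lambda>s. L2_norm (g s - g t)) \<longlongrightarrow> 0) (at t)" for t
  proof -
    define t0 where "t0 = max 0 t"
    have t0: "0 \<le> t0" by (simp add: t0_def)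
    let ?N = "\<lambda>s. H10_norm (u s - u t0)"
    have eq: "?N s = L2_norm (wderiv (u s) - wderiv (u t0))" if "0 \<le> s" for s
      using h10_norm[OF h10_diff[OF H10_h10[OF H10[OF that]] H10_h10[OF H10[OF t0]]]] .
    have "(?N \<longlongrightarrow> 0) (at t0 within {0..})"
      using u t0 by (simp add: strong_solution_def)
    then have "continuous (at t0 within {0..}) ?N"
      using eq[OF t0] by (simp add: continuous_within)
    then have "((\<lambda>s. ?N (max 0 s)) \<longlongrightarrow> ?N t0) (at t)"
      unfolding t0_def by (rule continuous_within_tendsto_compose) (auto intro!: tendsto_intros)
    then show ?thesis
      using eq[OF t0] eq by (simp add: g_def w_def t0_def)
  qed
  have wcont: "((\<lambda>s. L2_norm (w s - w t)) \<longlongrightarrow> 0) (at t)" for t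
    by (rule Lim_null_comparison[OF always_eventually gcont])
      (simp add: h10_L2_norm_le[OF h10_diff[OF h h]])
  have "((\<lambda>t. L2_inner (w t) v) has_real_derivative velocity (w t) (g t) v k) (at t)"
    if v: "h10 v k" and t: "0 < t" for v k t
  proof -
    \<comment> \<open>Any horizon beyond \<open>t\<close> will do; it only has to contain
      \<open>t\<close> in its interior.\<close>
    define T where "T = t + 1"
    have T: "0 < T" "t < T" using t by (auto simp: T_def)
    note vL = h10_L2[OF v]
    define P where "P = (\<lambda>t. lam * L2_inner (\<lambda>x. f (w t x)) v)"
    define Q where "Q = (\<lambda>t. a ((L2_norm (g t))\<^sup>2) * L2_inner (g t) k)"
    have PQ: "velocity (w s) (g s) v k = P s - Q s" for s
      by (simp add: velocity_def P_def Q_def)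
    have "isCont P s" for s
      unfolding isCont_def P_def
      by (intro tendsto_intros L2_inner_tendsto h10_compose_tendsto[OF h h cont gcont]
          h10_compose_L2[OF h cont] vL) simp
    then have Pc: "continuous_on S P" for S by (simp add: continuous_at_imp_continuous_on)
    have "isCont Q s" for s
      unfolding isCont_def Q_def
    proof (intro tendsto_intros)
      show "((\<lambda>t. a ((L2_norm (g t))\<^sup>2)) \<longlongrightarrow> a ((L2_norm (g s))\<^sup>2)) (at s)"
        by (rule continuous_on_tendsto_compose[OF a_cont])
          (auto intro!: tendsto_intros L2_norm_tendsto hL gcont)
      show "((\<lambda>t. L2_inner (g t) k) \<longlongrightarrow> L2_inner (g s) k) (at s)"
        by (intro L2_inner_tendsto hL vL gcont) simp
    qed
    then have Qc: "continuous_on S Q" for S by (simp add: continuous_at_imp_continuous_on)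
    have "isCont (\<lambda>t. L2_inner (w t) v) s" for s
      unfolding isCont_def by (intro L2_inner_tendsto hL vL wcont) simp
    then have yc: "continuous_on S (\<lambda>t. L2_inner (w t) v)" for S
      by (simp add: continuous_at_imp_continuous_on)
    have PQc: "continuous_on {0..T} (\<lambda>t. P t - Q t)" by (intro continuous_on_diff Pc Qc)
    \<comment> \<open>The equation is stated with the chosen representative \<open>wderiv v\<close>,
      which agrees almost everywhere with \<open>k\<close>.\<close>
    have kv: "L2_inner (g s) (wderiv v) = L2_inner (g s) k" for s
      using h10_wderiv_AE[OF v] by (intro L2_inner_cong_AE hL vL wderiv_H1 h10_H1[OF v]) auto
    have "(LINT t|lebesgue_on {0<..<T}. L2_inner (w t) v * deriv \<phi> t)
        = - (LINT t|lebesgue_on {0<..<T}. (P t - Q t) * \<phi> t)" if \<phi>: "test_function {0<..<T} \<phi>" for \<phi>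
    proof -
      have w_eq: "u s = w s" if "s \<in> {0<..<T}" for s using that by (simp add: w_def)
      have "- (LINT t|lebesgue_on {0<..<T}. L2_inner (u t) v * deriv \<phi> t)
          + (LINT t|lebesgue_on {0<..<T}.
               a ((H10_norm (u t))\<^sup>2) * L2_inner (wderiv (u t)) (wderiv v) * \<phi> t)
          = (LINT t|lebesgue_on {0<..<T}. lam * L2_inner (\<lambda>x. f (u t x)) v * \<phi> t)"
        using u T(1) \<phi> h10_H10[OF v] unfolding strong_solution_def by blast
      moreover have "(LINT t|lebesgue_on {0<..<T}. L2_inner (u t) v * deriv \<phi> t)
          = (LINT t|lebesgue_on {0<..<T}. L2_inner (w t) v * deriv \<phi> t)"
        by (intro Bochner_Integration.integral_cong refl) (use w_eq in simp)
      moreover have "(LINT t|lebesgue_on {0<..<T}.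
               a ((H10_norm (u t))\<^sup>2) * L2_inner (wderiv (u t)) (wderiv v) * \<phi> t)
          = (LINT t|lebesgue_on {0<..<T}. Q t * \<phi> t)"
        by (intro Bochner_Integration.integral_cong refl)
          (use w_eq kv in \<open>simp add: Q_def H10_norm_def g_def\<close>)
      moreover have "(LINT t|lebesgue_on {0<..<T}. lam * L2_inner (\<lambda>x. f (u t x)) v * \<phi> t)
          = (LINT t|lebesgue_on {0<..<T}. P t * \<phi> t)"
        by (intro Bochner_Integration.integral_cong refl) (use w_eq in \<open>simp add: P_def\<close>)
      moreover have "integrable (lebesgue_on {0<..<T}) (\<lambda>t. P t * \<phi> t)"
        "integrable (lebesgue_on {0<..<T}) (\<lambda>t. Q t * \<phi> t)"
        by (intro integrable_mult_continuous integrable_continuous_interval Pc Qc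
            smooth_continuous test_function_smooth[OF \<phi>])+
      ultimately show ?thesis by (simp add: left_diff_distrib)
    qed
    \<comment> \<open>The equation in the sense of distributions has a continuous right-hand side,
      so the pairing is almost everywhere a C^1 function, and everywhere since it is itself
      continuous.\<close>
    then obtain U where U: "\<And>s. s \<in> {0..T} \<Longrightarrow> (U has_real_derivative P s - Q s) (at s within {0..T})"
      "AE s in lebesgue_on {0<..<T}. L2_inner (w s) v = U s"
      using continuous_weak_deriv[OF integrable_continuous_interval[OF yc] PQc T(1)] by blast
    have Uc: "continuous_on {0..T} U"
      using U(1) by (meson DERIV_continuous continuous_on_eq_continuous_within)
    have yU: "L2_inner (w s) v = U s" if "s \<in> {0..T}" for s
      using continuous_AE_eq[OF yc Uc U(2) T(1) that] .
    have "((\<lambda>s. L2_inner (w s) v) has_real_derivative P t - Q t) (at t within {0..T})"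
      by (rule has_field_derivative_transform_within[OF U(1), of _ 1]) (use t T yU in auto)
    then show ?thesis
      using t T by (simp add: PQ at_within_Icc_at)
  qed
  then show ?thesis
    using h gcont unfolding weak_flow_def g_def w_def by blast
qed

end

subsection \<open>Asymptotic stability\<close>

context coercive_equilibrium
begin

lemma H10_norm_diff_equilibrium: "y \<in> H10 \<Longrightarrow> H10_norm (y - z) = L2_norm (wderiv y - gz)"
  by (rule h10_norm[OF h10_diff[OF H10_h10 z]])

text \<open>The semiflow fixes the initial value only almost everywhere, so the bound on the weak
  derivative has to be carried over from \<open>u0\<close> to \<open>u 0\<close>.\<close>

lemma semiflow_setE:
  assumes "y \<in> semiflow_set a f lam t (H10_ball z \<delta>)" "0 \<le> t"
  obtains u g where "weak_flow u g" "L2_norm (g 0 - gz) < \<delta>" "y \<in> H10"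
    "H10_norm (y - z) = L2_norm (g t - gz)"
proof -
  obtain u u0 where u: "strong_solution a f lam u" "y = u t" "AE x in lebesgue_on \<Omega>. u 0 x = u0 x"
    and u0: "u0 \<in> H10" "H10_norm (u0 - z) < \<delta>"
    using assms(1) by (auto simp: semiflow_set_def semiflow_def H10_ball_def)
  have H10: "u s \<in> H10" if "0 \<le> s" for s using u(1) that by (simp add: strong_solution_def)
  note h = H10_h10[OF H10[OF order_refl]] and h0 = H10_h10[OF u0(1)]
  have "AE x in lebesgue_on \<Omega>. u0 x = u 0 x" using u(3) by eventually_elim simp
  then have "has_weak_deriv (u 0) (wderiv u0)"
    by (rule has_weak_deriv_cong_AE_left[OF h10_weak_deriv[OF h0] h10_L2(1)[OF h0] h10_L2(1)[OF h]])
  then have "AE x in lebesgue_on \<Omega>. wderiv (u 0) x = wderiv u0 x"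
    by (rule wderiv_AE_eq[OF h10_L2(1)[OF h] h10_L2(2)[OF h0]])
  then have "AE x in lebesgue_on \<Omega>. (wderiv (u 0) - gz) x = (wderiv u0 - gz) x"
    by eventually_elim simp
  then have "L2_norm (wderiv (u 0) - gz) = L2_norm (wderiv u0 - gz)"
    using h10_L2(2)[OF h0] h10_L2(2)[OF h] h10_L2(2)[OF z]
    by (intro L2_norm_cong_AE L2_diff)
  then have "L2_norm (wderiv (u (max 0 0)) - gz) < \<delta>"
    using u0 H10_norm_diff_equilibrium by simp
  then show thesis
    using that[OF strong_solution_weak_flow[OF u(1)]] H10[OF assms(2)] assms(2) u(2)
      H10_norm_diff_equilibrium by simp
qed

lemma equilibrium_asymptotically_stable: "asymptotically_stable a f lam z"
  unfolding asymptotically_stable_def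
proof
  show "stable a f lam z"
    unfolding stable_def
  proof (intro allI impI)
    fix \<epsilon> :: real assume "0 < \<epsilon>"
    then obtain \<delta> where \<delta>: "\<delta> > 0"
      "\<forall>u g. weak_flow u g \<longrightarrow> (\<forall>s\<ge>0. L2_norm (g s - gz) < \<delta> \<longrightarrow> (\<forall>t\<ge>s. L2_norm (g t - gz) < \<epsilon>))"
      using flow_stable[of \<epsilon>] by auto
    have "semiflow_set a f lam t (H10_ball z \<delta>) \<subseteq> H10_ball z \<epsilon>" if "0 \<le> t" for t
    proof
      fix y assume "y \<in> semiflow_set a f lam t (H10_ball z \<delta>)"
      then obtain u g where "weak_flow u g" "L2_norm (g 0 - gz) < \<delta>" "y \<in> H10"
        "H10_norm (y - z) = L2_norm (g t - gz)"
        using semiflow_setE \<open>0 \<le> t\<close> by metis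
      then show "y \<in> H10_ball z \<epsilon>"
        using \<delta>(2) \<open>0 \<le> t\<close> by (auto simp: H10_ball_def)
    qed
    then show "\<exists>\<delta>>0. \<forall>t\<ge>0. semiflow_set a f lam t (H10_ball z \<delta>) \<subseteq> H10_ball z \<epsilon>"
      using \<delta>(1) by blast
  qed
  obtain \<epsilon> where \<epsilon>: "\<epsilon> > 0"
    and attracted: "\<forall>\<eta>>0. \<exists>T\<ge>0. \<forall>u g. weak_flow u g \<longrightarrow> L2_norm (g 0 - gz) < \<epsilon> \<longrightarrow>
        (\<forall>t\<ge>T. L2_norm (g t - gz) < \<eta>)"
    using flow_attracted by blast
  let ?S = "\<lambda>t. SUP y \<in> semiflow_set a f lam t (H10_ball z \<epsilon>). ennreal (H10_norm (y - z))"
  have "(?S \<longlongrightarrow> 0) at_top"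
  proof (rule order_tendstoI)
    fix b :: ennreal assume "0 < b"
    \<comment> \<open>A supremum of values below a bound may attain it, so strictness needs an
      intermediate level, which is also finite.\<close>
    then obtain b' where b': "0 < b'" "b' < b" using dense by blast
    then obtain \<eta> where \<eta>: "b' = ennreal \<eta>" "0 < \<eta>"
      by (cases b') auto
    obtain T where T: "0 \<le> T"
      "\<forall>u g. weak_flow u g \<longrightarrow> L2_norm (g 0 - gz) < \<epsilon> \<longrightarrow> (\<forall>t\<ge>T. L2_norm (g t - gz) < \<eta>)"
      using attracted \<eta>(2) by blast
    have "?S t < b" if "T \<le> t" for t
    proof -
      have "?S t \<le> ennreal \<eta>"
      proof (rule SUP_least)
        fix y assume "y \<in> semiflow_set a f lam t (H10_ball z \<epsilon>)"
        moreover have "0 \<le> t" using T(1) that by simp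
        ultimately obtain u g where "weak_flow u g" "L2_norm (g 0 - gz) < \<epsilon>"
          "H10_norm (y - z) = L2_norm (g t - gz)"
          using semiflow_setE by metis
        then have "H10_norm (y - z) < \<eta>" using T(2) that by auto
        then show "ennreal (H10_norm (y - z)) \<le> ennreal \<eta>" by (simp add: ennreal_leI)
      qed
      then show ?thesis using b'(2) \<eta>(1) by simp
    qed
    then show "\<forall>\<^sub>F t in at_top. ?S t < b" by (auto simp: eventually_at_top_linorder)
  qed simp
  then show "\<exists>\<epsilon>>0. ((\<lambda>t. SUP y \<in> semiflow_set a f lam t (H10_ball z \<epsilon>). ennreal (H10_norm (y - z)))
      \<longlongrightarrow> 0) at_top"
    using \<epsilon> by blast
qed

section \<open>Reflection to the negative equilibrium\<close>

lemma F_even: "F (- x) = F x"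
proof -
  have "((\<lambda>x. F (- x)) has_real_derivative f (- x) * - 1) (at x)" for x
    by (rule DERIV_chain2[OF F]) (auto intro!: derivative_eq_intros)
  then have "((\<lambda>x. F (- x)) has_real_derivative f x) (at x)" for x
    by (simp add: odd)
  then have "((\<lambda>x. F (- x) - F x) has_real_derivative 0) (at x)" for x
    using DERIV_diff[OF _ F] by fastforce
  then have "F (- x) - F x = F (- 0) - F 0"
    using DERIV_isconst_all by blast
  then show ?thesis by simp
qed

lemma L2_norm_uminus_diff: "L2_norm (- g - h) = L2_norm (g - (- h))"
  by (simp add: L2_norm_def L2_inner_def algebra_simps)

text \<open>As \<open>f\<close> is odd and \<open>F\<close> even, each condition at
  \<open>- z\<close> for \<open>u\<close> is the condition at \<open>z\<close> for
  \<open>- u\<close>.\<close>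

lemma reflected: "coercive_equilibrium f a F \<Phi> lam (- z) (- gz) r c L"
proof unfold_locales
  have n: "L2_norm (- gz) = L2_norm gz" by (simp add: L2_norm_def L2_inner_def)
  show "h10 (- z) (- gz)" by (rule h10_uminus[OF z])
  show "velocity (- z) (- gz) v h = 0" if "h10 v h" for v h
    using stationary[OF that] by (simp add: velocity_def n odd) (simp add: L2_inner_def)
  fix u g assume u: "h10 u g" "L2_norm (g - (- gz)) \<le> r"
  have small: "L2_norm (- g - gz) \<le> r" using u(2) by (simp only: L2_norm_uminus_diff)
  have "L2_inner (\<lambda>x. f ((- u) x) - f (z x)) (- u - z) = L2_inner (\<lambda>x. f (u x) - f ((- z) x)) (u - (- z))"
    by (simp add: L2_inner_def odd algebra_simps)
  then show "c * (L2_norm (g - (- gz)))\<^sup>2 \<le> a ((L2_norm (- gz))\<^sup>2) * (L2_norm (g - (- gz)))\<^sup>2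
      - lam * L2_inner (\<lambda>x. f (u x) - f ((- z) x)) (u - (- z))"
    using coercive1[OF h10_uminus[OF u(1)] small] by (simp only: n L2_norm_uminus_diff)
  have "(LINT x|lebesgue_on \<Omega>. F ((- u) x) - F (z x) - f (z x) * ((- u) x - z x))
      = (LINT x|lebesgue_on \<Omega>. F (u x) - F ((- z) x) - f ((- z) x) * (u x - (- z) x))"
    by (simp add: F_even odd algebra_simps)
  then show "c * (L2_norm (g - (- gz)))\<^sup>2 \<le> a ((L2_norm (- gz))\<^sup>2) * (L2_norm (g - (- gz)))\<^sup>2
      - 2 * lam * (LINT x|lebesgue_on \<Omega>. F (u x) - F ((- z) x) - f ((- z) x) * (u x - (- z) x))"
    using coercive2[OF h10_uminus[OF u(1)] small] by (simp only: n L2_norm_uminus_diff)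
qed (use L r c in auto)

end

text \<open>There are exactly two zeros, and both endpoints are among them, so \<open>x1 = 0\<close>
  and \<open>x2 = 1\<close>.\<close>

lemma is_u_plus_1_positive:
  assumes "is_u_plus a f lam 1 z" "z 0 = 0" "z 1 = 0" "x \<in> \<Omega>"
  shows "0 < z x"
proof -
  obtain x1 x2 where x: "0 \<le> x1" "x1 < x2" "x2 \<le> 1" "{x \<in> {0..x2}. z x = 0} = {x1, x2}"
    "\<forall>x\<in>{x1<..<x2}. z x > 0" and card: "card {x \<in> {0..1}. z x = 0} = 2"
    using assms(1) unfolding is_u_plus_def by auto
  have "{x1, x2} \<subseteq> {x \<in> {0..1}. z x = 0}" using x(1-4) by fastforce
  moreover have "finite {x \<in> {0..1}. z x = 0}" by (rule card_ge_0_finite, subst card) simp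
  moreover have "card {x1, x2} = 2" using x(2) by simp
  ultimately have "{x1, x2} = {x \<in> {0..1}. z x = 0}"
    using card by (intro card_subset_eq) auto
  moreover have "0 \<in> {x \<in> {0..1}. z x = 0}" "1 \<in> {x \<in> {0..1}. z x = 0}" using assms(2,3) by auto
  ultimately have "0 \<in> {x1, x2}" "1 \<in> {x1, x2}" by auto
  then have "x1 = 0" "x2 = 1" using x(1-3) by auto
  then show ?thesis using x(5) assms(4) by simp
qed

theorem theorem46:
  fixes f a :: "real \<Rightarrow> real"
    and lam p C1 C2 C3 C4 m M1 :: real
    and k :: nat
    and u1_plus u1_minus :: "real \<Rightarrow> real"
  assumes "lam > 0"
    and "continuous_on UNIV f" and "\<And>u. f (- u) = - f u" and "f 0 = 0"
    and "(f has_real_derivative 1) (at 0)"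
    and "strictly_concave_on {0<..} f" and "strictly_convex_on {..<0} f"
    and "p \<ge> 2" and "C1 > 0" and "C2 > 0" and "C3 > 0" and "C4 > 0"
    and "\<And>u. \<bar>f u\<bar> \<le> C1 + C2 * \<bar>u\<bar> powr (p - 1)"
    and "p > 2 \<Longrightarrow> (\<And>u. f u * u \<le> C3 - C4 * \<bar>u\<bar> powr p)"
    and "p = 2 \<Longrightarrow> Limsup at_top (\<lambda>u. ereal (f u / u)) \<le> 0"
    and "p = 2 \<Longrightarrow> Limsup at_bot (\<lambda>u. ereal (f u / u)) \<le> 0"
    and "continuous_on {0..} a" and "mono_on {0..} a"
    and "\<exists>L. L-lipschitz_on {0..} a"
    and "0 < m" and "\<And>s. s \<ge> 0 \<Longrightarrow> m \<le> a s \<and> a s \<le> M1"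
    and "k \<ge> 1"
    and "a 0 * pi\<^sup>2 * (real k)\<^sup>2 < lam" and "lam \<le> a 0 * pi\<^sup>2 * (real k + 1)\<^sup>2"
    and "is_u_plus a f lam 1 u1_plus" and "u1_minus = - u1_plus"
  shows "asymptotically_stable a f lam u1_plus \<and> asymptotically_stable a f lam u1_minus"
proof -
  note up = assms(25)
  interpret reaction f
    using assms(2,3,5,6) by unfold_locales
  define z where "z = u1_plus"
  define gz where "gz = wderiv z"
  define A where "A = a ((H10_norm z)\<^sup>2)"
  have sp: "stationary_point a f lam z" "continuous_on {0..1} z"
    using up by (auto simp: is_u_plus_def z_def)
  have zh: "h10 z gz"
    using sp(1) unfolding gz_def stationary_point_def by (intro H10_h10) auto
  have a_pos: "0 < a s" if "s \<ge> 0" for s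
    using assms(20) assms(21)[OF that] by linarith
  have A: "A > 0" by (simp add: A_def a_pos)
  have A_eq: "A = a ((L2_norm gz)\<^sup>2)" by (simp add: A_def H10_norm_def gz_def)
  obtain z' where z': "\<And>x. x \<in> {0..1} \<Longrightarrow> (z has_real_derivative z' x) (at x within {0..1})"
    "\<And>x. x \<in> {0..1} \<Longrightarrow> (z' has_real_derivative - (lam / A) * f (z x)) (at x within {0..1})"
    "z 0 = 0" "z 1 = 0"
    using stationary_point_regular[OF sp cont A_def A] by blast
  have zpos: "0 < z x" if "x \<in> \<Omega>" for x
    using is_u_plus_1_positive[OF up] z'(3,4) that by (simp add: z_def)
  obtain F where F: "\<And>x. (F has_real_derivative f x) (at x)"
    using continuous_imp_antiderivative[OF cont] by blast
  have "continuous_on UNIV (\<lambda>s. a (max 0 s))"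
    by (rule continuous_on_compose2[OF assms(17)]) (auto intro!: continuous_intros)
  then obtain \<Phi> where \<Phi>: "\<And>s. (\<Phi> has_real_derivative a (max 0 s)) (at s)"
    using continuous_imp_antiderivative by blast
  interpret gradient_system f a F \<Phi> lam
    using assms(1,17,18) a_pos F \<Phi> by unfold_locales
  obtain L where L: "L-lipschitz_on {0..} a" using assms(19) by blast
  obtain r c where rc: "r > 0" "c > 0"
    and c1: "\<And>u g. h10 u g \<Longrightarrow> L2_norm (g - gz) \<le> r \<Longrightarrow> c * (L2_norm (g - gz))\<^sup>2 \<le>
        A * (L2_norm (g - gz))\<^sup>2 - lam * L2_inner (\<lambda>x. f (u x) - f (z x)) (u - z)"
    and c2: "\<And>u g. h10 u g \<Longrightarrow> L2_norm (g - gz) \<le> r \<Longrightarrow> c * (L2_norm (g - gz))\<^sup>2 \<le>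
        A * (L2_norm (g - gz))\<^sup>2
        - 2 * lam * (LINT x|lebesgue_on \<Omega>. F (u x) - F (z x) - f (z x) * (u x - z x))"
    using locally_coercive[OF assms(1) A zh z' zpos F] by blast
  have equilibrium: "coercive_equilibrium f a F \<Phi> lam z gz r c L"
    using zh stationary_velocity[OF sp(1)] L rc c1 c2
    unfolding A_eq gz_def by unfold_locales
  show ?thesis
    using coercive_equilibrium.equilibrium_asymptotically_stable[OF equilibrium]
      coercive_equilibrium.equilibrium_asymptotically_stable[OF
        coercive_equilibrium.reflected[OF equilibrium]] assms(26)
    by (simp add: z_def)
qed

end
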